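(* Let $G$ be a Polish group acting in a Borel manner (not necessarily preserving the measure) on a standard probability space $(X,\mu)$. Then the associated orbit full group $$[\mathcal R_G]=\{T\in\mathrm{Aut}(X,\mu): \forall x\in X,\ T(x)\in G\cdot x\}$$ is a Polish group for the topology of convergence in measure. This topology is weaker than the uniform topology and refines the weak topology. Moreover, if the $G$-action is essentially free and measure preserving, then $G$ embeds (as a topological group) into $[\mathcal R_G]$.
   Context: A standard probability space is a standard Borel space equipped with a non-atomic Borel probability measure. $\mathrm{Aut}(X,\mu)$ is the group of measure-preserving Borel bijections of $(X,\mu)$, identified when equal almost everywhere. The weak topology on it is the one for which $T_n\to T$ iff $\mu(T_n(A)\triangle T(A))\to0$ for all measurable $A$; the uniform topology is induced by the metric $d_u(T,S)=\mu(\{x:Tx\neq Sx\})$. A Borel action means that the action map $G\times X\to X$ is Borel. In the definition of $[\mathcal R_G]$ the condition "for all $x$" is understood up to modifying $T$ on a null set; equivalently, $T(x)\in G\cdot x$ for almost every $x$. The action is essentially free if there is a full measure $G$-invariant subset $A\subseteq X$ such that $gx\neq x$ for every $g\in G\setminus\{1_G\}$ and every $x\in A$. For a Polish space $Y$, $\mathrm L^0(X,\mu,Y)$ is the space of ($\mu$-)measurable maps $X\to Y$ up to equality a.e., with the topology of convergence in measure, i.e. the topology induced by $\tilde d(f,g)=\int_X d(f(x),g(x))\,d\mu(x)$ for any compatible bounded metric $d$ on $Y$ (the topology does not depend on $d$). Define $\Phi:\mathrm L^0(X,\mu,G)\to \mathrm L^0(X,\mu,X)$ by $\Phi(f)(x)=f(x)\cdot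 x$ and view $\mathrm{Aut}(X,\mu)\subseteq \mathrm L^0(X,\mu,X)$. Put $\widetilde{[\mathcal R_G]}:=\Phi^{-1}(\mathrm{Aut}(X,\mu))$, with the subspace topology from $\mathrm L^0(X,\mu,G)$. Then $\Phi(\widetilde{[\mathcal R_G]})=[\mathcal R_G]$, and the topology of convergence in measure on $[\mathcal R_G]$ is by definition the quotient topology induced by the surjection $\Phi:\widetilde{[\mathcal R_G]}\to[\mathcal R_G]$. *)

theory Defs
  imports "HOL-Probability.Probability" "HOL-Algebra.Group_Action"
begin

definition polish_topology :: "'a topology \<Rightarrow> bool" where
  "polish_topology T \<longleftrightarrow> separable_space T \<and> completely_metrizable_space T"

definition borel_of :: "'a topology \<Rightarrow> 'a measure" where
  "borel_of T = sigma (topspace T) {U. openin T U}"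

definition topological_group :: "('g, 'm) monoid_scheme \<Rightarrow> 'g topology \<Rightarrow> bool" where
  "topological_group G T \<longleftrightarrow>
     group G \<and> topspace T = carrier G \<and>
     continuous_map (prod_topology T T) T (\<lambda>(x, y). x \<otimes>\<^bsub>G\<^esub> y) \<and>
     continuous_map T T (\<lambda>x. inv\<^bsub>G\<^esub> x)"

definition polish_group :: "('g, 'm) monoid_scheme \<Rightarrow> 'g topology \<Rightarrow> bool" where
  "polish_group G T \<longleftrightarrow> topological_group G T \<and> polish_topology T"

definition standard_borel :: "'x measure \<Rightarrow> bool" where
  "standard_borel M \<longleftrightarrow>
     (\<exists>T. polish_topology T \<and> topspace T = space M \<and> sets M = sets (borel_of T))"

definition nonatomic :: "'x measure \<Rightarrow> bool" where
  "nonatomic M \<longleftrightarrow>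
     (\<forall>A\<in>sets M. emeasure M A > 0 \<longrightarrow>
        (\<exists>B\<in>sets M. B \<subseteq> A \<and> 0 < emeasure M B \<and> emeasure M B < emeasure M A))"

definition standard_prob_space :: "'x measure \<Rightarrow> bool" where
  "standard_prob_space M \<longleftrightarrow> standard_borel M \<and> prob_space M \<and> nonatomic M"

definition ae_rel :: "'x measure \<Rightarrow> 'y measure \<Rightarrow> (('x \<Rightarrow> 'y) \<times> ('x \<Rightarrow> 'y)) set" where
  "ae_rel M N = {(f, g). f \<in> measurable M N \<and> g \<in> measurable M N \<and> (AE x in M. f x = g x)}"

definition ae_class :: "'x measure \<Rightarrow> 'y measure \<Rightarrow> ('x \<Rightarrow> 'y) \<Rightarrow> ('x \<Rightarrow> 'y) set" where
  "ae_class M N f = ae_rel M N `` {f}"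

text \<open>The points of \<open>L0 M N\<close> are the almost everywhere equality classes. Every map that is measurable
  for the completion of \<open>M\<close> with values in a Polish space agrees almost everywhere with one that
  is measurable for \<open>M\<close>, so using the latter gives the same classes.\<close>

definition L0 :: "'x measure \<Rightarrow> 'y measure \<Rightarrow> ('x \<Rightarrow> 'y) set set" where
  "L0 M N = measurable M N // ae_rel M N"

text \<open>An arbitrary representative; every operation on classes below that uses it is independent of
  the choice.\<close>

definition rep :: "('x \<Rightarrow> 'y) set \<Rightarrow> 'x \<Rightarrow> 'y" where
  "rep C = (SOME f. f \<in> C)"

definition L0_dist :: "'x measure \<Rightarrow> ('y \<Rightarrow> 'y \<Rightarrow> real) \<Rightarrow> ('x \<Rightarrow> 'y) set \<Rightarrow> ('x \<Rightarrow> 'y) set \<Rightarrow> real" where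
  "L0_dist M d F H = (\<integral>x. d (rep F x) (rep H x) \<partial>M)"

definition compatible_bounded_metric :: "'y topology \<Rightarrow> ('y \<Rightarrow> 'y \<Rightarrow> real) \<Rightarrow> bool" where
  "compatible_bounded_metric T d \<longleftrightarrow>
     Metric_space (topspace T) d \<and> Metric_space.mtopology (topspace T) d = T \<and>
     (\<exists>B. \<forall>x\<in>topspace T. \<forall>y\<in>topspace T. d x y \<le> B)"

text \<open>The topology of convergence in measure, computed from a compatible bounded metric \<open>d\<close> on the
  target \<open>T\<close>. It does not depend on the choice of \<open>d\<close>.\<close>

definition L0_topology ::
    "'x measure \<Rightarrow> 'y topology \<Rightarrow> ('y \<Rightarrow> 'y \<Rightarrow> real) \<Rightarrow> ('x \<Rightarrow> 'y) set topology" where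
  "L0_topology M T d = Metric_space.mtopology (L0 M (borel_of T)) (L0_dist M d)"

definition mp_bijections :: "'x measure \<Rightarrow> ('x \<Rightarrow> 'x) set" where
  "mp_bijections M =
     {T \<in> measurable M M. bij_betw T (space M) (space M) \<and> distr M M T = M}"

text \<open>As a subset of \<open>L0 M M\<close>: an element is the class of all measurable maps that agree almost
  everywhere with some measure-preserving Borel bijection.\<close>

definition Aut :: "'x measure \<Rightarrow> ('x \<Rightarrow> 'x) set set" where
  "Aut M = ae_class M M ` mp_bijections M"

text \<open>The coarsest topology making each pseudometric \<open>(S, T) \<mapsto> \<mu>(S(A) \<triangle> T(A))\<close> continuous. Images are
  taken under genuinely bijective representatives, since the image of \<open>A\<close> under an arbitrary
  representative is not determined up to a null set.\<close>

definition weak_topology :: "'x measure \<Rightarrow> ('x \<Rightarrow> 'x) set topology" where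
  "weak_topology M = topology_generated_by
     {{ae_class M M S | S. S \<in> mp_bijections M \<and> measure M (sym_diff (S ` A) (T ` A)) < e}
      | T A e. T \<in> mp_bijections M \<and> A \<in> sets M \<and> e > 0}"

definition uniform_dist :: "'x measure \<Rightarrow> ('x \<Rightarrow> 'x) set \<Rightarrow> ('x \<Rightarrow> 'x) set \<Rightarrow> real" where
  "uniform_dist M C D = measure M {x \<in> space M. rep C x \<noteq> rep D x}"

definition uniform_topology :: "'x measure \<Rightarrow> ('x \<Rightarrow> 'x) set topology" where
  "uniform_topology M = Metric_space.mtopology (Aut M) (uniform_dist M)"

definition borel_action ::
    "('g, 'm) monoid_scheme \<Rightarrow> 'g topology \<Rightarrow> 'x measure \<Rightarrow> ('g \<Rightarrow> 'x \<Rightarrow> 'x) \<Rightarrow> bool" where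
  "borel_action G T M \<phi> \<longleftrightarrow>
     group_action G (space M) \<phi> \<and>
     (\<lambda>(g, x). \<phi> g x) \<in> measurable (borel_of T \<Otimes>\<^sub>M M) M"

definition measure_preserving_action ::
    "('g, 'm) monoid_scheme \<Rightarrow> 'x measure \<Rightarrow> ('g \<Rightarrow> 'x \<Rightarrow> 'x) \<Rightarrow> bool" where
  "measure_preserving_action G M \<phi> \<longleftrightarrow> (\<forall>g\<in>carrier G. distr M M (\<phi> g) = M)"

definition essentially_free ::
    "('g, 'm) monoid_scheme \<Rightarrow> 'x measure \<Rightarrow> ('g \<Rightarrow> 'x \<Rightarrow> 'x) \<Rightarrow> bool" where
  "essentially_free G M \<phi> \<longleftrightarrow>
     (\<exists>A \<subseteq> space M. (AE x in M. x \<in> A) \<and>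
        (\<forall>g\<in>carrier G. \<forall>x\<in>A. \<phi> g x \<in> A) \<and>
        (\<forall>g\<in>carrier G - {\<one>\<^bsub>G\<^esub>}. \<forall>x\<in>A. \<phi> g x \<noteq> x))"

definition orbit_full_set ::
    "('g, 'm) monoid_scheme \<Rightarrow> 'x measure \<Rightarrow> ('g \<Rightarrow> 'x \<Rightarrow> 'x) \<Rightarrow> ('x \<Rightarrow> 'x) set set" where
  "orbit_full_set G M \<phi> =
     {ae_class M M T | T. T \<in> mp_bijections M \<and> (AE x in M. T x \<in> orbit G \<phi> x)}"

definition orbit_full_group ::
    "('g, 'm) monoid_scheme \<Rightarrow> 'x measure \<Rightarrow> ('g \<Rightarrow> 'x \<Rightarrow> 'x) \<Rightarrow> ('x \<Rightarrow> 'x) set monoid" where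
  "orbit_full_group G M \<phi> =
     \<lparr>carrier = orbit_full_set G M \<phi>,
      mult = (\<lambda>C D. ae_class M M (rep C \<circ> rep D)),
      one = ae_class M M (\<lambda>x. x)\<rparr>"

definition Phi :: "'x measure \<Rightarrow> ('g \<Rightarrow> 'x \<Rightarrow> 'x) \<Rightarrow> ('x \<Rightarrow> 'g) set \<Rightarrow> ('x \<Rightarrow> 'x) set" where
  "Phi M \<phi> F = ae_class M M (\<lambda>x. \<phi> (rep F x) x)"

definition orbit_full_lift ::
    "'g topology \<Rightarrow> 'x measure \<Rightarrow> ('g \<Rightarrow> 'x \<Rightarrow> 'x) \<Rightarrow> ('x \<Rightarrow> 'g) set set" where
  "orbit_full_lift T M \<phi> = {F \<in> L0 M (borel_of T). Phi M \<phi> F \<in> Aut M}"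

definition quotient_topology :: "'a topology \<Rightarrow> 'b set \<Rightarrow> ('a \<Rightarrow> 'b) \<Rightarrow> 'b topology" where
  "quotient_topology X Y q = topology (\<lambda>U. U \<subseteq> Y \<and> openin X {x \<in> topspace X. q x \<in> U})"

lemma openin_quotient_topology:
  "openin (quotient_topology X Y q) U \<longleftrightarrow> U \<subseteq> Y \<and> openin X {x \<in> topspace X. q x \<in> U}"
proof -
  have "istopology (\<lambda>U. U \<subseteq> Y \<and> openin X {x \<in> topspace X. q x \<in> U})"
    unfolding istopology_def
  proof (intro conjI allI impI)
    fix S T
    assume S: "S \<subseteq> Y \<and> openin X {x \<in> topspace X. q x \<in> S}"
      and T: "T \<subseteq> Y \<and> openin X {x \<in> topspace X. q x \<in> T}"
    have "{x \<in> topspace X. q x \<in> S \<inter> T} = {x \<in> topspace X. q x \<in> S} \<inter> {x \<in> topspace X. q x \<in> T}"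
      by blast
    then show "openin X {x \<in> topspace X. q x \<in> S \<inter> T}" using S T by auto
    show "S \<inter> T \<subseteq> Y" using S by blast
  next
    fix \<K>
    assume K: "\<forall>K\<in>\<K>. K \<subseteq> Y \<and> openin X {x \<in> topspace X. q x \<in> K}"
    have "{x \<in> topspace X. q x \<in> \<Union>\<K>} = (\<Union>K\<in>\<K>. {x \<in> topspace X. q x \<in> K})" by blast
    then show "openin X {x \<in> topspace X. q x \<in> \<Union>\<K>}" using K by auto
    show "\<Union>\<K> \<subseteq> Y" using K by blast
  qed
  then show ?thesis by (simp add: quotient_topology_def)
qed

definition orbit_full_topology ::
    "('g, 'm) monoid_scheme \<Rightarrow> 'g topology \<Rightarrow> ('g \<Rightarrow> 'g \<Rightarrow> real) \<Rightarrow> 'x measure \<Rightarrow>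
     ('g \<Rightarrow> 'x \<Rightarrow> 'x) \<Rightarrow> ('x \<Rightarrow> 'x) set topology" where
  "orbit_full_topology G T d M \<phi> =
     quotient_topology (subtopology (L0_topology M T d) (orbit_full_lift T M \<phi>))
       (orbit_full_set G M \<phi>) (Phi M \<phi>)"

definition finer_topology :: "'a topology \<Rightarrow> 'a topology \<Rightarrow> bool" where
  "finer_topology T S \<longleftrightarrow> topspace T = topspace S \<and> (\<forall>U. openin S U \<longrightarrow> openin T U)"

definition topological_group_embedding ::
    "('g, 'm) monoid_scheme \<Rightarrow> 'g topology \<Rightarrow> ('h, 'n) monoid_scheme \<Rightarrow> 'h topology \<Rightarrow>
     ('g \<Rightarrow> 'h) \<Rightarrow> bool" where
  "topological_group_embedding G T H S \<iota> \<longleftrightarrow> \<iota> \<in> hom G H \<and> embedding_map T S \<iota>"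

end

theory Submission
  imports Defs
begin

text \<open>
  Lifting elements of the orbit full group to maps \<open>f : X \<rightarrow> G\<close> turns \<open>\<Phi>\<close> into an open quotient map, so
  everything reduces to two points. First, \<open>\<Phi>\<close> is continuous on lifts although the action is only Borel: the Vaught
  transforms \<open>A\<^sup>\<Delta>\<^sup>U\<close> give a countable separating, hence generating, family of Borel sets that are open along orbits;
  convergence in measure of lifts controls such sets, and since \<open>\<Phi> f\<close> preserves the measure, this passes to all Borel sets.
  The same family shows that the lifts are complete for the distance recording \<open>f\<close>, \<open>\<Phi> f\<close> and \<open>(\<Phi> f)\<^sup>-\<^sup>1\<close>.
  Secondly, a regular Hausdorff image of a Polish space under a continuous open map is Polish (Hausdorff). Descriptive set
  theory enters through the Lusin--Souslin theorem and a uniformization theorem modulo null sets, which provides the lifts.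
\<close>

text \<open>Two obstacles shape the argument. Convergence of lifts in measure says nothing directly
  about \<open>\<phi> (f n x) x\<close>, because the action need not be continuous in any given
  topology on \<open>X\<close>; only Borel sets whose trace on every orbit is open in
  \<open>G\<close> react to it, so such sets have to be manufactured. Moreover, a limit in measure
  of measure-preserving bijections preserves the measure but may fail to be invertible, so the lifts
  are in general not closed among the measurable maps into \<open>G\<close>. Convergence of the
  inverses as well forces invertibility; this is why the complete distance has a term for them, much
  as left and right uniformities are combined in a Polish group. Openness of \<open>Phi\<close>
  comes from right multiplication by stabilizer-valued maps. The hypotheses of the open image
  theorem are then met cheaply: every topological group is regular, and the Hausdorff property is
  inherited from the space of measurable self-maps of \<open>X\<close>. The group operations are
  checked on lifts, where metrizability makes sequences sufficient, and descend along the quotient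
  map.\<close>

no_notation eq_closure_of (\<open>closure'_of\<index>\<close>)


subsection \<open>Metrizable and second countable spaces\<close>

lemma metrizable_separable_imp_second_countable:
  assumes "metrizable_space X" "separable_space X"
  shows "second_countable X"
proof -
  obtain M d where "Metric_space M d" and X: "X = Metric_space.mtopology M d"
    using assms by (auto simp: metrizable_space_def)
  interpret Metric_space M d by fact
  obtain C where C: "countable C" "C \<subseteq> M" "mtopology closure_of C = M"
    using assms X by (auto simp: separable_space_def)
  define \<B> where "\<B> = (\<lambda>(c, n::nat). mball c (1 / Suc n)) ` (C \<times> UNIV)"
  show ?thesis
    unfolding second_countable_def
  proof (intro exI conjI ballI allI impI)
    show "countable \<B>" using C by (auto simp: \<B>_def)
    show "openin X V" if "V \<in> \<B>" for V using that X by (auto simp: \<B>_def)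
    show "\<exists>V\<in>\<B>. x \<in> V \<and> V \<subseteq> U" if U: "openin X U \<and> x \<in> U" for U x
    proof -
      have "U \<subseteq> M" "\<exists>r>0. mball x r \<subseteq> U"
        using U unfolding X openin_mtopology by blast+
      then obtain r where r: "r > 0" "mball x r \<subseteq> U" "x \<in> M"
        using U by blast
      obtain n where n: "1 / real (Suc n) < r / 2"
        using r(1) nat_approx_posE by (metis half_gt_zero)
      have "x \<in> mtopology closure_of C" using C r by auto
      moreover have "0 < 1 / real (Suc n)" by simp
      ultimately have "\<exists>c\<in>C. c \<in> mball x (1 / Suc n)"
        unfolding metric_closure_of by blast
      then obtain c where c: "c \<in> C" "c \<in> mball x (1 / Suc n)" by blast
      have "x \<in> mball c (1 / Suc n)" using c commute by auto
      moreover have "mball c (1 / Suc n) \<subseteq> mball x r"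
        using c n by (intro mball_subset) (auto simp: commute)
      ultimately show ?thesis using c r unfolding \<B>_def by (intro bexI[of _ "mball c (1 / Suc n)"]) auto
    qed
  qed
qed

lemma second_countable_prod_topology:
  assumes "second_countable X" "second_countable Y"
  shows "second_countable (prod_topology X Y)"
proof -
  obtain \<A> where "countable \<A> \<and> (\<forall>V \<in> \<A>. openin X V) \<and>
      (\<forall>U x. openin X U \<and> x \<in> U \<longrightarrow> (\<exists>V \<in> \<A>. x \<in> V \<and> V \<subseteq> U))"
    using assms(1) unfolding second_countable_def by (rule exE)
  then have A: "countable \<A>" "\<And>V. V \<in> \<A> \<Longrightarrow> openin X V"
    "\<And>U x. openin X U \<Longrightarrow> x \<in> U \<Longrightarrow> \<exists>V \<in> \<A>. x \<in> V \<and> V \<subseteq> U"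
    by blast+
  obtain \<B> where "countable \<B> \<and> (\<forall>V \<in> \<B>. openin Y V) \<and>
      (\<forall>U x. openin Y U \<and> x \<in> U \<longrightarrow> (\<exists>V \<in> \<B>. x \<in> V \<and> V \<subseteq> U))"
    using assms(2) unfolding second_countable_def by (rule exE)
  then have B: "countable \<B>" "\<And>V. V \<in> \<B> \<Longrightarrow> openin Y V"
    "\<And>U x. openin Y U \<Longrightarrow> x \<in> U \<Longrightarrow> \<exists>V \<in> \<B>. x \<in> V \<and> V \<subseteq> U"
    by blast+
  show ?thesis
    unfolding second_countable_def
  proof (intro exI[of _ "(\<lambda>(a, b). a \<times> b) ` (\<A> \<times> \<B>)"] conjI ballI allI impI)
    show "countable ((\<lambda>(a, b). a \<times> b) ` (\<A> \<times> \<B>))" using A B by auto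
    show "openin (prod_topology X Y) V" if "V \<in> (\<lambda>(a, b). a \<times> b) ` (\<A> \<times> \<B>)" for V
      using that A B by (auto simp: openin_prod_Times_iff)
    fix U x assume U: "openin (prod_topology X Y) U \<and> x \<in> U"
    obtain p q where x: "x = (p, q)" by (cases x)
    obtain S T where ST: "openin X S" "openin Y T" "p \<in> S" "q \<in> T" "S \<times> T \<subseteq> U"
      using U unfolding x openin_prod_topology_alt by blast
    obtain a where a: "a \<in> \<A>" "p \<in> a" "a \<subseteq> S" using A ST by blast
    obtain b where b: "b \<in> \<B>" "q \<in> b" "b \<subseteq> T" using B ST by blast
    show "\<exists>V\<in>(\<lambda>(a, b). a \<times> b) ` (\<A> \<times> \<B>). x \<in> V \<and> V \<subseteq> U"
      using a b ST unfolding x by (intro bexI[of _ "a \<times> b"]) auto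
  qed
qed

lemma second_countable_sequence:
  assumes "second_countable X"
  shows "\<exists>B :: nat \<Rightarrow> 'a set. (\<forall>n. openin X (B n)) \<and>
    (\<forall>U x. openin X U \<longrightarrow> x \<in> U \<longrightarrow> (\<exists>n. x \<in> B n \<and> B n \<subseteq> U))"
proof -
  obtain \<A> where "countable \<A> \<and> (\<forall>V \<in> \<A>. openin X V) \<and>
      (\<forall>U x. openin X U \<and> x \<in> U \<longrightarrow> (\<exists>V \<in> \<A>. x \<in> V \<and> V \<subseteq> U))"
    using assms(1) unfolding second_countable_def by (rule exE)
  then have A: "countable \<A>" "\<And>V. V \<in> \<A> \<Longrightarrow> openin X V"
    "\<And>U x. openin X U \<Longrightarrow> x \<in> U \<Longrightarrow> \<exists>V \<in> \<A>. x \<in> V \<and> V \<subseteq> U"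
    by blast+
  \<comment> \<open>Inserting the empty set makes the family nonempty and hence enumerable by all of
    \<open>nat\<close>. Basic sets may therefore be empty, which explains later conditions such as
    \<open>B n \<noteq> {}\<close>.\<close>
  define B where "B = from_nat_into (insert {} \<A>)"
  have r: "range B = insert {} \<A>"
    unfolding B_def using A by (intro range_from_nat_into) auto
  show ?thesis
  proof (intro exI[of _ B] conjI allI impI)
    show "openin X (B n)" for n using r A(2) by (metis insertE openin_empty rangeI)
    show "\<exists>n. x \<in> B n \<and> B n \<subseteq> U" if U: "openin X U" "x \<in> U" for U x
    proof -
      obtain V where V: "V \<in> \<A>" "x \<in> V" "V \<subseteq> U" using A(3) U by blast
      then obtain n where "B n = V" using r by (metis UnI2 imageE insert_is_Un)
      then show ?thesis using V by auto
    qed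
  qed
qed

lemma openin_Union_base:
  assumes "\<And>U x. openin X U \<Longrightarrow> x \<in> U \<Longrightarrow> \<exists>n. x \<in> B n \<and> B n \<subseteq> U" "openin X U"
  shows "U = (\<Union>n\<in>{n. B n \<subseteq> U}. B (n::nat))"
proof
  show "U \<subseteq> (\<Union>n\<in>{n. B n \<subseteq> U}. B n)" using assms(1)[OF assms(2)] by fastforce
qed auto

lemma (in Metric_space) openin_if_sequentially:
  assumes "U \<subseteq> M"
    and seq: "\<And>\<sigma> l. range \<sigma> \<subseteq> M - U \<Longrightarrow> limitin mtopology \<sigma> l sequentially \<Longrightarrow> l \<notin> U"
  shows "openin mtopology U"
proof -
  have "closedin mtopology (M - U)"
    unfolding metric_closedin_iff_sequentially_closed
    using seq limitin_topspace by fastforce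
  then show ?thesis
    using assms(1) by (simp add: openin_closedin_eq)
qed

lemma metrizable_continuous_map_sequentially:
  assumes "metrizable_space X" and f: "\<And>x. x \<in> topspace X \<Longrightarrow> f x \<in> topspace Y"
    and seq: "\<And>\<sigma> l. range \<sigma> \<subseteq> topspace X \<Longrightarrow> limitin X \<sigma> l sequentially \<Longrightarrow>
      limitin Y (\<lambda>n. f (\<sigma> n)) (f l) sequentially"
  shows "continuous_map X Y f"
proof -
  obtain M d where "Metric_space M d" and X: "X = Metric_space.mtopology M d"
    using assms by (auto simp: metrizable_space_def)
  interpret Metric_space M d by fact
  show ?thesis
    unfolding continuous_map_def
  proof (intro conjI allI impI)
    fix U assume U: "openin Y U"
    show "openin X {x \<in> topspace X. f x \<in> U}"
      unfolding X
    proof (rule openin_if_sequentially)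
      fix \<sigma> l assume s: "range \<sigma> \<subseteq> M - {x \<in> topspace mtopology. f x \<in> U}" "limitin mtopology \<sigma> l sequentially"
      have "limitin Y (\<lambda>n. f (\<sigma> n)) (f l) sequentially" 
        using seq[of \<sigma> l] s X by (metis (no_types, lifting) Diff_subset order_trans topspace_mtopology)
      then have "f l \<in> U \<Longrightarrow> eventually (\<lambda>n. f (\<sigma> n) \<in> U) sequentially"
        using U limitinD by fastforce
      then have "f l \<in> U \<Longrightarrow> \<exists>n. f (\<sigma> n) \<in> U"
        using eventually_happens' sequentially_bot by blast
      then show "l \<notin> {x \<in> topspace mtopology. f x \<in> U}" using s by fastforce
    qed auto
  qed (use f in auto)
qed

text \<open>Closed sets of a metric space are the sequentially closed ones, so metrics on one set
  can be compared through convergence alone. This serves for changing the metric on the target of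
  \<open>L0\<close> and for adding terms to the distance on lifts.\<close>

lemma mtopology_eq_sequentially:
  assumes "Metric_space M d" "Metric_space M d'"
    and "\<And>\<sigma> l. range \<sigma> \<subseteq> M \<Longrightarrow> l \<in> M \<Longrightarrow> (\<lambda>n. d (\<sigma> n) l) \<longlonglongrightarrow> 0 \<longleftrightarrow> (\<lambda>n. d' (\<sigma> n) l) \<longlonglongrightarrow> 0"
  shows "Metric_space.mtopology M d = Metric_space.mtopology M d'"
proof -
  interpret A: Metric_space M d by fact
  interpret B: Metric_space M d' by fact
  have "limitin A.mtopology \<sigma> l sequentially \<longleftrightarrow> limitin B.mtopology \<sigma> l sequentially" if "range \<sigma> \<subseteq> M" for \<sigma> l
    using assms(3)[OF that] that unfolding A.limitin_metric_dist_null B.limitin_metric_dist_null by auto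
  then have "closedin A.mtopology S \<longleftrightarrow> closedin B.mtopology S" for S
    unfolding A.metric_closedin_iff_sequentially_closed B.metric_closedin_iff_sequentially_closed
    by (meson order_trans)
  then show ?thesis
    by (metis topology_eq openin_closedin_eq A.topspace_mtopology B.topspace_mtopology)
qed

subsection \<open>Metrization and open images\<close>

text \<open>Urysohn's metrization argument: each pair of basic sets with the closure of the first
  inside the second contributes one function, \<open>0\<close> on the inner closure and
  \<open>1\<close> off the outer set. There are countably many pairs, so the product is completely
  metrizable.\<close>

lemma regular_second_countable_embedding:
  assumes reg: "regular_space X" and "Hausdorff_space X" and sc: "second_countable X"
  obtains I :: "(nat \<times> nat) set" and e where "embedding_map X (powertop_real I) e"
proof -
  obtain B :: "nat \<Rightarrow> 'a set" where "(\<forall>n. openin X (B n)) \<and>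
      (\<forall>U x. openin X U \<longrightarrow> x \<in> U \<longrightarrow> (\<exists>n. x \<in> B n \<and> B n \<subseteq> U))"
    using second_countable_sequence[OF sc] by (rule exE)
  then have B: "\<And>n. openin X (B n)"
    "\<And>U x. openin X U \<Longrightarrow> x \<in> U \<Longrightarrow> \<exists>n. x \<in> B n \<and> B n \<subseteq> U"
    by blast+
  define I where "I = {(i :: nat, j :: nat). X closure_of B i \<subseteq> B j}"
  have norm: "normal_space X"
    by (simp add: reg regular_Lindelof_imp_normal_space sc second_countable_imp_Lindelof_space)
  have "\<exists>f. continuous_map X euclideanreal f \<and> f ` (X closure_of B i) \<subseteq> {0} \<and> f ` (topspace X - B j) \<subseteq> {1}"
    if "(i, j) \<in> I" for i j
  proof (rule Urysohn_lemma_alt[OF norm, of "X closure_of B i" "topspace X - B j" 0 1])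
    show "disjnt (X closure_of B i) (topspace X - B j)" using that by (auto simp: I_def disjnt_def)
  qed (use B in auto)
  then have "\<forall>p\<in>I. \<exists>f. continuous_map X euclideanreal f \<and> f ` (X closure_of B (fst p)) \<subseteq> {0} \<and> f ` (topspace X - B (snd p)) \<subseteq> {1}"
    by auto
  then obtain f where f: "\<And>p. p \<in> I \<Longrightarrow> continuous_map X euclideanreal (f p)"
    "\<And>p. p \<in> I \<Longrightarrow> f p ` (X closure_of B (fst p)) \<subseteq> {0}"
    "\<And>p. p \<in> I \<Longrightarrow> f p ` (topspace X - B (snd p)) \<subseteq> {1::real}"
    by metis
  have sep: "\<exists>p\<in>I. f p x = 0 \<and> f p ` (topspace X - U) \<subseteq> {1}" if U: "openin X U" "x \<in> U" for U x
  proof -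
    obtain j where j: "x \<in> B j" "B j \<subseteq> U" using B U by blast
    obtain V C where V: "openin X V" "closedin X C" "x \<in> V" "V \<subseteq> C" "C \<subseteq> B j"
      using reg B(1)[of j] j(1) unfolding neighbourhood_base_of_closedin[symmetric] neighbourhood_base_of
      by (elim allE[where x = "B j"] allE[where x = x]) blast
    obtain i where i: "x \<in> B i" "B i \<subseteq> V" using B(2)[OF V(1,3)] by blast
    have "X closure_of B i \<subseteq> C" using i V by (intro closure_of_minimal) auto
    then have p: "(i, j) \<in> I" using V by (auto simp: I_def)
    have "x \<in> X closure_of B i" using i B by (meson closure_of_subset openin_subset subsetD)
    then have "f (i, j) x = 0" "f (i, j) ` (topspace X - U) \<subseteq> {1}"
      using f(2)[OF p] f(3)[OF p] j by (auto simp: image_subset_iff)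
    then show ?thesis using p by blast
  qed
  define e where "e = (\<lambda>x. \<lambda>p\<in>I. f p x)"
  have cont: "continuous_map X (powertop_real I) e"
    using f(1) by (auto simp: e_def continuous_map_componentwise)
  have inj: "inj_on e (topspace X)"
  proof (rule inj_onI, rule ccontr)
    fix x y assume xy: "x \<in> topspace X" "y \<in> topspace X" "e x = e y" "x \<noteq> y"
    then obtain U where U: "openin X U" "x \<in> U" "y \<notin> U"
      using \<open>Hausdorff_space X\<close> unfolding Hausdorff_space_def disjnt_def by (metis disjoint_iff)
    then obtain p where p: "p \<in> I" "f p x = 0" "f p ` (topspace X - U) \<subseteq> {1}" using sep by blast
    then have "f p y = 1" using U xy by auto
    then show False using p xy(3) by (metis e_def restrict_apply' zero_neq_one)
  qed
  have "open_map X (subtopology (powertop_real I) (e ` topspace X)) e"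
    unfolding open_map_def
  proof (intro allI impI)
    fix U assume U: "openin X U"
    \<comment> \<open>Only coordinates whose function is constantly \<open>1\<close> off
      \<open>U\<close> enter: a value below \<open>1\<close> in such a coordinate certifies
      membership in \<open>U\<close>, and \<open>sep\<close> provides one for every point of
      \<open>U\<close>.\<close>
    define W where "W = (\<Union>p\<in>{p\<in>I. f p ` (topspace X - U) \<subseteq> {1}}. {z \<in> topspace (powertop_real I). z p \<in> {..<1}})"
    have "openin (powertop_real I) {z \<in> topspace (powertop_real I). z p \<in> {..<1}}" if "p \<in> I" for p
      using that by (intro openin_continuous_map_preimage[OF continuous_map_product_projection]) auto
    then have "openin (powertop_real I) W" unfolding W_def by blast
    moreover have "e ` U = W \<inter> e ` topspace X"
    proof safe
      fix x assume x: "x \<in> U"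
      obtain p where "p \<in> I" "f p x = 0" "f p ` (topspace X - U) \<subseteq> {1}" using sep[OF U x] by blast
      moreover have "e x \<in> topspace (powertop_real I)"
        using cont x U openin_subset unfolding continuous_map_def by fastforce
      ultimately show "e x \<in> W"
        unfolding W_def by (intro UN_I[of p]) (auto simp: e_def)
      show "e x \<in> e ` topspace X" using x U openin_subset by blast
    next
      fix x assume x: "e x \<in> W" "x \<in> topspace X"
      then obtain p where "p \<in> I" "f p ` (topspace X - U) \<subseteq> {1}" "f p x < 1"
        by (auto simp: W_def e_def)
      then have "x \<in> U" using x by (metis DiffI image_subset_iff less_irrefl singletonD)
      then show "e x \<in> e ` U" by blast
    qed
    ultimately show "openin (subtopology (powertop_real I) (e ` topspace X)) (e ` U)"
      by (auto simp: openin_subtopology)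
  qed
  then have "embedding_map X (powertop_real I) e"
    unfolding embedding_map_def using cont inj
    by (intro bijective_open_imp_homeomorphic_map)
      (auto simp: continuous_map_in_subtopology dest: continuous_map_image_subset_topspace)
  then show ?thesis using that by blast
qed

text \<open>From \<open>W i\<close> keep the points closer than \<open>1 / (i + 1)\<close> to the
  complement of every earlier \<open>W j\<close>. A point survives in the first set that contains
  it, where it is itself a point of those complements. Once a ball around it lies in
  \<open>W j\<close>, it is dropped from all \<open>W i\<close> with large \<open>i\<close>.\<close>

lemma (in Metric_space) point_finite_refinement:
  assumes W: "\<And>i::nat. openin mtopology (W i)"
  shows "\<exists>W'. (\<forall>i. openin mtopology (W' i)) \<and> (\<forall>i. W' i \<subseteq> W i) \<and>
    (\<Union>i. W' i) = (\<Union>i. W i) \<and> (\<forall>z. finite {i. z \<in> W' i})"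
proof (intro exI conjI allI)
  define W' where "W' i = W i \<inter> (\<Inter>j\<in>{..<i}. \<Union>y\<in>M - W j. mball y (1 / (real i + 1))) " for i
  show "openin mtopology (W' i)" for i
  \<comment> \<open>For \<open>i = 0\<close> the intersection is over the empty family and equals
    \<open>UNIV\<close>, which is not a subset of the space.\<close>
  proof (cases "i = 0")
    case True then show ?thesis using W by (simp add: W'_def)
  next
    case False
    then have "openin mtopology (\<Inter>j\<in>{..<i}. \<Union>y\<in>M - W j. mball y (1 / (real i + 1)))"
      by (intro openin_Inter) auto
    then show ?thesis using W by (simp add: W'_def openin_Int)
  qed
  show sub: "W' i \<subseteq> W i" for i by (auto simp: W'_def)
  show "(\<Union>i. W' i) = (\<Union>i. W i)"
  proof
    show "(\<Union>i. W i) \<subseteq> (\<Union>i. W' i)"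
    proof
      fix z assume "z \<in> (\<Union>i. W i)"
      then have ex: "\<exists>i. z \<in> W i" by auto
      define j where "j = (LEAST i. z \<in> W i)"
      have j: "z \<in> W j" using ex unfolding j_def by (rule LeastI_ex)
      have k: "z \<notin> W k" if "k < j" for k using that not_less_Least unfolding j_def by blast
      have zM: "z \<in> M" using j W openin_subset by fastforce
      then have "z \<in> W' j" using j k unfolding W'_def by (auto intro!: bexI[of _ z])
      then show "z \<in> (\<Union>i. W' i)" by blast
    qed
  qed (use sub in blast)
  show "finite {i. z \<in> W' i}" for z
  proof (cases "\<exists>j. z \<in> W j")
    case True
    then obtain j where j: "z \<in> W j" by auto
    then obtain r where r: "r > 0" "mball z r \<subseteq> W j" using W openin_mtopology by blast
    obtain n where n: "1 / real (Suc n) < r" using r nat_approx_posE by blast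
    have "i \<le> max j n" if "z \<in> W' i" for i
    proof (rule ccontr)
      assume "\<not> ?thesis"
      then have i: "j < i" "n < i" by auto
      then obtain y where y: "y \<in> M - W j" "z \<in> mball y (1 / (real i + 1))"
        using \<open>z \<in> W' i\<close> unfolding W'_def by blast
      have "1 / (real i + 1) \<le> 1 / real (Suc n)" using i by (intro divide_left_mono) auto
      then have "y \<in> mball z r" using y n by (auto simp: commute)
      then show False using r y by auto
    qed
    then have "{i. z \<in> W' i} \<subseteq> {..max j n}" by auto
    then show ?thesis using finite_subset by blast
  next
    case False
    then have "{i. z \<in> W' i} = {}" using sub by auto
    then show ?thesis by simp
  qed
qed


text \<open>One stage of the scheme behind Hausdorff's theorem: a source set and a target set
  matched over \<open>S\<close> split into countably many smaller matched pairs. Point-finiteness of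
  the target sets is what later makes the branching finite.\<close>

lemma open_image_refinement_step:
  assumes X: "Metric_space MX dX" and Z: "Metric_space MZ dZ"
    and sc: "second_countable (Metric_space.mtopology MX dX)"
    and q: "continuous_map (Metric_space.mtopology MX dX) (Metric_space.mtopology MZ dZ) q"
    and op: "open_map (Metric_space.mtopology MX dX) (subtopology (Metric_space.mtopology MZ dZ) S) q"
    and U: "openin (Metric_space.mtopology MX dX) U" and V: "openin (Metric_space.mtopology MZ dZ) V"
    and UV: "q ` U = V \<inter> S" and e: "e > 0"
  shows "\<exists>U' V' :: nat \<Rightarrow> _ set. (\<forall>i. openin (Metric_space.mtopology MX dX) (U' i) \<and>
    openin (Metric_space.mtopology MZ dZ) (V' i) \<and> V' i \<subseteq> V \<and> U' i \<subseteq> U \<and> q ` U' i = V' i \<inter> S \<and>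
    (\<forall>x\<in>U' i. \<forall>y\<in>U' i. dX x y < e) \<and> (\<forall>x\<in>V' i. \<forall>y\<in>V' i. dZ x y < e)) \<and>
    (\<Union>i. V' i) \<inter> S = V \<inter> S \<and> (\<forall>z. finite {i. z \<in> V' i})"
proof -
  interpret X: Metric_space MX dX by fact
  interpret Z: Metric_space MZ dZ by fact
  obtain B :: "nat \<Rightarrow> 'a set" where "(\<forall>n. openin X.mtopology (B n)) \<and>
      (\<forall>U x. openin X.mtopology U \<longrightarrow> x \<in> U \<longrightarrow> (\<exists>n. x \<in> B n \<and> B n \<subseteq> U))"
    using second_countable_sequence[OF sc] by (rule exE)
  then have B: "\<And>n. openin X.mtopology (B n)"
    "\<And>U x. openin X.mtopology U \<Longrightarrow> x \<in> U \<Longrightarrow> \<exists>n. x \<in> B n \<and> B n \<subseteq> U"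
    by blast+
  \<comment> \<open>A ball of radius \<open>e/2\<close> around the image allows its open witness in
    \<open>Z\<close> to be cut down to diameter below \<open>e\<close>.\<close>
  define good where "good b \<longleftrightarrow> b \<subseteq> U \<and> (\<forall>x\<in>b. \<forall>y\<in>b. dX x y < e) \<and> (\<exists>z. q ` b \<subseteq> Z.mball z (e/2))" for b
  define B' where "B' n = (if good (B n) then B n else {})" for n
  have B'open: "openin X.mtopology (B' n)" for n using B by (auto simp: B'_def)
  have Ucover: "U \<subseteq> (\<Union>n. B' n)"
  proof
    fix x assume x: "x \<in> U"
    then have xM: "x \<in> MX" using U openin_subset by fastforce
    then have qx: "q x \<in> MZ" using q by (auto simp: continuous_map_def Pi_iff)
    define W where "W = U \<inter> X.mball x (e/2) \<inter> {y \<in> topspace X.mtopology. q y \<in> Z.mball (q x) (e/2)}"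
    have "openin X.mtopology W" unfolding W_def using U q
      by (intro openin_Int openin_continuous_map_preimage[OF q]) auto
    moreover have "x \<in> W" using x xM qx e by (auto simp: W_def)
    ultimately obtain n where n: "x \<in> B n" "B n \<subseteq> W" using B(2) by blast
    have "dX y z < e" if "y \<in> B n" "z \<in> B n" for y z
    proof -
      have "dX x y < e/2" "dX x z < e/2" "y \<in> MX" "z \<in> MX" using that n unfolding W_def by auto
      then show ?thesis using X.triangle'[of y x z] xM by (smt (verit) field_sum_of_halves X.commute)
    qed
    moreover have "q ` B n \<subseteq> Z.mball (q x) (e/2)" "B n \<subseteq> U" using n unfolding W_def by auto
    ultimately have "good (B n)" unfolding good_def by blast
    then have "x \<in> B' n" using n by (simp add: B'_def)
    then show "x \<in> (\<Union>n. B' n)" by blast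
  qed
  have B'good: "good (B' n)" for n by (auto simp: B'_def) (auto simp: good_def)
  have "\<exists>W. openin Z.mtopology W \<and> W \<subseteq> V \<and> W \<inter> S = q ` B' n \<and> (\<forall>x\<in>W. \<forall>y\<in>W. dZ x y < e)" for n
  proof -
    obtain z where z: "q ` B' n \<subseteq> Z.mball z (e/2)" using B'good unfolding good_def by blast
    obtain T where T: "openin Z.mtopology T" "q ` B' n = T \<inter> S"
      using op B'open unfolding open_map_def openin_subtopology by metis
    have "q ` B' n \<subseteq> V" using B'good UV unfolding good_def by blast
    moreover have "dZ x y < e" if "x \<in> Z.mball z (e/2)" "y \<in> Z.mball z (e/2)" for x y
      using that Z.triangle[of x z y] Z.commute[of x z] by auto
    ultimately show ?thesis using z T V
      by (intro exI[of _ "T \<inter> V \<inter> Z.mball z (e/2)"]) (auto intro!: openin_Int)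
  qed
  then obtain W where W: "\<And>n. openin Z.mtopology (W n)" "\<And>n. W n \<subseteq> V" "\<And>n. W n \<inter> S = q ` B' n"
    "\<And>n x y. x \<in> W n \<Longrightarrow> y \<in> W n \<Longrightarrow> dZ x y < e"
    by metis
  obtain V' where "(\<forall>i. openin Z.mtopology (V' i)) \<and> (\<forall>i. V' i \<subseteq> W i) \<and>
    (\<Union>i. V' i) = (\<Union>i. W i) \<and> (\<forall>z. finite {i. z \<in> V' i})"
    using Z.point_finite_refinement[of W, OF W(1)] by (rule exE)
  then have V': "\<And>i. openin Z.mtopology (V' i)" "\<And>i. V' i \<subseteq> W i" "(\<Union>i. V' i) = (\<Union>i. W i)"
    "\<And>z. finite {i. z \<in> V' i}"
    by blast+
  \<comment> \<open>Shrinking \<open>W\<close> to \<open>V'\<close> destroys the match with the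
    image of \<open>B' i\<close>; restricting \<open>B' i\<close> to the preimage of
    \<open>V' i\<close> restores it.\<close>
  define U' where "U' i = B' i \<inter> {x \<in> topspace X.mtopology. q x \<in> V' i}" for i
  have U'U: "U' i \<subseteq> U" "\<forall>x\<in>U' i. \<forall>y\<in>U' i. dX x y < e" for i
    using B'good[of i] unfolding U'_def good_def by auto
  have U'open: "openin X.mtopology (U' i)" for i
    unfolding U'_def using B'open V'(1) by (intro openin_Int openin_continuous_map_preimage[OF q]) auto
  have qU': "q ` U' i = V' i \<inter> S" for i
  proof
    show "q ` U' i \<subseteq> V' i \<inter> S" unfolding U'_def using W(3)[of i] by auto
    show "V' i \<inter> S \<subseteq> q ` U' i"
    proof
      fix z assume z: "z \<in> V' i \<inter> S"
      then obtain x where "x \<in> B' i" "z = q x" using W(3)[of i] V'(2)[of i] by blast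
      then show "z \<in> q ` U' i" using z B'open[of i] openin_subset[of X.mtopology "B' i"] unfolding U'_def by auto
    qed
  qed
  have "(\<Union>i. V' i) \<inter> S = V \<inter> S"
  proof -
    have "(\<Union>i. V' i) \<inter> S = q ` (\<Union>i. B' i)" using W(3) unfolding V'(3) by blast
    also have "(\<Union>i. B' i) = U" using Ucover B'good unfolding good_def by blast
    finally show ?thesis using UV by simp
  qed
  moreover have "V' i \<subseteq> V" "\<forall>x\<in>V' i. \<forall>y\<in>V' i. dZ x y < e" for i
    using V'(2)[of i] W(2)[of i] W(4)[of _ i] by blast+
  ultimately show ?thesis
    using U'U U'open V'(1,4) qU' by (intro exI[of _ U'] exI[of _ V']) auto
qed

text \<open>Koenig's lemma. Lists grow at the head, so the ancestors of a node are its suffixes and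
  the hypothesis \<open>mono\<close> passes \<open>P\<close> to ancestors.\<close>

lemma infinite_branch:
  assumes mono: "\<And>s i. P (i # s) \<Longrightarrow> P s"
    and fin: "\<And>s. finite {i::nat. P (i # s)}" and ex: "\<And>n. \<exists>s. length s = n \<and> P s"
  obtains p where "\<And>n. length (p n) = n" "\<And>n. P (p n)" "\<And>n. \<exists>i. p (Suc n) = i # p n"
proof -
  have mono': "P (t @ s) \<Longrightarrow> P s" for t s by (induction t) (use mono in auto)
  define good where "good s \<longleftrightarrow> (\<forall>n. \<exists>t. length t = n \<and> P (t @ s))" for s
  have step: "\<exists>i. good (i # s)" if s: "good s" for s
  proof (rule ccontr)
    assume "\<not> ?thesis"
    then have "\<forall>i. \<exists>n. \<forall>t. length t = n \<longrightarrow> \<not> P (t @ i # s)" unfolding good_def by blast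
    then obtain n where n: "\<And>i t. length t = n i \<Longrightarrow> \<not> P (t @ i # s)" by metis
    define F where "F = {i. P (i # s)}"
    \<comment> \<open>If no child were \<open>good\<close>, each child in the finite set
      \<open>F\<close> would have a length \<open>n i\<close> that its extensions avoid. The sum
      dominates all of them, so an extension of \<open>s\<close> of length \<open>Suc N\<close>
      contradicts one of them after truncation.\<close>
    define N where "N = (\<Sum>i\<in>F. n i)"
    obtain t where t: "length t = Suc N" "P (t @ s)" using s unfolding good_def by blast
    then obtain t' i where t': "t = t' @ [i]" by (cases t rule: rev_cases) auto
    then have "i \<in> F" using mono'[of t' "i # s"] t by (auto simp: F_def)
    then have "n i \<le> N" unfolding N_def using fin by (intro member_le_sum) (auto simp: F_def)
    define u where "u = drop (N - n i) t'"
    have "length u = n i" using t t' \<open>n i \<le> N\<close> by (auto simp: u_def)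
    moreover have "P (take (N - n i) t' @ (u @ i # s))"
      using t t' by (simp add: u_def) (metis append.assoc append_take_drop_id)
    ultimately show False using n mono' by blast
  qed
  have good0: "good []" using ex by (auto simp: good_def)
  obtain f where f: "\<And>s. good s \<Longrightarrow> good (f s # s)" using step by metis
  define p where "p = rec_nat [] (\<lambda>_ s. f s # s)"
  have p: "p 0 = []" "p (Suc n) = f (p n) # p n" for n by (auto simp: p_def)
  have g: "good (p n)" for n by (induction n) (use good0 f p in auto)
  show ?thesis
  proof
    show "length (p n) = n" for n by (induction n) (auto simp: p)
    show "P (p n)" for n using g[of n] unfolding good_def by (metis append_Nil length_0_conv)
    show "\<exists>i. p (Suc n) = i # p n" for n using p by auto
  qed
qed

text \<open>Iterated refinement gives a tree of matched pairs \<open>(U s, V s)\<close> of vanishing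
  diameter. A point lying in some \<open>V s\<close> at every level follows an infinite branch, by
  point-finiteness and Koenig's lemma. Points chosen in the sets \<open>U\<close> along the branch
  are Cauchy, and their limit is mapped to the given point.\<close>

lemma open_image_gdelta_in:
  assumes "completely_metrizable_space X" and sc: "second_countable X" and "metrizable_space Z"
    and q: "continuous_map X Z q" and op: "open_map X (subtopology Z S) q" and S: "q ` topspace X = S"
  shows "gdelta_in Z S"
proof -
  obtain MX dX where "Metric_space MX dX" and XC: "Metric_space.mcomplete MX dX"
    and X: "X = Metric_space.mtopology MX dX"
    using assms by (auto simp: completely_metrizable_space_def)
  interpret X: Metric_space MX dX by fact
  obtain MZ dZ where "Metric_space MZ dZ" and Z: "Z = Metric_space.mtopology MZ dZ"
    using assms by (auto simp: metrizable_space_def)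
  interpret Z: Metric_space MZ dZ by fact
  define ok where "ok p \<longleftrightarrow> openin X (fst p) \<and> openin Z (snd p) \<and> q ` fst p = snd p \<inter> S" for p
  define R where "R p e F \<longleftrightarrow> (\<forall>i::nat. ok (F i) \<and> snd (F i) \<subseteq> snd p \<and> fst (F i) \<subseteq> fst p \<and>
      (\<forall>x\<in>fst (F i). \<forall>y\<in>fst (F i). dX x y < e) \<and> (\<forall>x\<in>snd (F i). \<forall>y\<in>snd (F i). dZ x y < e)) \<and>
      (\<Union>i. snd (F i)) \<inter> S = snd p \<inter> S \<and> (\<forall>z. finite {i. z \<in> snd (F i)})" for p e F
  have "\<exists>F. R p e F" if p: "ok p" and e: "e > 0" for p and e :: real
  proof -
    have *: "openin X.mtopology (fst p)" "openin Z.mtopology (snd p)" "q ` fst p = snd p \<inter> S"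
      using p unfolding ok_def X Z by blast+
    from open_image_refinement_step[OF \<open>Metric_space MX dX\<close> \<open>Metric_space MZ dZ\<close> sc[unfolded X] q[unfolded X Z]
        op[unfolded X Z] * e]
    show ?thesis
    proof (elim exE)
      fix U' V' :: "nat \<Rightarrow> _ set"
      assume "(\<forall>i. openin X.mtopology (U' i) \<and> openin Z.mtopology (V' i) \<and> V' i \<subseteq> snd p \<and> U' i \<subseteq> fst p \<and>
        q ` U' i = V' i \<inter> S \<and> (\<forall>x\<in>U' i. \<forall>y\<in>U' i. dX x y < e) \<and> (\<forall>x\<in>V' i. \<forall>y\<in>V' i. dZ x y < e)) \<and>
        (\<Union>i. V' i) \<inter> S = snd p \<inter> S \<and> (\<forall>z. finite {i. z \<in> V' i})"
      then show ?thesis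
        unfolding R_def ok_def X Z by (intro exI[of _ "\<lambda>i. (U' i, V' i)"]) simp
    qed
  qed
  then obtain step where step: "\<And>p e. ok p \<Longrightarrow> e > 0 \<Longrightarrow> R p e (step p e)" by metis
  define T where "T = rec_list (topspace X, topspace Z) (\<lambda>i s p. step p (1 / real (Suc (length s))) i)"
  have T: "T [] = (topspace X, topspace Z)" "T (i # s) = step (T s) (1 / real (Suc (length s))) i" for i s
    by (auto simp: T_def)
  have ST: "S \<subseteq> topspace Z" using S q by (auto simp: continuous_map_def Pi_iff)
  have ok: "ok (T s)" for s
  proof (induction s)
    case Nil
    then show ?case using S ST by (auto simp: T ok_def)
  next
    case (Cons i s)
    then show ?case using step[OF Cons, of "1 / real (Suc (length s))"] by (simp add: T R_def)
  qed
  define U where "U s = fst (T s)" for s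
  define V where "V s = snd (T s)" for s
  have UV: "openin X (U s)" "openin Z (V s)" "q ` U s = V s \<inter> S" for s
    using ok[of s] by (auto simp: ok_def U_def V_def)
  have R: "R (T s) (1 / real (Suc (length s))) (\<lambda>i. T (i # s))" for s
    using step[OF ok, of "1 / real (Suc (length s))" s] by (simp add: T)
  have sub: "V (i # s) \<subseteq> V s" "U (i # s) \<subseteq> U s" for i s
    using R[of s] by (auto simp: R_def U_def V_def)
  have small: "x \<in> U (i # s) \<Longrightarrow> y \<in> U (i # s) \<Longrightarrow> dX x y < 1 / real (Suc (length s))"
    "a \<in> V (i # s) \<Longrightarrow> b \<in> V (i # s) \<Longrightarrow> dZ a b < 1 / real (Suc (length s))" for x y a b i s
    using R[of s] by (auto simp: R_def U_def V_def)
  have cov: "(\<Union>i. V (i # s)) \<inter> S = V s \<inter> S" and fin: "finite {i. z \<in> V (i # s)}" for s z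
    using R[of s] by (auto simp: R_def V_def)
  \<comment> \<open>A set \<open>V s\<close> may miss \<open>S\<close>, and then \<open>U s\<close>
    is empty. Membership in the closure of \<open>S\<close> excludes this along the branch; closed
    sets are G-delta in a metrizable space, so this intersection costs nothing.\<close>
  define G where "G = (\<Inter>n. \<Union>s\<in>{s. length s = n}. V s) \<inter> (Z closure_of S)"
  have "gdelta_in Z (\<Inter>n. \<Union>s\<in>{s. length s = n}. V s)"
    using UV(2) by (intro gdelta_in_Inter open_imp_gdelta_in) auto
  moreover have "gdelta_in Z (Z closure_of S)"
    using assms(3) by (intro closed_imp_gdelta_in) auto
  ultimately have "gdelta_in Z G" unfolding G_def by (rule gdelta_in_Int)
  moreover have "G = S"
  proof
    show "S \<subseteq> G"
    proof -
      have "\<exists>s. length s = n \<and> z \<in> V s" if z: "z \<in> S" for z n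
      proof (induction n)
        case 0
        then show ?case using z ST by (auto simp: V_def T)
      next
        case (Suc n)
        then obtain s where s: "length s = n" "z \<in> V s" by auto
        then obtain i where "z \<in> V (i # s)" using cov[of s] z by blast
        then show ?case using s by (intro exI[of _ "i # s"]) auto
      qed
      then show ?thesis using closure_of_subset[OF ST] unfolding G_def by blast
    qed
    show "G \<subseteq> S"
    proof
      fix r assume r: "r \<in> G"
      obtain p where p: "\<And>n. length (p n) = n" "\<And>n. r \<in> V (p n)" "\<And>n. \<exists>i. p (Suc n) = i # p n"
      proof (rule infinite_branch[of "\<lambda>s. r \<in> V s"])
        show "finite {i. r \<in> V (i # s)}" for s by (rule fin)
        show "\<exists>s. length s = n \<and> r \<in> V s" for n using r unfolding G_def by blast
        show "r \<in> V (i # s) \<Longrightarrow> r \<in> V s" for s i using sub(1) by blast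
      qed auto
      have "U (p n) \<noteq> {}" for n
      proof -
        have "V (p n) \<inter> S \<noteq> {}"
        proof -
          have "r \<in> Z closure_of S" using r by (simp add: G_def)
          then show ?thesis using p(2)[of n] UV(2)[of "p n"] unfolding in_closure_of by (metis disjoint_iff)
        qed
        then show ?thesis using UV(3)[of "p n"] by auto
      qed
      then have "\<forall>n. \<exists>x. x \<in> U (p n)" by blast
      then obtain x where x: "\<And>n. x n \<in> U (p n)" by metis
      have dec: "U (p (n + k)) \<subseteq> U (p n)" for n k
      proof (induction k)
        case (Suc k)
        then show ?case using sub(2) p(3)[of "n + k"] by fastforce
      qed auto
      have decU: "m \<ge> n \<Longrightarrow> U (p m) \<subseteq> U (p n)" for m n
        using dec[of n "m - n"] by simp
      have xM: "x n \<in> MX" for n using x[of n] UV(1)[of "p n"] openin_subset X by fastforce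
      have dx: "dX (x m) (x n) < 1 / real (Suc k)" if "m > k" "n > k" for m n k
      proof -
        obtain i where "p (Suc k) = i # p k" using p(3) by blast
        moreover have "x m \<in> U (p (Suc k))" "x n \<in> U (p (Suc k))"
          using that x decU[of "Suc k" m] decU[of "Suc k" n] by auto
        ultimately show ?thesis using small(1)[of "x m" i "p k" "x n"] p(1) by simp
      qed
      have "X.MCauchy x"
        unfolding X.MCauchy_def
      proof (intro conjI allI impI)
        show "range x \<subseteq> MX" using xM by auto
        fix e :: real assume "e > 0"
        then obtain k where "1 / real (Suc k) < e" using nat_approx_posE by blast
        then show "\<exists>N. \<forall>n n'. N \<le> n \<longrightarrow> N \<le> n' \<longrightarrow> dX (x n) (x n') < e"
          using dx[of k] by (intro exI[of _ "Suc k"]) (meson Suc_le_lessD less_trans)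
      qed
      then obtain l where l: "limitin X x l sequentially"
        using XC X unfolding X.mcomplete_def by blast
      then have ql: "limitin Z (q \<circ> x) (q l) sequentially"
        by (rule continuous_map_limit[OF q])
      \<comment> \<open>For late \<open>n\<close> both \<open>q (x n)\<close> and \<open>r\<close>
        lie in \<open>V (p (Suc k))\<close>, whose diameter is below
        \<open>1 / Suc k\<close>.\<close>
      have "limitin Z (q \<circ> x) r sequentially"
        unfolding Z Z.limit_metric_sequentially
      proof (intro conjI allI impI)
        show rM: "r \<in> MZ" using p(2) UV(2) openin_subset Z by fastforce
        fix e :: real assume "e > 0"
        then obtain k where k: "1 / real (Suc k) < e" using nat_approx_posE by blast
        have "(q \<circ> x) n \<in> MZ \<and> dZ ((q \<circ> x) n) r < e" if "n \<ge> Suc k" for n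
        proof -
          obtain i where i: "p (Suc k) = i # p k" using p(3) by blast
          have "x n \<in> U (p (Suc k))" using that x decU[of "Suc k" n] by auto
          then have "q (x n) \<in> V (p (Suc k))" using UV(3) by blast
          then have "dZ (q (x n)) r < 1 / real (Suc k)" using small(2)[of "q (x n)" i "p k" r] p i by metis
          moreover have "q (x n) \<in> MZ" using \<open>q (x n) \<in> V (p (Suc k))\<close> UV(2) openin_subset Z by fastforce
          ultimately show ?thesis using k by auto
        qed
        then show "\<exists>N. \<forall>n\<ge>N. (q \<circ> x) n \<in> MZ \<and> dZ ((q \<circ> x) n) r < e" by blast
      qed
      then have "r = q l"
        using ql Z.limitin_metric_unique Z by (metis trivial_limit_sequentially)
      moreover have "l \<in> topspace X" using l limitin_topspace by metis
      ultimately show "r \<in> S" using S by blast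
    qed
  qed
  ultimately show ?thesis by simp
qed

text \<open>After a Urysohn embedding of \<open>Y\<close>, complete metrizability becomes the
  G-delta property of a subset of a completely metrizable space, which the tree argument
  supplies.\<close>

theorem open_image_completely_metrizable:
  assumes X: "completely_metrizable_space X" "second_countable X"
    and q: "continuous_map X Y q" "open_map X Y q" "q ` topspace X = topspace Y"
    and Y: "regular_space Y" "Hausdorff_space Y"
  shows "completely_metrizable_space Y"
proof -
  have "second_countable Y" using second_countable_open_map_image q X by blast
  then obtain I :: "(nat \<times> nat) set" and e where e: "embedding_map Y (powertop_real I) e"
    using regular_second_countable_embedding Y by blast
  define S where "S = e ` topspace Y"
  have hom: "homeomorphic_map Y (subtopology (powertop_real I) S) e"
    using e by (simp add: embedding_map_def S_def)
  have cm: "completely_metrizable_space (powertop_real I)"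
    by (simp add: completely_metrizable_space_product_topology completely_metrizable_space_euclidean)
  have "gdelta_in (powertop_real I) S"
  proof (rule open_image_gdelta_in[OF X])
    show "metrizable_space (powertop_real I)" using cm completely_metrizable_imp_metrizable_space by blast
    show "continuous_map X (powertop_real I) (e \<circ> q)"
      using q(1) hom by (meson continuous_map_compose continuous_map_in_subtopology homeomorphic_imp_continuous_map)
    show "open_map X (subtopology (powertop_real I) S) (e \<circ> q)"
      using q(2) hom by (meson homeomorphic_imp_open_map open_map_compose)
    show "(e \<circ> q) ` topspace X = S" using q(3) unfolding S_def by (metis image_comp)
  qed
  then have "completely_metrizable_space (subtopology (powertop_real I) S)"
    by (rule completely_metrizable_space_gdelta_in[OF cm])
  then show ?thesis
    using hom homeomorphic_completely_metrizable_space homeomorphic_map_imp_homeomorphic_space by blast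
qed

subsection \<open>Borel sets of a topology\<close>

lemma space_borel_of [simp]: "space (borel_of T) = topspace T"
  by (simp add: borel_of_def space_measure_of_conv)

lemma sets_borel_of: "sets (borel_of T) = sigma_sets (topspace T) {U. openin T U}"
  unfolding borel_of_def by (intro sets_measure_of) (auto dest: openin_subset)

lemma borel_of_open: "openin T U \<Longrightarrow> U \<in> sets (borel_of T)"
  by (auto simp: sets_borel_of)

lemma borel_of_closed: "closedin T C \<Longrightarrow> C \<in> sets (borel_of T)"
  using borel_of_open[of T "topspace T - C"] sets.compl_sets[of "topspace T - C" "borel_of T"]
  by (simp add: closedin_def double_diff)

lemma measurable_borel_ofI:
  assumes "\<And>x. x \<in> space M \<Longrightarrow> f x \<in> topspace T"
    and "\<And>U. openin T U \<Longrightarrow> {x \<in> space M. f x \<in> U} \<in> sets M"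
  shows "f \<in> measurable M (borel_of T)"
  unfolding borel_of_def
  by (intro measurable_measure_of) (use assms in \<open>auto simp: vimage_def Int_def conj_commute dest: openin_subset\<close>)

lemma continuous_map_borel_measurable:
  "continuous_map S T f \<Longrightarrow> f \<in> measurable (borel_of S) (borel_of T)"
  by (intro measurable_borel_ofI) (auto simp: continuous_map_def Pi_iff intro!: borel_of_open)

lemma sets_borel_of_prod_topology:
  assumes "second_countable X" "second_countable Y"
  shows "sets (borel_of (prod_topology X Y)) = sets (borel_of X \<Otimes>\<^sub>M borel_of Y)"
proof
  obtain A :: "nat \<Rightarrow> 'a set" where "(\<forall>n. openin X (A n)) \<and>
      (\<forall>U x. openin X U \<longrightarrow> x \<in> U \<longrightarrow> (\<exists>n. x \<in> A n \<and> A n \<subseteq> U))"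
    using second_countable_sequence[OF assms(1)] by (rule exE)
  then have A: "\<And>n. openin X (A n)" "\<And>U x. openin X U \<Longrightarrow> x \<in> U \<Longrightarrow> \<exists>n::nat. x \<in> A n \<and> A n \<subseteq> U"
    by blast+
  obtain B :: "nat \<Rightarrow> 'b set" where "(\<forall>n. openin Y (B n)) \<and>
      (\<forall>U x. openin Y U \<longrightarrow> x \<in> U \<longrightarrow> (\<exists>n. x \<in> B n \<and> B n \<subseteq> U))"
    using second_countable_sequence[OF assms(2)] by (rule exE)
  then have B: "\<And>n. openin Y (B n)" "\<And>U x. openin Y U \<Longrightarrow> x \<in> U \<Longrightarrow> \<exists>n::nat. x \<in> B n \<and> B n \<subseteq> U"
    by blast+
  have "U \<in> sets (borel_of X \<Otimes>\<^sub>M borel_of Y)" if U: "openin (prod_topology X Y) U" for U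
  proof -
    have "U = (\<Union>p\<in>{p. A (fst p) \<times> B (snd p) \<subseteq> U}. A (fst p) \<times> B (snd p))"
    proof
      show "U \<subseteq> (\<Union>p\<in>{p. A (fst p) \<times> B (snd p) \<subseteq> U}. A (fst p) \<times> B (snd p))"
      proof
        fix z assume z: "z \<in> U"
        obtain x y where xy: "z = (x, y)" by (cases z)
        have "\<exists>S T. openin X S \<and> openin Y T \<and> x \<in> S \<and> y \<in> T \<and> S \<times> T \<subseteq> U"
          using U z unfolding xy openin_prod_topology_alt by simp
        then obtain S T where ST: "openin X S" "openin Y T" "x \<in> S" "y \<in> T" "S \<times> T \<subseteq> U"
          by (elim exE conjE) (rule that)
        obtain i where i: "x \<in> A i" "A i \<subseteq> S" using A(2)[OF ST(1,3)] by blast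
        obtain j where j: "y \<in> B j" "B j \<subseteq> T" using B(2)[OF ST(2,4)] by blast
        show "z \<in> (\<Union>p\<in>{p. A (fst p) \<times> B (snd p) \<subseteq> U}. A (fst p) \<times> B (snd p))"
          using i j ST(5) unfolding xy by (intro UN_I[of "(i, j)"]) auto
      qed
    qed auto
    also have "\<dots> \<in> sets (borel_of X \<Otimes>\<^sub>M borel_of Y)"
    proof (rule sets.countable_UN'')
      fix p :: "nat \<times> nat"
      show "A (fst p) \<times> B (snd p) \<in> sets (borel_of X \<Otimes>\<^sub>M borel_of Y)"
        by (intro pair_measureI borel_of_open A(1) B(1))
    qed auto
    finally show ?thesis .
  qed
  then show "sets (borel_of (prod_topology X Y)) \<subseteq> sets (borel_of X \<Otimes>\<^sub>M borel_of Y)"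
    unfolding sets_borel_of[of "prod_topology X Y"]
    using sets.sigma_sets_subset[of "{U. openin (prod_topology X Y) U}" "borel_of X \<Otimes>\<^sub>M borel_of Y"]
    by (auto simp: space_pair_measure)
  show "sets (borel_of X \<Otimes>\<^sub>M borel_of Y) \<subseteq> sets (borel_of (prod_topology X Y))"
  proof (rule sets_pair_in_sets)
    fix a b assume ab: "a \<in> sets (borel_of X)" "b \<in> sets (borel_of Y)"
    have "fst -` a \<inter> space (borel_of (prod_topology X Y)) \<in> sets (borel_of (prod_topology X Y))"
      by (rule measurable_sets[OF continuous_map_borel_measurable[OF continuous_map_fst] ab(1)])
    moreover have "snd -` b \<inter> space (borel_of (prod_topology X Y)) \<in> sets (borel_of (prod_topology X Y))"
      by (rule measurable_sets[OF continuous_map_borel_measurable[OF continuous_map_snd] ab(2)])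
    moreover have "a \<times> b = (fst -` a \<inter> space (borel_of (prod_topology X Y))) \<inter>
        (snd -` b \<inter> space (borel_of (prod_topology X Y)))"
      using ab[THEN sets.sets_into_space] by auto
    ultimately show "a \<times> b \<in> sets (borel_of (prod_topology X Y))" by (metis sets.Int)
  qed
qed

lemma polish_imp_second_countable: "polish_topology T \<Longrightarrow> second_countable T"
  by (simp add: polish_topology_def completely_metrizable_imp_metrizable_space
      metrizable_separable_imp_second_countable)

lemma polish_imp_Hausdorff: "polish_topology T \<Longrightarrow> Hausdorff_space T"
  by (simp add: polish_topology_def completely_metrizable_imp_metrizable_space metrizable_imp_Hausdorff_space)

lemma polish_prod_topology:
  "polish_topology X \<Longrightarrow> polish_topology Y \<Longrightarrow> polish_topology (prod_topology X Y)"
  using second_countable_prod_topology[of X Y] polish_imp_second_countable[of X] polish_imp_second_countable[of Y]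
  by (auto simp: polish_topology_def completely_metrizable_space_prod_topology second_countable_imp_separable_space)

lemma Hausdorff_space_disjoint_open:
  "Hausdorff_space T \<Longrightarrow> x \<in> topspace T \<Longrightarrow> y \<in> topspace T \<Longrightarrow> x \<noteq> y \<Longrightarrow>
    \<exists>U V. openin T U \<and> openin T V \<and> x \<in> U \<and> y \<in> V \<and> disjnt U V"
  by (simp add: Hausdorff_space_def)

subsection \<open>Analytic sets\<close>

definition agree :: "nat \<Rightarrow> (nat \<Rightarrow> 'a) \<Rightarrow> (nat \<Rightarrow> 'a) \<Rightarrow> bool" where
  "agree n s t \<longleftrightarrow> (\<forall>i<n. s i = t i)"

lemma agree_mono: "agree n s t \<Longrightarrow> m \<le> n \<Longrightarrow> agree m s t"
  by (auto simp: agree_def)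

text \<open>Closed subsets of the Baire space and continuous maps on them, expressed through finite initial segments.\<close>

definition closed_seqs :: "(nat \<Rightarrow> nat) set \<Rightarrow> bool" where
  "closed_seqs D \<longleftrightarrow> (\<forall>s. (\<forall>n. \<exists>t\<in>D. agree n s t) \<longrightarrow> s \<in> D)"

definition continuous_seqs :: "(nat \<Rightarrow> nat) set \<Rightarrow> 'a topology \<Rightarrow> ((nat \<Rightarrow> nat) \<Rightarrow> 'a) \<Rightarrow> bool" where
  "continuous_seqs D T h \<longleftrightarrow> (\<forall>s\<in>D. h s \<in> topspace T) \<and>
     (\<forall>s\<in>D. \<forall>U. openin T U \<longrightarrow> h s \<in> U \<longrightarrow> (\<exists>n. \<forall>t\<in>D. agree n s t \<longrightarrow> h t \<in> U))"

text \<open>Continuous images of closed subsets of the Baire space. Admitting an arbitrary closed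
  domain, possibly empty, treats the empty set without a special case.\<close>

definition analytic_in :: "'a topology \<Rightarrow> 'a set \<Rightarrow> bool" where
  "analytic_in T P \<longleftrightarrow> (\<exists>D h. closed_seqs D \<and> continuous_seqs D T h \<and> h ` D = P)"

lemma closed_seqsD: "closed_seqs D \<Longrightarrow> (\<And>n. \<exists>t\<in>D. agree n s t) \<Longrightarrow> s \<in> D"
  by (auto simp: closed_seqs_def)

lemma continuous_seqsD:
  "continuous_seqs D T h \<Longrightarrow> s \<in> D \<Longrightarrow> openin T U \<Longrightarrow> h s \<in> U \<Longrightarrow> \<exists>n. \<forall>t\<in>D. agree n s t \<longrightarrow> h t \<in> U"
  by (simp add: continuous_seqs_def)

lemma continuous_seqs_topspace: "continuous_seqs D T h \<Longrightarrow> s \<in> D \<Longrightarrow> h s \<in> topspace T"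
  by (simp add: continuous_seqs_def)

lemma continuous_seqs_compose:
  assumes h: "continuous_seqs D T h" and f: "continuous_map T T' f"
  shows "continuous_seqs D T' (f \<circ> h)"
  unfolding continuous_seqs_def
proof (intro conjI ballI allI impI)
  fix s assume s: "s \<in> D"
  then have hs: "h s \<in> topspace T" using h by (rule continuous_seqs_topspace[rotated])
  then show "(f \<circ> h) s \<in> topspace T'" using f by (auto simp: continuous_map_def Pi_iff)
  fix U assume U: "openin T' U" "(f \<circ> h) s \<in> U"
  have "openin T {x \<in> topspace T. f x \<in> U}" using f U by (intro openin_continuous_map_preimage)
  moreover have "h s \<in> {x \<in> topspace T. f x \<in> U}" using hs U by simp
  ultimately show "\<exists>n. \<forall>t\<in>D. agree n s t \<longrightarrow> (f \<circ> h) t \<in> U"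
    using continuous_seqsD[OF h s] by fastforce
qed

lemma analytic_in_image:
  assumes "analytic_in T P" "continuous_map T T' f"
  shows "analytic_in T' (f ` P)"
  using assms continuous_seqs_compose unfolding analytic_in_def by (metis image_comp)

lemma analytic_in_empty: "analytic_in T {}"
  unfolding analytic_in_def closed_seqs_def continuous_seqs_def by (intro exI[of _ "{}"]) auto

lemma analytic_in_Int_closed:
  assumes "analytic_in T P" and C: "closedin T C"
  shows "analytic_in T (P \<inter> C)"
proof -
  obtain D h where D: "closed_seqs D" and h: "continuous_seqs D T h" and P: "h ` D = P"
    using assms by (auto simp: analytic_in_def)
  define D' where "D' = {s \<in> D. h s \<in> C}"
  have "closed_seqs D'"
    unfolding closed_seqs_def
  proof (intro allI impI)
    fix s assume s: "\<forall>n. \<exists>t\<in>D'. agree n s t"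
    then have sD: "s \<in> D" by (intro closed_seqsD[OF D]) (auto simp: D'_def)
    have "h s \<in> C"
    proof (rule ccontr)
      assume "h s \<notin> C"
      then have "h s \<in> topspace T - C" using continuous_seqs_topspace[OF h sD] by auto
      then obtain n where "\<forall>t\<in>D. agree n s t \<longrightarrow> h t \<in> topspace T - C"
        using continuous_seqsD[OF h sD, of "topspace T - C"] C by auto
      then show False using s by (auto simp: D'_def)
    qed
    then show "s \<in> D'" using sD by (simp add: D'_def)
  qed
  moreover have "continuous_seqs D' T h"
    using h unfolding continuous_seqs_def D'_def by (metis (no_types, lifting) mem_Collect_eq)
  moreover have "h ` D' = P \<inter> C" using P by (auto simp: D'_def)
  ultimately show ?thesis unfolding analytic_in_def by blast
qed

text \<open>The first entry of a code selects the index \<open>i\<close>; the remaining entries are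
  a code for \<open>P i\<close>.\<close>

lemma analytic_in_UN:
  assumes "\<And>i::nat. analytic_in T (P i)"
  shows "analytic_in T (\<Union>i. P i)"
proof -
  have "\<forall>i. \<exists>D h. closed_seqs D \<and> continuous_seqs D T h \<and> h ` D = P i"
    using assms by (auto simp: analytic_in_def)
  then obtain D h where D: "\<And>i. closed_seqs (D i)" and h: "\<And>i. continuous_seqs (D i) T (h i)"
    and P: "\<And>i. h i ` D i = P i"
    by metis
  define D' where "D' = {s. s \<circ> Suc \<in> D (s 0)}"
  define h' where "h' s = h (s 0) (s \<circ> Suc)" for s
  have ag: "agree n (s \<circ> Suc) (t \<circ> Suc)" "s 0 = t 0" if "agree (Suc n) s t" for n and s t :: "nat \<Rightarrow> nat"
    using that by (auto simp: agree_def)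
  have "closed_seqs D'"
    unfolding closed_seqs_def
  proof (intro allI impI)
    fix s assume s: "\<forall>n. \<exists>t\<in>D'. agree n s t"
    have "s \<circ> Suc \<in> D (s 0)"
    proof (rule closed_seqsD[OF D])
      fix n
      obtain t where t: "t \<in> D'" "agree (Suc n) s t" using s by blast
      then show "\<exists>t\<in>D (s 0). agree n (s \<circ> Suc) t" using ag[OF t(2)] by (auto simp: D'_def)
    qed
    then show "s \<in> D'" by (simp add: D'_def)
  qed
  moreover have "continuous_seqs D' T h'"
    unfolding continuous_seqs_def
  proof (intro conjI ballI allI impI)
    fix s assume s: "s \<in> D'"
    then have s': "s \<circ> Suc \<in> D (s 0)" by (simp add: D'_def)
    then show "h' s \<in> topspace T" unfolding h'_def by (rule continuous_seqs_topspace[OF h])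
    fix U assume "openin T U" "h' s \<in> U"
    then obtain n where "\<forall>t\<in>D (s 0). agree n (s \<circ> Suc) t \<longrightarrow> h (s 0) t \<in> U"
      using continuous_seqsD[OF h s'] unfolding h'_def by blast
    then show "\<exists>n. \<forall>t\<in>D'. agree n s t \<longrightarrow> h' t \<in> U"
      using ag[of n s] unfolding D'_def h'_def by (intro exI[of _ "Suc n"]) fastforce
  qed
  moreover have "h' ` D' = (\<Union>i. P i)"
  proof
    show "h' ` D' \<subseteq> (\<Union>i. P i)" using P unfolding h'_def D'_def by blast
    show "(\<Union>i. P i) \<subseteq> h' ` D'"
    proof
      fix p assume "p \<in> (\<Union>i. P i)"
      then obtain i s where s: "s \<in> D i" "p = h i s" using P by blast
      have "case_nat i s \<in> D'" "h' (case_nat i s) = p" using s by (auto simp: D'_def h'_def o_def)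
      then show "p \<in> h' ` D'" by blast
    qed
  qed
  ultimately show ?thesis unfolding analytic_in_def by blast
qed

text \<open>A code is read as a matrix through \<open>prod_encode\<close>, with row \<open>i\<close>
  a code for \<open>P i\<close>. The requirement that all rows name the same point is a closed
  condition because the space is Hausdorff.\<close>

lemma analytic_in_INT:
  assumes "Hausdorff_space T" and "\<And>i::nat. analytic_in T (P i)"
  shows "analytic_in T (\<Inter>i. P i)"
proof -
  have "\<forall>i. \<exists>D h. closed_seqs D \<and> continuous_seqs D T h \<and> h ` D = P i"
    using assms by (auto simp: analytic_in_def)
  then obtain D h where D: "\<And>i. closed_seqs (D i)" and h: "\<And>i. continuous_seqs (D i) T (h i)"
    and P: "\<And>i. h i ` D i = P i"
    by metis
  define row where "row i s = (\<lambda>n. s (prod_encode (i, n)))" for i and s :: "nat \<Rightarrow> nat"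
  define D' where "D' = {s. \<forall>i. row i s \<in> D i \<and> h i (row i s) = h 0 (row 0 s)}"
  define h' where "h' s = h 0 (row 0 s)" for s
  \<comment> \<open>The first \<open>n\<close> entries of row \<open>i\<close> sit at positions
    below \<open>N i n\<close>, so agreement up to \<open>N i n\<close> implies agreement of the
    rows up to \<open>n\<close>.\<close>
  define N where "N i n = Suc (\<Sum>k<n. prod_encode (i, k))" for i n
  have ag: "agree n (row i s) (row i t)" if "agree (N i n) s t" for i n s t
    unfolding agree_def row_def
  proof (intro allI impI)
    fix k assume "k < n"
    then have "prod_encode (i, k) \<le> (\<Sum>k<n. prod_encode (i, k))" by (intro member_le_sum) auto
    then show "s (prod_encode (i, k)) = t (prod_encode (i, k))" using that by (auto simp: agree_def N_def)
  qed
  have "closed_seqs D'"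
    unfolding closed_seqs_def
  proof (intro allI impI)
    fix s assume s: "\<forall>n. \<exists>t\<in>D'. agree n s t"
    have mem: "row i s \<in> D i" for i
    proof (rule closed_seqsD[OF D])
      fix n
      obtain t where t: "t \<in> D'" "agree (N i n) s t" using s by blast
      then show "\<exists>t\<in>D i. agree n (row i s) t" using ag[OF t(2)] by (auto simp: D'_def)
    qed
    have "h i (row i s) = h 0 (row 0 s)" for i
    proof (rule ccontr)
      assume ne: "h i (row i s) \<noteq> h 0 (row 0 s)"
      obtain U V where UV: "openin T U" "openin T V" "h i (row i s) \<in> U" "h 0 (row 0 s) \<in> V" "disjnt U V"
        using Hausdorff_space_disjoint_open[OF assms(1) continuous_seqs_topspace[OF h[of i] mem[of i]] continuous_seqs_topspace[OF h[of 0] mem[of 0]] ne] by (elim exE conjE) (rule that)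
      have "\<exists>n. \<forall>t\<in>D i. agree n (row i s) t \<longrightarrow> h i t \<in> U"
        using h[of i] mem[of i] UV(1) UV(3) unfolding continuous_seqs_def by simp
      then obtain n where n: "\<forall>t\<in>D i. agree n (row i s) t \<longrightarrow> h i t \<in> U" ..
      have "\<exists>m. \<forall>t\<in>D 0. agree m (row 0 s) t \<longrightarrow> h 0 t \<in> V"
        using h[of 0] mem[of 0] UV(2) UV(4) unfolding continuous_seqs_def by simp
      then obtain m where m: "\<forall>t\<in>D 0. agree m (row 0 s) t \<longrightarrow> h 0 t \<in> V" ..
      obtain t where t: "t \<in> D'" "agree (max (N i n) (N 0 m)) s t" using s by blast
      have "agree n (row i s) (row i t)" "agree m (row 0 s) (row 0 t)"
        using t(2) by (auto intro!: ag elim!: agree_mono)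
      then have "h i (row i t) \<in> U" "h 0 (row 0 t) \<in> V" using n m t by (auto simp: D'_def)
      moreover have "h i (row i t) = h 0 (row 0 t)" using t by (auto simp: D'_def)
      ultimately show False using UV(5) by (auto simp: disjnt_def)
    qed
    then show "s \<in> D'" using mem by (auto simp: D'_def)
  qed
  moreover have "continuous_seqs D' T h'"
    unfolding continuous_seqs_def
  proof (intro conjI ballI allI impI)
    fix s assume s: "s \<in> D'"
    then have s': "row 0 s \<in> D 0" by (simp add: D'_def)
    then show "h' s \<in> topspace T" unfolding h'_def by (rule continuous_seqs_topspace[OF h])
    fix U assume "openin T U" "h' s \<in> U"
    then obtain n where "\<forall>t\<in>D 0. agree n (row 0 s) t \<longrightarrow> h 0 t \<in> U"
      using continuous_seqsD[OF h s'] unfolding h'_def by blast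
    then show "\<exists>n. \<forall>t\<in>D'. agree n s t \<longrightarrow> h' t \<in> U"
      using ag[of 0 n s] unfolding D'_def h'_def by (intro exI[of _ "N 0 n"]) auto
  qed
  moreover have "h' ` D' = (\<Inter>i. P i)"
  proof
    show "h' ` D' \<subseteq> (\<Inter>i. P i)"
    proof (clarsimp simp: D'_def h'_def)
      fix s i assume "\<forall>i. row i s \<in> D i \<and> h i (row i s) = h 0 (row 0 s)"
      then show "h 0 (row 0 s) \<in> P i" using P[of i] by (metis imageI)
    qed
    show "(\<Inter>i. P i) \<subseteq> h' ` D'"
    proof
      fix p assume "p \<in> (\<Inter>i. P i)"
      then have "\<forall>i. \<exists>s\<in>D i. h i s = p" using P by (metis INT_D UNIV_I imageE)
      then obtain s where s: "\<And>i. s i \<in> D i" "\<And>i. h i (s i) = p" by metis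
      define t where "t m = s (fst (prod_decode m)) (snd (prod_decode m))" for m
      have "row i t = s i" for i by (auto simp: row_def t_def)
      then have "t \<in> D'" "h' t = p" using s by (auto simp: D'_def h'_def)
      then show "p \<in> h' ` D'" by blast
    qed
  qed
  ultimately show ?thesis unfolding analytic_in_def by blast
qed

text \<open>A code lists indices of points of a dense sequence that converges at the prescribed rate
  \<open>e n\<close>, the powers of \<open>1/2\<close>, and it names the limit. The rate makes the
  limit depend continuously on the code.\<close>

lemma analytic_in_topspace:
  assumes "polish_topology T"
  shows "analytic_in T (topspace T)"
proof (cases "topspace T = {}")
  case True
  then show ?thesis by (simp add: analytic_in_empty)
next
  case False
  obtain M d where "Metric_space M d" and mc: "Metric_space.mcomplete M d" and T: "T = Metric_space.mtopology M d"
    using assms by (auto simp: polish_topology_def completely_metrizable_space_def)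
  interpret Metric_space M d by fact
  obtain C where C: "countable C" "C \<subseteq> M" "T closure_of C = M"
    using assms T by (auto simp: polish_topology_def separable_space_def)
  have "C \<noteq> {}" using C False T by auto
  define z where "z = from_nat_into C"
  have z: "range z = C" unfolding z_def using C \<open>C \<noteq> {}\<close> by (intro range_from_nat_into)
  have zM: "z n \<in> M" for n using z C by blast
  define e where "e n = (1/2::real) ^ n" for n
  have e: "e n > 0" for n by (simp add: e_def)
  have e_small: "\<exists>n. e n < r" if "r > 0" for r using real_arch_pow_inv[of r "1/2"] that by (auto simp: e_def)
  have e_mono: "e n \<le> e m" if "m \<le> n" for m n using that by (simp add: e_def power_decreasing)
  \<comment> \<open>Each instance involves only two entries, so \<open>D\<close> is closed; and any
    \<open>s\<close> with \<open>d (z (s i)) l \<le> e i\<close> for all \<open>i\<close> satisfies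
    it by the triangle inequality, which gives surjectivity.\<close>
  define D where "D = {s. \<forall>i j. d (z (s i)) (z (s j)) \<le> e i + e j}"
  have lim_ex: "\<exists>l. limitin T (\<lambda>i. z (s i)) l sequentially" if s: "s \<in> D" for s
  proof -
    have "MCauchy (\<lambda>i. z (s i))"
      unfolding MCauchy_def
    proof (intro conjI allI impI)
      show "range (\<lambda>i. z (s i)) \<subseteq> M" using zM by auto
      fix r :: real assume "r > 0"
      then obtain N where N: "e N < r / 2" using e_small[of "r/2"] by auto
      have "d (z (s i)) (z (s j)) < r" if "N \<le> i" "N \<le> j" for i j
      proof -
        have "d (z (s i)) (z (s j)) \<le> e i + e j" using s by (simp add: D_def)
        then show ?thesis using e_mono[OF that(1)] e_mono[OF that(2)] N by linarith
      qed
      then show "\<exists>N. \<forall>n n'. N \<le> n \<longrightarrow> N \<le> n' \<longrightarrow> d (z (s n)) (z (s n')) < r" by blast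
    qed
    then show ?thesis using mc unfolding mcomplete_def T by blast
  qed
  define h where "h s = (SOME l. limitin T (\<lambda>i. z (s i)) l sequentially)" for s
  have lim: "limitin T (\<lambda>i. z (s i)) (h s) sequentially" if "s \<in> D" for s
    unfolding h_def using lim_ex[OF that] by (rule someI_ex)
  have hM: "h s \<in> M" if "s \<in> D" for s using lim[OF that] limitin_topspace T by fastforce
  have near: "d (z (s i)) (h s) \<le> e i" if s: "s \<in> D" for s i
  proof (rule field_le_epsilon)
    fix r :: real assume r: "r > 0"
    obtain N where N: "e N < r / 2" using e_small[of "r/2"] r by auto
    obtain M' where M': "\<And>n. n \<ge> M' \<Longrightarrow> d (z (s n)) (h s) < r / 2"
      using lim[OF s] r unfolding T limit_metric_sequentially by (meson half_gt_zero)
    define n where "n = max N M'"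
    have "d (z (s i)) (h s) \<le> d (z (s i)) (z (s n)) + d (z (s n)) (h s)"
      using zM hM[OF s] by (intro triangle)
    moreover have "d (z (s i)) (z (s n)) \<le> e i + e n" using s by (simp add: D_def)
    moreover have "e n \<le> e N" by (intro e_mono) (simp add: n_def)
    ultimately show "d (z (s i)) (h s) \<le> e i + r" using N M'[of n] by (simp add: n_def)
  qed
  have "closed_seqs D"
    unfolding closed_seqs_def
  proof (intro allI impI)
    fix s assume s: "\<forall>n. \<exists>t\<in>D. agree n s t"
    show "s \<in> D"
      unfolding D_def
    proof (intro CollectI allI)
      fix i j
      obtain t where "t \<in> D" "agree (Suc (max i j)) s t" using s by blast
      then show "d (z (s i)) (z (s j)) \<le> e i + e j" by (auto simp: D_def agree_def)
    qed
  qed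
  moreover have "continuous_seqs D T h"
    unfolding continuous_seqs_def
  proof (intro conjI ballI allI impI)
    fix s assume s: "s \<in> D"
    then show "h s \<in> topspace T" using hM T by simp
    fix U assume U: "openin T U" "h s \<in> U"
    then obtain r where r: "r > 0" "mball (h s) r \<subseteq> U" using openin_mtopology T by blast
    obtain n where n: "e n < r / 2" using e_small[of "r/2"] r by auto
    have "h t \<in> U" if t: "t \<in> D" "agree (Suc n) s t" for t
    proof -
      have "d (z (s n)) (h s) \<le> e n" "d (z (t n)) (h t) \<le> e n" "t n = s n"
        using near[OF s, of n] near[OF t(1), of n] t(2) by (simp_all add: agree_def)
      moreover have "d (h s) (h t) \<le> d (z (s n)) (h s) + d (z (s n)) (h t)"
        using triangle''[of "h s" "z (s n)" "h t"] hM s t zM by (auto simp: commute)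
      ultimately have "h t \<in> mball (h s) r" using n hM s t by auto
      then show ?thesis using r by auto
    qed
    then show "\<exists>n. \<forall>t\<in>D. agree n s t \<longrightarrow> h t \<in> U" by blast
  qed
  moreover have "h ` D = topspace T"
  proof
    show "h ` D \<subseteq> topspace T" using hM T by auto
    show "topspace T \<subseteq> h ` D"
    proof
      fix l assume "l \<in> topspace T"
      then have l: "l \<in> M" "l \<in> T closure_of C" using C T by auto
      have "\<exists>k. d (z k) l \<le> e i" for i
      proof -
        obtain c where "c \<in> C" "c \<in> mball l (e i)"
          using l(2) e[of i] unfolding T metric_closure_of by blast
        then obtain k where "c = z k" "c \<in> mball l (e i)" using z by blast
        then show ?thesis by (auto simp: commute intro!: exI[of _ k])
      qed
      then obtain s where s: "\<And>i. d (z (s i)) l \<le> e i" by metis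
      have sD: "s \<in> D"
        unfolding D_def
      proof (intro CollectI allI)
        fix i j
        have "d (z (s i)) (z (s j)) \<le> d (z (s i)) l + d (z (s j)) l"
          using triangle''[of "z (s i)" l "z (s j)"] zM l by (auto simp: commute)
        then show "d (z (s i)) (z (s j)) \<le> e i + e j" using s[of i] s[of j] by linarith
      qed
      have "limitin T (\<lambda>i. z (s i)) l sequentially"
        unfolding T limit_metric_sequentially
      proof (intro conjI allI impI)
        show "l \<in> M" by fact
        fix r :: real assume "r > 0"
        then obtain N where N: "e N < r" using e_small by blast
        have "z (s n) \<in> M \<and> d (z (s n)) l < r" if "n \<ge> N" for n
          using s[of n] e_mono[OF that] N zM by auto
        then show "\<exists>N. \<forall>n\<ge>N. z (s n) \<in> M \<and> d (z (s n)) l < r" by blast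
      qed
      then have "l = h s" using lim[OF sD] limitin_metric_unique T by (metis trivial_limit_sequentially)
      then show "l \<in> h ` D" using sD by blast
    qed
  qed
  ultimately show ?thesis unfolding analytic_in_def by blast
qed

lemma analytic_in_closed:
  "polish_topology T \<Longrightarrow> closedin T C \<Longrightarrow> analytic_in T C"
  using analytic_in_Int_closed[OF analytic_in_topspace, of T C] closedin_subset[of T C]
  by (simp add: Int_absorb1)

text \<open>Analytic sets are not closed under complements, so the induction over the Borel sets
  carries each set together with its complement. The base case uses that open sets are countable
  unions of closed ones.\<close>

lemma analytic_in_borel:
  assumes T: "polish_topology T" and "A \<in> sets (borel_of T)"
  shows "analytic_in T A"
proof -
  have "A \<in> sigma_sets (topspace T) {U. openin T U}" using assms by (simp add: sets_borel_of)
  then have "analytic_in T A \<and> analytic_in T (topspace T - A)"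
  proof induction
    case (Basic U)
    then have U: "openin T U" by simp
    then have "fsigma_in T U"
      using T by (intro open_imp_fsigma_in) (auto simp: polish_topology_def completely_metrizable_imp_metrizable_space)
    then obtain C :: "nat \<Rightarrow> 'a set" where "\<forall>n. closedin T (C n)" "\<Union>(range C) = U" by (auto simp: fsigma_in_ascending)
    then have "analytic_in T U" using analytic_in_UN[of T C] analytic_in_closed[OF T] by auto
    then show ?case using analytic_in_closed[OF T] U by blast
  next
    case Empty
    then show ?case using analytic_in_empty analytic_in_topspace[OF T] by simp
  next
    case (Compl a)
    moreover from this have "topspace T - (topspace T - a) = a"
      using sigma_sets_into_sp[of "{U. openin T U}" "topspace T" a] by (auto dest: openin_subset)
    ultimately show ?case by simp
  next
    case (Union a)
    have "topspace T - (\<Union>i. a i) = (\<Inter>i. topspace T - a i)" by auto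
    then show ?case
      using Union analytic_in_UN[of T a] analytic_in_INT[OF polish_imp_Hausdorff[OF T], of "\<lambda>i. topspace T - a i"] by auto
  qed
  then show ?thesis by simp
qed


text \<open>Lusin's separation argument: if \<open>h ` D\<close> and \<open>k ` E\<close> had no separating Borel set, then neither would the images
  of shrinking cylinders around some \<open>s \<in> D\<close> and \<open>t \<in> E\<close>, but these are eventually contained in disjoint
  neighbourhoods of \<open>h s \<noteq> k t\<close>.\<close>

theorem analytic_separation:
  assumes T: "Hausdorff_space T" and "analytic_in T P" "analytic_in T Q" "P \<inter> Q = {}"
  shows "\<exists>C\<in>sets (borel_of T). P \<subseteq> C \<and> Q \<inter> C = {}"
proof -
  obtain D h where D: "closed_seqs D" and h: "continuous_seqs D T h" and P: "h ` D = P"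
    using assms(2) by (auto simp: analytic_in_def)
  obtain E k where E: "closed_seqs E" and k: "continuous_seqs E T k" and Q: "k ` E = Q"
    using assms(3) by (auto simp: analytic_in_def)
  define sep where "sep A B \<longleftrightarrow> (\<exists>C\<in>sets (borel_of T). A \<subseteq> C \<and> B \<inter> C = {})" for A B
  have sep_UN: "sep (\<Union>i. A i) (\<Union>j. B j)" if "\<And>i j. sep (A i) (B j)" for A B :: "nat \<Rightarrow> 'a set"
  proof -
    obtain C where C: "\<And>i j. C i j \<in> sets (borel_of T)" "\<And>i j. A i \<subseteq> C i j" "\<And>i j. B j \<inter> C i j = {}"
      using \<open>\<And>i j. sep (A i) (B j)\<close> unfolding sep_def by metis
    have "(\<Union>i. \<Inter>j. C i j) \<in> sets (borel_of T)"
      by (intro sets.countable_UN' sets.countable_INT' C(1)) (auto intro: C(1))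
    moreover have "(\<Union>i. A i) \<subseteq> (\<Union>i. \<Inter>j. C i j)" using C(2) by blast
    moreover have "(\<Union>j. B j) \<inter> (\<Union>i. \<Inter>j. C i j) = {}" using C(3) by blast
    ultimately show ?thesis unfolding sep_def by blast
  qed
  define PP where "PP n s = h ` {t\<in>D. agree n s t}" for n s
  define QQ where "QQ n s = k ` {t\<in>E. agree n s t}" for n s
  have split: "{t\<in>X. agree n s t} = (\<Union>i. {t\<in>X. agree (Suc n) (s(n := i)) t})" for n X and s :: "nat \<Rightarrow> nat"
  proof
    show "{t \<in> X. agree n s t} \<subseteq> (\<Union>i. {t \<in> X. agree (Suc n) (s(n := i)) t})"
      by (auto simp: agree_def less_Suc_eq)
    show "(\<Union>i. {t \<in> X. agree (Suc n) (s(n := i)) t}) \<subseteq> {t \<in> X. agree n s t}"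
    proof clarsimp
      fix t i assume "agree (Suc n) (s(n := i)) t"
      then show "agree n s t" unfolding agree_def by (metis fun_upd_other less_Suc_eq nat_neq_iff)
    qed
  qed
  have PP: "PP n s = (\<Union>i. PP (Suc n) (s(n := i)))" for n s
    unfolding PP_def by (subst split) (rule image_UN)
  have QQ: "QQ n s = (\<Union>i. QQ (Suc n) (s(n := i)))" for n s
    unfolding QQ_def by (subst split) (rule image_UN)
  have cong: "PP n s = PP n s'" "QQ n s = QQ n s'" if "agree n s s'" for n s s'
    using that by (auto simp: PP_def QQ_def agree_def)
  have "sep P Q"
  proof (rule ccontr)
    assume ns: "\<not> sep P Q"
    define R where "R n p \<longleftrightarrow> \<not> sep (PP n (fst p)) (QQ n (snd p))" for n and p :: "(nat \<Rightarrow> nat) \<times> (nat \<Rightarrow> nat)"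
    have "\<exists>p'. R (Suc n) p' \<and> agree n (fst p) (fst p') \<and> agree n (snd p) (snd p')" if "R n p" for n p
    proof -
      have "\<exists>i j. \<not> sep (PP (Suc n) ((fst p)(n := i))) (QQ (Suc n) ((snd p)(n := j)))"
      proof (rule ccontr)
        assume "\<not> ?thesis"
        then have "sep (PP n (fst p)) (QQ n (snd p))"
          unfolding PP[of n "fst p"] QQ[of n "snd p"] by (intro sep_UN) blast
        then show False using \<open>R n p\<close> by (simp add: R_def)
      qed
      then obtain i j where "\<not> sep (PP (Suc n) ((fst p)(n := i))) (QQ (Suc n) ((snd p)(n := j)))" by blast
      then show ?thesis
        by (intro exI[of _ "((fst p)(n := i), (snd p)(n := j))"]) (auto simp: R_def agree_def)
    qed
    moreover have "R 0 (\<lambda>_. 0, \<lambda>_. 0)" using ns P Q by (simp add: R_def PP_def QQ_def agree_def)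
    ultimately obtain f where f: "\<And>n. R n (f n)"
      "\<And>n. agree n (fst (f n)) (fst (f (Suc n)))" "\<And>n. agree n (snd (f n)) (snd (f (Suc n)))"
      using dependent_nat_choice[of R "\<lambda>n p p'. agree n (fst p) (fst p') \<and> agree n (snd p) (snd p')"] by blast
    define s where "s n = fst (f (Suc n)) n" for n
    define t where "t n = snd (f (Suc n)) n" for n
    have st: "agree n (fst (f n)) s \<and> agree n (snd (f n)) t" for n
    proof (induction n)
      case (Suc n)
      then show ?case using f(2)[of n] f(3)[of n] by (auto simp: agree_def less_Suc_eq s_def t_def)
    qed (auto simp: agree_def)
    have nsep: "\<not> sep (PP n s) (QQ n t)" for n
      using f(1)[of n] cong st unfolding R_def by metis
    have "PP n s \<noteq> {}" for n using nsep[of n] unfolding sep_def by (metis Int_empty_right empty_subsetI sets.empty_sets)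
    then have "\<And>n. \<exists>t\<in>D. agree n s t" unfolding PP_def by blast
    then have sD: "s \<in> D" by (rule closed_seqsD[OF D])
    \<comment> \<open>Here the separator has to contain the left-hand set, so an empty right-hand
      set is separated by the whole space instead of the empty set.\<close>
    have "QQ n t \<noteq> {}" for n
    proof
      assume "QQ n t = {}"
      moreover have "PP n s \<subseteq> topspace T" using continuous_seqs_topspace[OF h] by (auto simp: PP_def)
      ultimately have "sep (PP n s) (QQ n t)"
        unfolding sep_def by (intro bexI[of _ "topspace T"]) (auto intro: borel_of_open)
      then show False using nsep by blast
    qed
    then have "\<And>n. \<exists>t'\<in>E. agree n t t'" unfolding QQ_def by blast
    then have tE: "t \<in> E" by (rule closed_seqsD[OF E])
    have "h s \<noteq> k t" using sD tE P Q assms(4) by blast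
    from Hausdorff_space_disjoint_open[OF T continuous_seqs_topspace[OF h sD] continuous_seqs_topspace[OF k tE] this]
    obtain U V where UV: "openin T U" "openin T V" "h s \<in> U" "k t \<in> V" "disjnt U V"
      by (elim exE conjE) (rule that)
    obtain n where n: "\<forall>t\<in>D. agree n s t \<longrightarrow> h t \<in> U"
      using continuous_seqsD[OF h sD UV(1,3)] by (rule exE)
    obtain m where m: "\<forall>t'\<in>E. agree m t t' \<longrightarrow> k t' \<in> V"
      using continuous_seqsD[OF k tE UV(2,4)] by (rule exE)
    have "PP (max n m) s \<subseteq> U" using n agree_mono[of "max n m" s _ n] by (auto simp: PP_def)
    moreover have "QQ (max n m) t \<inter> U = {}" 
      using m UV(5) agree_mono[of "max n m" t _ m] by (auto simp: QQ_def disjnt_def)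
    ultimately have "sep (PP (max n m) s) (QQ (max n m) t)"
      unfolding sep_def using borel_of_open[OF UV(1)] by blast
    then show False using nsep by blast
  qed
  then show ?thesis by (simp add: sep_def)
qed

text \<open>The Lusin--Souslin theorem: the images of \<open>A\<close> and of its complement are disjoint analytic sets.\<close>

theorem borel_injective_preimage:
  assumes X: "polish_topology X" and Y: "polish_topology Y"
    and f: "f \<in> measurable (borel_of X) (borel_of Y)" and inj: "inj_on f (topspace X)"
    and A: "A \<in> sets (borel_of X)"
  shows "\<exists>C\<in>sets (borel_of Y). A = {x \<in> topspace X. f x \<in> C}"
proof -
  note sc = polish_imp_second_countable
  note [measurable] = f
  have fY: "f x \<in> topspace Y" if "x \<in> topspace X" for x
    using measurable_space[OF f] that by simp
  have YY: "sets (borel_of (prod_topology Y Y)) = sets (borel_of Y \<Otimes>\<^sub>M borel_of Y)"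
    using sc[OF Y] by (intro sets_borel_of_prod_topology)
  have XY: "sets (borel_of (prod_topology X Y)) = sets (borel_of X \<Otimes>\<^sub>M borel_of Y)"
    using sc[OF X] sc[OF Y] by (intro sets_borel_of_prod_topology)
  have diag: "((\<lambda>y. (y, y)) ` topspace Y) \<in> sets (borel_of Y \<Otimes>\<^sub>M borel_of Y)"
    unfolding YY[symmetric] using polish_imp_Hausdorff[OF Y]
    by (intro borel_of_closed) (simp add: Hausdorff_space_closedin_diagonal)
  have img: "analytic_in Y (f ` B)" if B: "B \<in> sets (borel_of X)" for B
  proof -
    \<comment> \<open>The image of \<open>B\<close> is the projection of the graph of
      \<open>f\<close> over \<open>B\<close>. The graph is Borel as a preimage of the diagonal,
      which is closed in a Hausdorff space.\<close>
    define \<Gamma> where "\<Gamma> = {p \<in> space (borel_of X \<Otimes>\<^sub>M borel_of Y). fst p \<in> B \<and> (f (fst p), snd p) \<in> (\<lambda>y. (y, y)) ` topspace Y}"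
    have "(\<lambda>p. (f (fst p), snd p)) \<in> measurable (borel_of X \<Otimes>\<^sub>M borel_of Y) (borel_of Y \<Otimes>\<^sub>M borel_of Y)"
      by measurable
    from measurable_sets[OF this diag] measurable_sets[OF measurable_fst B, of "borel_of Y"]
    have "(\<lambda>p. (f (fst p), snd p)) -` ((\<lambda>y. (y, y)) ` topspace Y) \<inter> space (borel_of X \<Otimes>\<^sub>M borel_of Y) \<inter>
        (fst -` B \<inter> space (borel_of X \<Otimes>\<^sub>M borel_of Y)) \<in> sets (borel_of X \<Otimes>\<^sub>M borel_of Y)"
      by (rule sets.Int)
    also have "(\<lambda>p. (f (fst p), snd p)) -` ((\<lambda>y. (y, y)) ` topspace Y) \<inter> space (borel_of X \<Otimes>\<^sub>M borel_of Y) \<inter>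
        (fst -` B \<inter> space (borel_of X \<Otimes>\<^sub>M borel_of Y)) = \<Gamma>"
      by (auto simp: \<Gamma>_def)
    finally have "analytic_in (prod_topology X Y) \<Gamma>"
      unfolding XY[symmetric] by (rule analytic_in_borel[OF polish_prod_topology[OF X Y]])
    then have "analytic_in Y (snd ` \<Gamma>)" by (rule analytic_in_image[OF _ continuous_map_snd])
    also have "snd ` \<Gamma> = f ` B"
    proof
      show "snd ` \<Gamma> \<subseteq> f ` B" by (auto simp: \<Gamma>_def)
      show "f ` B \<subseteq> snd ` \<Gamma>"
      proof
        fix y assume "y \<in> f ` B"
        then obtain x where x: "x \<in> B" "y = f x" by blast
        then have "(x, y) \<in> \<Gamma>" using sets.sets_into_space[OF B] fY[of x] by (auto simp: \<Gamma>_def space_pair_measure)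
        then show "y \<in> snd ` \<Gamma>" by force
      qed
    qed
    finally show ?thesis .
  qed
  have AX: "A \<subseteq> topspace X" using sets.sets_into_space[OF A] by simp
  have "topspace X - A \<in> sets (borel_of X)" using sets.compl_sets[OF A] by simp
  moreover have "f ` A \<inter> f ` (topspace X - A) = {}" using inj AX unfolding inj_on_def by blast
  ultimately have "\<exists>C\<in>sets (borel_of Y). f ` A \<subseteq> C \<and> f ` (topspace X - A) \<inter> C = {}"
    by (intro analytic_separation[OF polish_imp_Hausdorff[OF Y] img[OF A] img])
  then obtain C where "C \<in> sets (borel_of Y)" "f ` A \<subseteq> C" "f ` (topspace X - A) \<inter> C = {}"
    by blast
  then show ?thesis using AX by (intro bexI[of _ C]) auto
qed

section \<open>Generating families and images under Borel bijections\<close>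

lemma borel_of_euclidean: "borel_of euclidean = borel"
  by (simp add: borel_of_def borel_def)

lemma polish_euclidean: "polish_topology (euclidean :: 'a :: polish_space topology)"
proof -
  obtain B :: "'a set set" where B: "countable B" "topological_basis B" using ex_countable_basis by blast
  have "\<exists>V\<in>B. x \<in> V \<and> V \<subseteq> U" if "open U" "x \<in> U" for U x
    using topological_basisE[OF B(2) that] by metis
  then have "second_countable (euclidean :: 'a topology)"
    unfolding second_countable_def using B topological_basis_open[OF B(2)] by (intro exI[of _ B]) auto
  then show ?thesis
    by (simp add: polish_topology_def completely_metrizable_space_euclidean second_countable_imp_separable_space)
qed

text \<open>A countable separating family of Borel sets is the family of coordinate preimages of an injective map into a product.\<close>

theorem separating_family_generates:
  fixes A :: "nat \<Rightarrow> 'a set"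
  assumes X: "polish_topology X" and A: "\<And>n. A n \<in> sets (borel_of X)"
    and sep: "\<And>x y. x \<in> topspace X \<Longrightarrow> y \<in> topspace X \<Longrightarrow> x \<noteq> y \<Longrightarrow> \<exists>n. x \<in> A n \<longleftrightarrow> y \<notin> A n"
  shows "sets (borel_of X) = sigma_sets (topspace X) (range A)"
proof
  show "sigma_sets (topspace X) (range A) \<subseteq> sets (borel_of X)"
    using sets.sigma_sets_subset[of "range A" "borel_of X"] A by auto
  define f where "f x = (\<lambda>n. indicator (A n) x :: real)" for x
  have AX: "range A \<subseteq> Pow (topspace X)" using A sets.sets_into_space[of "A _" "borel_of X"] by auto
  have f: "f \<in> borel_measurable N" if "\<And>n. A n \<in> sets N" for N
    using that unfolding f_def by (intro measurable_coordinatewise_then_product borel_measurable_indicator) auto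
  show "sets (borel_of X) \<subseteq> sigma_sets (topspace X) (range A)"
  proof
    fix B assume B: "B \<in> sets (borel_of X)"
    have "inj_on f (topspace X)"
    proof (rule inj_onI, rule ccontr)
      fix x y assume xy: "x \<in> topspace X" "y \<in> topspace X" "f x = f y" "x \<noteq> y"
      then obtain n where "x \<in> A n \<longleftrightarrow> y \<notin> A n" using sep by blast
      then have "f x n \<noteq> f y n" by (auto simp: f_def indicator_def)
      then show False using xy(3) by simp
    qed
    then obtain C where C: "C \<in> sets (borel :: (nat \<Rightarrow> real) measure)" "B = {x \<in> topspace X. f x \<in> C}"
      using borel_injective_preimage[OF X polish_euclidean, of f B] f[of "borel_of X"] A B
      by (auto simp: borel_of_euclidean)
    define N where "N = sigma (topspace X) (range A)"
    have N: "sets N = sigma_sets (topspace X) (range A)" "space N = topspace X"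
      unfolding N_def using AX by (auto simp: space_measure_of_conv)
    have "f -` C \<inter> space N \<in> sets N" using C(1) by (intro measurable_sets[OF f]) (auto simp: N)
    moreover have "f -` C \<inter> space N = B" using C(2) N by auto
    ultimately show "B \<in> sigma_sets (topspace X) (range A)" using N by simp
  qed
qed

lemma standard_borel_bij_image:
  assumes "standard_borel M" and T: "T \<in> measurable M M" and bij: "bij_betw T (space M) (space M)"
    and A: "A \<in> sets M"
  shows "T ` A \<in> sets M"
proof -
  obtain X where X: "polish_topology X" "topspace X = space M" "sets M = sets (borel_of X)"
    using assms(1) by (auto simp: standard_borel_def)
  have "T \<in> measurable (borel_of X) (borel_of X)"
    using T measurable_cong_sets[OF X(3) X(3)] by blast
  then obtain C where C: "C \<in> sets (borel_of X)" "A = {x \<in> topspace X. T x \<in> C}"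
    using borel_injective_preimage[OF X(1) X(1), of T A] bij A X by (auto simp: bij_betw_def)
  have "T ` A = C"
    using C bij sets.sets_into_space[OF C(1)] X(2) unfolding bij_betw_def by force
  then show ?thesis using C X by simp
qed


subsection \<open>Measurable uniformization\<close>

text \<open>A countable intersection of measurable supersets attains the infimum of their measures.
  A smaller superset \<open>H'\<close> would push \<open>K \<inter> H'\<close> below the infimum
  unless \<open>K - H'\<close> were null.\<close>

lemma measurable_hull_exists:
  assumes "finite_measure M" and P: "P \<subseteq> space M"
  shows "\<exists>H\<in>sets M. P \<subseteq> H \<and> (\<forall>H'\<in>sets M. P \<subseteq> H' \<longrightarrow> H - H' \<in> null_sets M)"
proof -
  interpret finite_measure M by fact
  define I where "I = measure M ` {H \<in> sets M. P \<subseteq> H}"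
  have I: "I \<noteq> {}" "bdd_below I" unfolding I_def using P by (auto intro!: bdd_belowI[of _ 0])
  have "\<exists>H\<in>sets M. P \<subseteq> H \<and> measure M H < Inf I + 1 / real (Suc n)" for n
    using cInf_lessD[OF I(1), of "Inf I + 1 / real (Suc n)"] by (auto simp: I_def)
  then obtain H where H: "\<And>n. H n \<in> sets M" "\<And>n. P \<subseteq> H n" "\<And>n. measure M (H n) < Inf I + 1 / real (Suc n)"
    by metis
  define K where "K = (\<Inter>n. H n)"
  have K: "K \<in> sets M" "P \<subseteq> K" unfolding K_def using H by (auto intro!: sets.countable_INT')
  have le: "measure M K \<le> Inf I"
  proof (rule field_le_epsilon)
    fix e :: real assume "e > 0"
    then obtain n where "1 / real (Suc n) < e" using nat_approx_posE by blast
    moreover have "measure M K \<le> measure M (H n)" unfolding K_def using H by (intro finite_measure_mono) auto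
    ultimately show "measure M K \<le> Inf I + e" using H(3)[of n] by linarith
  qed
  have "K - H' \<in> null_sets M" if H': "H' \<in> sets M" "P \<subseteq> H'" for H'
  proof -
    have "measure M (K \<inter> H') \<in> I" unfolding I_def using K H' by auto
    then have "Inf I \<le> measure M (K \<inter> H')" by (rule cInf_lower[OF _ I(2)])
    moreover have "measure M (K - H') = measure M K - measure M (K \<inter> H')"
      using K H' by (intro finite_measure_Diff')
    ultimately have "measure M (K - H') = 0" using le measure_nonneg[of M "K - H'"] by linarith
    then show ?thesis using K H' by (simp add: null_sets_def emeasure_eq_measure)
  qed
  then show ?thesis using K by blast
qed

text \<open>Jankov--von Neumann uniformization modulo null sets. Write \<open>B\<close> as \<open>h ` D\<close>. Outside a null set, a point that lies
  in the measurable hull \<open>H u\<close> of the projection of the cylinder of \<open>u\<close> also lies in the hull for some one-step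
  extension of \<open>u\<close>; always taking the least one produces a branch \<open>s \<in> D\<close> with \<open>fst (h s) = x\<close>.\<close>

theorem borel_uniformization:
  assumes "prob_space M" and X: "polish_topology X" "sets M = sets (borel_of X)"
    and Y: "polish_topology Y" and B: "B \<in> sets (M \<Otimes>\<^sub>M borel_of Y)"
    and proj: "AE x in M. \<exists>y. (x, y) \<in> B"
  shows "\<exists>f\<in>measurable M (borel_of Y). AE x in M. (x, f x) \<in> B"
proof -
  interpret prob_space M by fact
  have spM: "space M = topspace X" using sets_eq_imp_space_eq[OF X(2)] by simp
  have "sets (M \<Otimes>\<^sub>M borel_of Y) = sets (borel_of (prod_topology X Y))"
    using sets_borel_of_prod_topology[OF polish_imp_second_countable[OF X(1)] polish_imp_second_countable[OF Y]]
      sets_pair_measure_cong[OF X(2) refl] by simp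
  then have "analytic_in (prod_topology X Y) B"
    using B by (intro analytic_in_borel polish_prod_topology X Y) simp
  then obtain D h where D: "closed_seqs D" and h: "continuous_seqs D (prod_topology X Y) h" and hB: "h ` D = B"
    by (auto simp: analytic_in_def)
  have h1: "continuous_seqs D X (fst \<circ> h)" and h2: "continuous_seqs D Y (snd \<circ> h)"
    using continuous_seqs_compose[OF h] continuous_map_fst continuous_map_snd by blast+
  define cyl where "cyl u = {s \<in> D. map s [0..<length u] = u}" for u :: "nat list"
  define P where "P u = (fst \<circ> h) ` cyl u" for u
  have PX: "P u \<subseteq> topspace X" for u using continuous_seqs_topspace[OF h1] by (auto simp: P_def cyl_def)
  \<comment> \<open>Cutting the hull down to the closure of \<open>P u\<close> is harmless, since
    the closure is a measurable superset. It ties the points of \<open>H u\<close> to the topology: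
    if the sets \<open>P u\<close> along a branch shrink into a neighbourhood of a point other than
    \<open>x\<close>, then \<open>x\<close> cannot stay in all the hulls.\<close>
  have "\<exists>H\<in>sets M. P u \<subseteq> H \<and> H \<subseteq> X closure_of P u \<and> (\<forall>H'\<in>sets M. P u \<subseteq> H' \<longrightarrow> H - H' \<in> null_sets M)" for u
  proof -
    obtain H where H: "H \<in> sets M" "P u \<subseteq> H" "\<forall>H'\<in>sets M. P u \<subseteq> H' \<longrightarrow> H - H' \<in> null_sets M"
      using measurable_hull_exists[of M "P u"] PX[of u] spM finite_measure_axioms by metis
    have C: "X closure_of P u \<in> sets M" unfolding X(2) by (intro borel_of_closed) simp
    have "(H \<inter> X closure_of P u) - H' \<in> null_sets M" if H': "H' \<in> sets M" "P u \<subseteq> H'" for H'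
    proof (rule null_sets_subset)
      show "H - H' \<in> null_sets M" using H(3) H' by blast
      show "(H \<inter> X closure_of P u) - H' \<in> sets M" using H(1) C H'(1) by (intro sets.Diff sets.Int)
    qed auto
    then show ?thesis
      using H C closure_of_subset[OF PX] by (intro bexI[of _ "H \<inter> X closure_of P u"]) auto
  qed
  then obtain H where H: "\<And>u. H u \<in> sets M" "\<And>u. P u \<subseteq> H u" "\<And>u. H u \<subseteq> X closure_of P u"
    "\<And>u H'. H' \<in> sets M \<Longrightarrow> P u \<subseteq> H' \<Longrightarrow> H u - H' \<in> null_sets M"
    by metis
  \<comment> \<open>Off \<open>N\<close> every hull is covered by the hulls of the one-step
    extensions, so a branch never gets stuck. \<open>N\<close> is null because the hulls of the
    extensions together contain \<open>P u\<close>, and there are only countably many finite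
    sequences.\<close>
  define N where "N = (\<Union>u. H u - (\<Union>i. H (u @ [i])))"
  have PUN: "P u \<subseteq> (\<Union>i. P (u @ [i]))" for u
  proof
    fix x assume "x \<in> P u"
    then obtain s where s: "s \<in> D" "map s [0..<length u] = u" "x = fst (h s)" by (auto simp: P_def cyl_def)
    then have "s \<in> cyl (u @ [s (length u)])" by (auto simp: cyl_def)
    then show "x \<in> (\<Union>i. P (u @ [i]))" using s(3) by (auto simp: P_def)
  qed
  have N: "N \<in> null_sets M"
    unfolding N_def
  proof (rule null_sets_UN)
    fix u
    have "P u \<subseteq> (\<Union>i. H (u @ [i]))" using PUN[of u] H(2) by blast
    then show "H u - (\<Union>i. H (u @ [i])) \<in> null_sets M"
      using H(1) by (intro H(4)) (auto intro!: sets.countable_UN')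
  qed
  define nxt where "nxt u x = (LEAST i. x \<in> H (u @ [i]))" for u x
  define br where "br x = rec_nat [] (\<lambda>_ u. u @ [nxt u x])" for x
  have br: "br x 0 = []" "br x (Suc n) = br x n @ [nxt (br x n) x]" for x n
    by (simp_all add: br_def)
  have [measurable]: "(\<lambda>x. x \<in> H u) \<in> measurable M (count_space UNIV)" for u
    using H(1)[of u] by measurable
  have nxt_meas: "nxt u \<in> measurable M (count_space UNIV)" for u
    unfolding nxt_def by measurable
  have br_meas: "(\<lambda>x. br x n) \<in> measurable M (count_space UNIV)" for n
  proof (induction n)
    case 0
    then show ?case by (simp add: br)
  next
    case (Suc n)
    have "(\<lambda>x. u @ [nxt u x]) \<in> measurable M (count_space UNIV)" for u
      by (rule measurable_compose[OF nxt_meas]) simp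
    then show ?case unfolding br by (rule measurable_compose_countable[OF _ Suc])
  qed
  have len: "length (br x n) = n" for x n by (induction n) (auto simp: br)
  define \<sigma> where "\<sigma> x n = nxt (br x n) x" for x n
  have br\<sigma>: "br x n = map (\<sigma> x) [0..<n]" for x n by (induction n) (auto simp: br \<sigma>_def)
  define good where "good = H [] - N"
  have good: "good \<in> sets M" unfolding good_def using H N by auto
  have "AE x in M. x \<in> P []" using proj
  proof eventually_elim
    case (elim x)
    then obtain y where "(x, y) \<in> h ` D" using hB by blast
    then obtain s where "s \<in> D" "h s = (x, y)" by (metis imageE)
    then show ?case unfolding P_def cyl_def by (intro image_eqI[of _ _ s]) auto
  qed
  then have AE_good: "AE x in M. x \<in> good"
    using AE_not_in[OF N] by eventually_elim (use H(2)[of "[]"] in \<open>auto simp: good_def\<close>)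
  have brH: "x \<in> H (br x n)" if x: "x \<in> good" for x n
  proof (induction n)
    case 0
    then show ?case using x by (simp add: br good_def)
  next
    case (Suc n)
    then have "\<exists>i. x \<in> H (br x n @ [i])" using x by (auto simp: good_def N_def)
    then show ?case unfolding br nxt_def by (rule LeastI_ex)
  qed
  have agree_cyl: "s \<in> cyl (br x n) \<longleftrightarrow> s \<in> D \<and> agree n (\<sigma> x) s" for s x n
    unfolding cyl_def br\<sigma> by (auto simp: agree_def list_eq_iff_nth_eq)
  have \<sigma>D: "\<sigma> x \<in> D" if x: "x \<in> good" for x
  proof (rule closed_seqsD[OF D])
    fix n
    have "P (br x n) \<noteq> {}" using brH[OF x, of n] H(3)[of "br x n"] by auto
    then show "\<exists>t\<in>D. agree n (\<sigma> x) t" unfolding P_def using agree_cyl by blast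
  qed
  have fst_h: "fst (h (\<sigma> x)) = x" if x: "x \<in> good" for x
  proof (rule ccontr)
    assume ne: "fst (h (\<sigma> x)) \<noteq> x"
    have xX: "x \<in> topspace X" using x good sets.sets_into_space spM by auto
    have "fst (h (\<sigma> x)) \<in> topspace X" using continuous_seqs_topspace[OF h1 \<sigma>D[OF x]] by simp
    from Hausdorff_space_disjoint_open[OF polish_imp_Hausdorff[OF X(1)] this xX ne]
    obtain U V where UV: "openin X U" "openin X V" "fst (h (\<sigma> x)) \<in> U" "x \<in> V" "disjnt U V"
      by (elim exE conjE) (rule that)
    obtain n where n: "\<forall>t\<in>D. agree n (\<sigma> x) t \<longrightarrow> (fst \<circ> h) t \<in> U"
      using continuous_seqsD[OF h1 \<sigma>D[OF x] UV(1)] UV(3) by auto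
    have "P (br x n) \<subseteq> U" unfolding P_def using n agree_cyl by auto
    moreover have "x \<in> X closure_of P (br x n)" using brH[OF x] H(3) by blast
    then obtain z where "z \<in> P (br x n)" "z \<in> V" using UV unfolding in_closure_of by blast
    ultimately show False using UV(5) by (auto simp: disjnt_def)
  qed
  \<comment> \<open>A default value off \<open>good\<close> needs \<open>Y\<close> to be nonempty;
    the set \<open>good\<close> has full measure and is thus nonempty, and any branch through it
    yields a point of \<open>Y\<close>.\<close>
  obtain y0 where y0: "y0 \<in> topspace Y"
  proof -
    have "\<exists>x. x \<in> good" using AE_good AE_E_prob[of "\<lambda>x. x \<in> good"] prob_space by fastforce
    then show ?thesis using continuous_seqs_topspace[OF h2 \<sigma>D] that by blast
  qed
  define f where "f x = (if x \<in> good then snd (h (\<sigma> x)) else y0)" for x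
  have "f \<in> measurable M (borel_of Y)"
  proof (rule measurable_borel_ofI)
    show "f x \<in> topspace Y" for x
      using continuous_seqs_topspace[OF h2 \<sigma>D] y0 by (auto simp: f_def)
    fix U assume U: "openin Y U"
    \<comment> \<open>By continuity, \<open>snd (h (\<sigma> x))\<close> lies in \<open>U\<close>
      exactly when some finite part of the branch already forces it. This turns the preimage into a
      countable union of measurable conditions on \<open>br\<close>.\<close>
    define W where "W = {u. \<forall>t\<in>cyl u. snd (h t) \<in> U}"
    have eq: "{x \<in> good. snd (h (\<sigma> x)) \<in> U} = good \<inter> (\<Union>u\<in>W. {x \<in> space M. br x (length u) = u})"
    proof
      show "{x \<in> good. snd (h (\<sigma> x)) \<in> U} \<subseteq> good \<inter> (\<Union>u\<in>W. {x \<in> space M. br x (length u) = u})"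
      proof
        fix x assume x: "x \<in> {x \<in> good. snd (h (\<sigma> x)) \<in> U}"
        then obtain n where "\<forall>t\<in>D. agree n (\<sigma> x) t \<longrightarrow> (snd \<circ> h) t \<in> U"
          using continuous_seqsD[OF h2 \<sigma>D U] by fastforce
        then have "br x n \<in> W" using agree_cyl by (auto simp: W_def)
        then show "x \<in> good \<inter> (\<Union>u\<in>W. {x \<in> space M. br x (length u) = u})"
          using x good sets.sets_into_space by (auto simp: len intro!: bexI[of _ "br x n"])
      qed
      show "good \<inter> (\<Union>u\<in>W. {x \<in> space M. br x (length u) = u}) \<subseteq> {x \<in> good. snd (h (\<sigma> x)) \<in> U}"
      proof clarify
        fix x u assume x: "x \<in> good" "u \<in> W" "br x (length u) = u"
        then have "\<sigma> x \<in> cyl u" using agree_cyl[of "\<sigma> x" x "length u"] \<sigma>D by (auto simp: agree_def)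
        then show "snd (h (\<sigma> x)) \<in> U" using x by (auto simp: W_def)
      qed
    qed
    have "{x \<in> space M. br x (length u) = u} \<in> sets M" for u
      using measurable_sets[OF br_meas, of "{u}" "length u"] by (auto simp: vimage_def Int_def conj_commute)
    then have m1: "{x \<in> good. snd (h (\<sigma> x)) \<in> U} \<in> sets M"
      unfolding eq by (intro sets.Int good sets.countable_UN') auto
    have "{x \<in> space M. f x \<in> U} = {x \<in> good. snd (h (\<sigma> x)) \<in> U} \<union> (if y0 \<in> U then space M - good else {})"
      using sets.sets_into_space[OF good] by (auto simp: f_def)
    then show "{x \<in> space M. f x \<in> U} \<in> sets M" using m1 good by auto
  qed
  moreover have "AE x in M. (x, f x) \<in> B"
    using AE_good
  proof eventually_elim
    case (elim x)
    have "h (\<sigma> x) \<in> B" using \<sigma>D[OF elim] hB by blast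
    moreover have "h (\<sigma> x) = (x, f x)" using fst_h[OF elim] elim by (simp add: f_def prod_eq_iff)
    ultimately show ?case by simp
  qed
  ultimately show ?thesis by blast
qed

subsection \<open>Meager sets and the Baire property\<close>

definition meager_in :: "'a topology \<Rightarrow> 'a set \<Rightarrow> bool" where
  "meager_in T S \<longleftrightarrow> (\<exists>F :: nat \<Rightarrow> 'a set. (\<forall>n. closedin T (F n) \<and> T interior_of F n = {}) \<and> S \<subseteq> (\<Union>n. F n))"

lemma meager_in_subset: "meager_in T S \<Longrightarrow> S' \<subseteq> S \<Longrightarrow> meager_in T S'"
  unfolding meager_in_def by (meson order_trans)

lemma meager_in_closed: "closedin T C \<Longrightarrow> T interior_of C = {} \<Longrightarrow> meager_in T C"
  unfolding meager_in_def by (intro exI[of _ "\<lambda>_. C"]) auto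

lemma meager_in_empty [simp]: "meager_in T {}"
  by (intro meager_in_closed) auto

lemma meager_in_UN:
  assumes "\<And>i::nat. meager_in T (S i)"
  shows "meager_in T (\<Union>i. S i)"
proof -
  obtain F where F: "\<And>i n. closedin T (F i n) \<and> T interior_of F i n = {}" "\<And>i. S i \<subseteq> (\<Union>n::nat. F i n)"
    using assms unfolding meager_in_def by metis
  have "(\<Union>i. S i) \<subseteq> (\<Union>n. F (fst (prod_decode n)) (snd (prod_decode n)))"
  proof
    fix x assume "x \<in> (\<Union>i. S i)"
    then obtain i n where "x \<in> F i n" using F(2) by blast
    then show "x \<in> (\<Union>n. F (fst (prod_decode n)) (snd (prod_decode n)))"
      by (intro UN_I[of "prod_encode (i, n)"]) auto
  qed
  then show ?thesis
    unfolding meager_in_def using F(1) by (intro exI[of _ "\<lambda>n. F (fst (prod_decode n)) (snd (prod_decode n))"]) blast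
qed

lemma meager_in_Un:
  assumes "meager_in T A" "meager_in T B"
  shows "meager_in T (A \<union> B)"
proof -
  have "meager_in T (\<Union>i::nat. if i = 0 then A else B)"
    using assms by (intro meager_in_UN) auto
  moreover have "A \<union> B \<subseteq> (\<Union>i::nat. if i = 0 then A else B)"
  proof -
    have "A \<subseteq> (if (0::nat) = 0 then A else B)" "B \<subseteq> (if (1::nat) = 0 then A else B)" by auto
    then show ?thesis by blast
  qed
  ultimately show ?thesis by (rule meager_in_subset)
qed

lemma not_meager_in_open:
  assumes "completely_metrizable_space T" "openin T U" "U \<noteq> {}"
  shows "\<not> meager_in T U"
proof
  assume "meager_in T U"
  then obtain F :: "nat \<Rightarrow> 'a set" where F: "\<forall>n. closedin T (F n) \<and> T interior_of F n = {}" "U \<subseteq> (\<Union>n. F n)"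
    unfolding meager_in_def by blast
  have "T interior_of \<Union>(range F) = {}"
    using assms(1) F(1) by (intro Baire_category_alt) auto
  moreover have "U \<subseteq> T interior_of \<Union>(range F)"
    using F(2) assms(2) by (intro interior_of_maximal) auto
  ultimately show False using assms(3) by auto
qed

lemma meager_in_homeomorphic_image:
  assumes f: "homeomorphic_map T T' f" and S: "meager_in T S"
  shows "meager_in T' (f ` S)"
proof -
  obtain F :: "nat \<Rightarrow> 'a set" where F: "\<And>n. closedin T (F n) \<and> T interior_of F n = {}" "S \<subseteq> (\<Union>n. F n)"
    using S unfolding meager_in_def by metis
  have "closedin T' (f ` F n) \<and> T' interior_of (f ` F n) = {}" for n
    using F(1)[of n] closedin_subset[of T "F n"] homeomorphic_map_closedness[OF f, of "F n"]
      homeomorphic_map_interior_of[OF f, of "F n"] by auto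
  then show ?thesis
    unfolding meager_in_def using image_mono[OF F(2), of f] by (intro exI[of _ "\<lambda>n. f ` F n"]) (simp add: image_UN)
qed

definition baire_property :: "'a topology \<Rightarrow> 'a set \<Rightarrow> bool" where
  "baire_property T S \<longleftrightarrow> (\<exists>U. openin T U \<and> meager_in T (S - U) \<and> meager_in T (U - S))"

lemma baire_property_borel:
  assumes "S \<in> sets (borel_of T)"
  shows "baire_property T S"
proof -
  have "S \<in> sigma_sets (topspace T) {U. openin T U}" using assms by (simp add: sets_borel_of)
  then show ?thesis
  proof induction
    case (Basic U)
    then show ?case unfolding baire_property_def by (intro exI[of _ U]) auto
  next
    case Empty
    then show ?case unfolding baire_property_def by (intro exI[of _ "{}"]) auto
  next
    case (Compl S)
    then obtain U where U: "openin T U" "meager_in T (S - U)" "meager_in T (U - S)"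
      by (auto simp: baire_property_def)
    \<comment> \<open>For the complement, \<open>U\<close> is replaced by the complement of its
      closure. The difference is the boundary of \<open>U\<close>, which is closed with empty
      interior and therefore meager.\<close>
    have "T interior_of (T closure_of U - U) \<inter> U = {}"
      using interior_of_subset by fastforce
    then have "T interior_of (T closure_of U - U) \<inter> T closure_of U = {}"
      by (simp add: openin_Int_closure_of_eq_empty)
    then have "T interior_of (T closure_of U - U) = {}"
      using interior_of_subset[of T "T closure_of U - U"] by blast
    then have "meager_in T (T closure_of U - U)"
      using U(1) by (intro meager_in_closed closedin_diff) auto
    then have "meager_in T ((T closure_of U - U) \<union> (U - S))" using U by (intro meager_in_Un)
    then have "meager_in T ((topspace T - S) - (topspace T - T closure_of U))"
      by (rule meager_in_subset) auto
    moreover have "meager_in T ((topspace T - T closure_of U) - (topspace T - S))"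
      using U(2) by (rule meager_in_subset) (use closure_of_subset[of U T] openin_subset[OF U(1)] in auto)
    ultimately show ?case
      unfolding baire_property_def by (intro exI[of _ "topspace T - T closure_of U"]) auto
  next
    case (Union S)
    then obtain U where U: "\<And>i. openin T (U i)" "\<And>i. meager_in T (S i - U i)" "\<And>i. meager_in T (U i - S i)"
      unfolding baire_property_def by metis
    have "meager_in T ((\<Union>i. S i) - (\<Union>i. U i))"
      using meager_in_UN[OF U(2)] by (rule meager_in_subset) auto
    moreover have "meager_in T ((\<Union>i. U i) - (\<Union>i. S i))"
      using meager_in_UN[OF U(3)] by (rule meager_in_subset) auto
    ultimately show ?case
      unfolding baire_property_def using U(1) by (intro exI[of _ "\<Union>i. U i"]) auto
  qed
qed

text \<open>Modulo meager sets \<open>S\<close> may be replaced by the open set \<open>U\<close>,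
  and a nonempty open set is nonmeager by the Baire category theorem.\<close>

lemma nonmeager_Int_open_iff:
  assumes T: "completely_metrizable_space T" and "openin T U" "meager_in T (S - U)" "meager_in T (U - S)"
    and V: "openin T V"
  shows "\<not> meager_in T (S \<inter> V) \<longleftrightarrow> U \<inter> V \<noteq> {}"
proof
  assume *: "\<not> meager_in T (S \<inter> V)"
  show "U \<inter> V \<noteq> {}"
  proof
    assume "U \<inter> V = {}"
    then have "S \<inter> V \<subseteq> S - U" by auto
    then show False using * assms(3) meager_in_subset by blast
  qed
next
  assume *: "U \<inter> V \<noteq> {}"
  show "\<not> meager_in T (S \<inter> V)"
  proof
    assume "meager_in T (S \<inter> V)"
    then have "meager_in T ((S \<inter> V) \<union> (U - S))" using assms(4) by (rule meager_in_Un)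
    then have "meager_in T (U \<inter> V)" by (rule meager_in_subset) auto
    then show False using not_meager_in_open[OF T openin_Int[OF assms(2) V] *] by blast
  qed
qed

text \<open>Localization: a nonmeager set with the Baire property is comeager in some basic open
  set. Being nonmeager thereby becomes a countable disjunction of smallness conditions on the
  complement, as the measurability induction over sections requires.\<close>

lemma nonmeager_Int_iff_base:
  assumes T: "completely_metrizable_space T" and S: "baire_property T S" and V: "openin T V"
    and B: "\<And>n. openin T (B n)" "\<And>U x. openin T U \<Longrightarrow> x \<in> U \<Longrightarrow> \<exists>n::nat. x \<in> B n \<and> B n \<subseteq> U"
  shows "\<not> meager_in T (S \<inter> V) \<longleftrightarrow> (\<exists>n. B n \<subseteq> V \<and> B n \<noteq> {} \<and> meager_in T (B n - S))"
proof
  assume *: "\<not> meager_in T (S \<inter> V)"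
  obtain U where U: "openin T U" "meager_in T (S - U)" "meager_in T (U - S)"
    using S by (auto simp: baire_property_def)
  then obtain x where "x \<in> U \<inter> V" using nonmeager_Int_open_iff[OF T U V] * by blast
  then obtain n where n: "x \<in> B n" "B n \<subseteq> U \<inter> V" using B(2)[OF openin_Int[OF U(1) V]] by blast
  then have "meager_in T (B n - S)" using U(3) by (elim meager_in_subset) auto
  then show "\<exists>n. B n \<subseteq> V \<and> B n \<noteq> {} \<and> meager_in T (B n - S)" using n by blast
next
  assume "\<exists>n. B n \<subseteq> V \<and> B n \<noteq> {} \<and> meager_in T (B n - S)"
  then obtain n where n: "B n \<subseteq> V" "B n \<noteq> {}" "meager_in T (B n - S)" by blast
  show "\<not> meager_in T (S \<inter> V)"
  proof
    assume "meager_in T (S \<inter> V)"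
    then have "meager_in T ((S \<inter> V) \<union> (B n - S))" using n(3) by (rule meager_in_Un)
    then have "meager_in T (B n)" by (rule meager_in_subset) (use n in auto)
    then show False using not_meager_in_open[OF T B(1) n(2)] by blast
  qed
qed

text \<open>The Montgomery-Novikov theorem, by induction on \<open>W\<close>. The claim is carried
  for all open \<open>V\<close> at once, because the complement step passes from \<open>V\<close> to
  the basic open sets contained in it.\<close>

lemma nonmeager_sections_measurable:
  assumes T: "polish_topology T" and W: "W \<in> sets (borel_of T \<Otimes>\<^sub>M M)" and V: "openin T V"
  shows "{x \<in> space M. \<not> meager_in T ({g. (g, x) \<in> W} \<inter> V)} \<in> sets M"
proof -
  have cm: "completely_metrizable_space T" using T by (simp add: polish_topology_def)
  obtain B :: "nat \<Rightarrow> 'a set" where "(\<forall>n. openin T (B n)) \<and>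
      (\<forall>U x. openin T U \<longrightarrow> x \<in> U \<longrightarrow> (\<exists>n. x \<in> B n \<and> B n \<subseteq> U))"
    using second_countable_sequence[OF polish_imp_second_countable[OF T]] by (rule exE)
  then have B: "\<And>n. openin T (B n)" "\<And>U x. openin T U \<Longrightarrow> x \<in> U \<Longrightarrow> \<exists>n. x \<in> B n \<and> B n \<subseteq> U"
    by blast+
  have "W \<in> sigma_sets (topspace T \<times> space M) {a \<times> b |a b. a \<in> sets (borel_of T) \<and> b \<in> sets M}"
    using W by (simp add: sets_pair_measure)
  then have "\<forall>V. openin T V \<longrightarrow> {x \<in> space M. \<not> meager_in T ({g. (g, x) \<in> W} \<inter> V)} \<in> sets M"
  proof induction
    case (Basic W)
    then obtain a b where ab: "W = a \<times> b" "a \<in> sets (borel_of T)" "b \<in> sets M" by auto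
    have "{x \<in> space M. \<not> meager_in T ({g. (g, x) \<in> W} \<inter> V)} = (if meager_in T (a \<inter> V) then {} else b)" for V
    proof -
      have "{g. (g, x) \<in> W} = (if x \<in> b then a else {})" for x using ab(1) by auto
      then show ?thesis using sets.sets_into_space[OF ab(3)] by (auto split: if_splits)
    qed
    then show ?case using ab(3) by auto
  next
    case Empty
    then show ?case by simp
  next
    case (Compl W)
    then have W: "W \<in> sets (borel_of T \<Otimes>\<^sub>M M)" by (simp add: sets_pair_measure)
    show ?case
    proof (intro allI impI)
      fix V assume V: "openin T V"
      have "\<not> meager_in T ({g. (g, x) \<in> topspace T \<times> space M - W} \<inter> V) \<longleftrightarrow>
          (\<exists>n. B n \<subseteq> V \<and> B n \<noteq> {} \<and> \<not> \<not> meager_in T ({g. (g, x) \<in> W} \<inter> B n))" if x: "x \<in> space M" for x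
      proof -
        have "{g. (g, x) \<in> topspace T \<times> space M - W} = topspace T - {g. (g, x) \<in> W}" using x by auto
        moreover have "{g. (g, x) \<in> W} \<in> sets (borel_of T)"
          using sets_Pair2[OF W, of x] by (simp add: vimage_def)
        then have "topspace T - {g. (g, x) \<in> W} \<in> sets (borel_of T)"
          using sets.compl_sets by fastforce
        moreover have "B n - (topspace T - {g. (g, x) \<in> W}) = {g. (g, x) \<in> W} \<inter> B n" for n
          using openin_subset[OF B(1)[of n]] by auto
        ultimately show ?thesis
          using nonmeager_Int_iff_base[OF cm baire_property_borel V B, of "topspace T - {g. (g, x) \<in> W}"] by simp
      qed
      then have "{x \<in> space M. \<not> meager_in T ({g. (g, x) \<in> topspace T \<times> space M - W} \<inter> V)} =
          (\<Union>n\<in>{n. B n \<subseteq> V \<and> B n \<noteq> {}}. space M - {x \<in> space M. \<not> meager_in T ({g. (g, x) \<in> W} \<inter> B n)})"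
        by blast
      also have "\<dots> \<in> sets M"
        using Compl.IH B(1) by (intro sets.countable_UN'' sets.compl_sets) auto
      finally show "{x \<in> space M. \<not> meager_in T ({g. (g, x) \<in> topspace T \<times> space M - W} \<inter> V)} \<in> sets M" .
    qed
  next
    case (Union W)
    show ?case
    proof (intro allI impI)
      fix V assume V: "openin T V"
      have "\<not> meager_in T ({g. (g, x) \<in> (\<Union>i. W i)} \<inter> V) \<longleftrightarrow> (\<exists>i. \<not> meager_in T ({g. (g, x) \<in> W i} \<inter> V))" for x
      proof -
        have "{g. (g, x) \<in> (\<Union>i. W i)} \<inter> V = (\<Union>i. {g. (g, x) \<in> W i} \<inter> V)" by auto
        moreover have "{g. (g, x) \<in> W i} \<inter> V \<subseteq> (\<Union>i. {g. (g, x) \<in> W i} \<inter> V)" for i by blast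
        ultimately show ?thesis
          using meager_in_UN[of T "\<lambda>i. {g. (g, x) \<in> W i} \<inter> V"]
            meager_in_subset[of T "\<Union>i. {g. (g, x) \<in> W i} \<inter> V"] by (metis (no_types, lifting))
      qed
      then have "{x \<in> space M. \<not> meager_in T ({g. (g, x) \<in> (\<Union>i. W i)} \<inter> V)} =
          (\<Union>i. {x \<in> space M. \<not> meager_in T ({g. (g, x) \<in> W i} \<inter> V)})"
        by blast
      also have "\<dots> \<in> sets M" using Union.IH V by (intro sets.countable_UN'') auto
      finally show "{x \<in> space M. \<not> meager_in T ({g. (g, x) \<in> (\<Union>i. W i)} \<inter> V)} \<in> sets M" .
    qed
  qed
  then show ?thesis using V by blast
qed

subsection \<open>Borel actions of Polish groups\<close>

locale polish_borel_action =
  fixes G :: "('g, 'm) monoid_scheme" (structure) and TG :: "'g topology"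
    and M :: "'x measure" and \<phi> :: "'g \<Rightarrow> 'x \<Rightarrow> 'x"
  assumes polish: "polish_group G TG" and standard: "standard_borel M" and action: "borel_action G TG M \<phi>"
begin

sublocale group_action G "space M" \<phi>
  using action by (simp add: borel_action_def)

sublocale group G
  using polish by (simp add: polish_group_def topological_group_def)

lemma TG: "polish_topology TG" "topspace TG = carrier G"
  "continuous_map (prod_topology TG TG) TG (\<lambda>(x, y). x \<otimes> y)" "continuous_map TG TG (\<lambda>x. inv x)"
  using polish by (auto simp: polish_group_def topological_group_def)

lemma TG_cm: "completely_metrizable_space TG"
  using TG(1) by (simp add: polish_topology_def)

lemma action_measurable: "(\<lambda>(g, x). \<phi> g x) \<in> measurable (borel_of TG \<Otimes>\<^sub>M M) M"
  using action by (simp add: borel_action_def)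

lemma act_closed: "g \<in> carrier G \<Longrightarrow> x \<in> space M \<Longrightarrow> \<phi> g x \<in> space M"
  using element_image by blast

lemma act_one: "x \<in> space M \<Longrightarrow> \<phi> \<one> x = x"
  using id_eq_one by (metis restrict_apply')

lemma act_inj: "g \<in> carrier G \<Longrightarrow> x \<in> space M \<Longrightarrow> y \<in> space M \<Longrightarrow> \<phi> g x = \<phi> g y \<Longrightarrow> x = y"
  using inj_prop by (meson inj_on_eq_iff)

lemma homeomorphic_right_translation:
  assumes g: "g \<in> carrier G"
  shows "homeomorphic_map TG TG (\<lambda>h. h \<otimes> g)"
proof -
  have c: "continuous_map TG TG (\<lambda>h. h \<otimes> k)" if "k \<in> carrier G" for k
  proof -
    have "continuous_map TG (prod_topology TG TG) (\<lambda>h. (h, k))"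
      using that TG(2) by (simp add: continuous_map_pairedI)
    from continuous_map_compose[OF this TG(3)] show ?thesis by (simp add: o_def)
  qed
  show ?thesis
    unfolding homeomorphic_map_maps homeomorphic_maps_def
    using c[OF g] c[OF inv_closed[OF g]] g TG(2) by (intro exI[of _ "\<lambda>h. h \<otimes> inv g"]) (auto simp: m_assoc)
qed

text \<open>The trace of \<open>A\<close> on the orbit of \<open>x\<close>, pulled back to
  \<open>G\<close>. Openness of this set in \<open>TG\<close> is what "open along the orbit of
  \<open>x\<close>" means throughout.\<close>

definition hits :: "'x set \<Rightarrow> 'x \<Rightarrow> 'g set" where
  "hits A x = {g \<in> carrier G. \<phi> g x \<in> A}"

text \<open>The Vaught transform \<open>A\<^sup>\<Delta>\<^sup>U\<close>.\<close>

definition vaught :: "'x set \<Rightarrow> 'g set \<Rightarrow> 'x set" where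
  "vaught A U = {x \<in> space M. \<not> meager_in TG (hits A x \<inter> U)}"

lemma hits_pair_measurable:
  assumes "A \<in> sets M"
  shows "{p \<in> space (borel_of TG \<Otimes>\<^sub>M M). \<phi> (fst p) (snd p) \<in> A} \<in> sets (borel_of TG \<Otimes>\<^sub>M M)"
  using measurable_sets[OF action_measurable assms] by (simp add: vimage_def Int_def case_prod_unfold conj_commute)

lemma hits_measurable:
  assumes "A \<in> sets M" "x \<in> space M"
  shows "hits A x \<in> sets (borel_of TG)"
  using sets_Pair2[OF hits_pair_measurable[OF assms(1)], of x] assms(2)
  by (simp add: hits_def vimage_def space_pair_measure TG(2))

lemma vaught_measurable:
  assumes A: "A \<in> sets M" and U: "openin TG U"
  shows "vaught A U \<in> sets M"
proof -
  have "vaught A U = {x \<in> space M. \<not> meager_in TG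
      ({g. (g, x) \<in> {p \<in> space (borel_of TG \<Otimes>\<^sub>M M). \<phi> (fst p) (snd p) \<in> A}} \<inter> U)}"
    by (auto simp: vaught_def hits_def space_pair_measure TG(2))
  also have "\<dots> \<in> sets M" by (rule nonmeager_sections_measurable[OF TG(1) hits_pair_measurable[OF A] U])
  finally show ?thesis .
qed

text \<open>The set \<open>hits A x\<close> equals an open \<open>V\<close> modulo a meager set.
  Right translation by \<open>g\<close> is a homeomorphism taking
  \<open>hits A (\<phi> g x) \<inter> U\<close> to \<open>hits A x \<inter> Ug\<close>, so
  \<open>\<phi> g x\<close> belongs to the transform exactly when \<open>V\<close> meets
  \<open>Ug\<close>. The set of such \<open>g\<close> is a union of preimages of \<open>V\<close>
  under left translations by elements of \<open>U\<close>.\<close>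

lemma vaught_orbit_open:
  assumes A: "A \<in> sets M" and U: "openin TG U" and x: "x \<in> space M"
  shows "openin TG (hits (vaught A U) x)"
proof -
  obtain V where V: "openin TG V" "meager_in TG (hits A x - V)" "meager_in TG (V - hits A x)"
    using baire_property_borel[OF hits_measurable[OF A x]] by (auto simp: baire_property_def)
  have UG: "U \<subseteq> carrier G" using openin_subset[OF U] TG(2) by simp
  have iff: "\<phi> g x \<in> vaught A U \<longleftrightarrow> (\<exists>u\<in>U. u \<otimes> g \<in> V)" if g: "g \<in> carrier G" for g
  proof -
    define r where "r = (\<lambda>h. h \<otimes> g)"
    have hom: "homeomorphic_map TG TG r" unfolding r_def by (rule homeomorphic_right_translation[OF g])
    have inj: "inj_on r (topspace TG)" using hom by (rule homeomorphic_imp_injective_map)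
    have img: "r ` (hits A (\<phi> g x) \<inter> U) = hits A x \<inter> r ` U"
    proof
      show "r ` (hits A (\<phi> g x) \<inter> U) \<subseteq> hits A x \<inter> r ` U"
        using composition_rule[OF x _ g] g by (auto simp: hits_def r_def)
      show "hits A x \<inter> r ` U \<subseteq> r ` (hits A (\<phi> g x) \<inter> U)"
        using composition_rule[OF x _ g] UG by (auto simp: hits_def r_def)
    qed
    have rU: "openin TG (r ` U)" using hom U by (meson homeomorphic_imp_open_map open_map_def)
    have "meager_in TG (hits A (\<phi> g x) \<inter> U) \<longleftrightarrow> meager_in TG (hits A x \<inter> r ` U)"
    proof
      show "meager_in TG (hits A (\<phi> g x) \<inter> U) \<Longrightarrow> meager_in TG (hits A x \<inter> r ` U)"
        unfolding img[symmetric] by (rule meager_in_homeomorphic_image[OF hom])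
      define r' where "r' = (\<lambda>h. h \<otimes> inv g)"
      have r': "homeomorphic_map TG TG r'" unfolding r'_def by (rule homeomorphic_right_translation[OF inv_closed[OF g]])
      have r'r: "r' (r h) = h" if "h \<in> hits A (\<phi> g x) \<inter> U" for h
        using that g by (simp add: r_def r'_def m_assoc hits_def)
      assume "meager_in TG (hits A x \<inter> r ` U)"
      then have "meager_in TG (r' ` r ` (hits A (\<phi> g x) \<inter> U))"
        unfolding img[symmetric] by (rule meager_in_homeomorphic_image[OF r'])
      also have "r' ` r ` (hits A (\<phi> g x) \<inter> U) = hits A (\<phi> g x) \<inter> U"
        using r'r by (simp add: image_image)
      finally show "meager_in TG (hits A (\<phi> g x) \<inter> U)" .
    qed
    then have "\<phi> g x \<in> vaught A U \<longleftrightarrow> V \<inter> r ` U \<noteq> {}"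
      using nonmeager_Int_open_iff[OF TG_cm V rU] act_closed[OF g x] by (simp add: vaught_def)
    then show ?thesis by (auto simp: r_def)
  qed
  have "hits (vaught A U) x = (\<Union>u\<in>U. {g \<in> topspace TG. u \<otimes> g \<in> V})"
    using iff UG TG(2) by (auto simp: hits_def)
  moreover have "openin TG {g \<in> topspace TG. u \<otimes> g \<in> V}" if "u \<in> U" for u
  proof -
    have "continuous_map TG (prod_topology TG TG) (\<lambda>h. (u, h))"
      using that UG TG(2) by (auto intro!: continuous_map_pairedI)
    from continuous_map_compose[OF this TG(3)] have "continuous_map TG TG (\<lambda>h. u \<otimes> h)" by (simp add: o_def)
    then show ?thesis using V(1) by (rule openin_continuous_map_preimage)
  qed
  ultimately show ?thesis by auto
qed

text \<open>Every \<open>g\<close> moves distinct points \<open>x\<close>, \<open>y\<close> to distinct points, which are separated by one of countably many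
  Borel sets; by Baire category one set works for nonmeagerly many \<open>g\<close>.\<close>

theorem separating_orbit_open_family:
  obtains D :: "nat \<Rightarrow> 'x set" where "\<And>n. D n \<in> sets M" "\<And>n x. x \<in> space M \<Longrightarrow> openin TG (hits (D n) x)"
    "\<And>x y. x \<in> space M \<Longrightarrow> y \<in> space M \<Longrightarrow> x \<noteq> y \<Longrightarrow> \<exists>n. x \<in> D n \<and> y \<notin> D n"
proof -
  obtain TX where TX: "polish_topology TX" "topspace TX = space M" "sets M = sets (borel_of TX)"
    using standard by (auto simp: standard_borel_def)
  obtain A :: "nat \<Rightarrow> 'x set" where "(\<forall>n. openin TX (A n)) \<and>
      (\<forall>U x. openin TX U \<longrightarrow> x \<in> U \<longrightarrow> (\<exists>n. x \<in> A n \<and> A n \<subseteq> U))"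
    using second_countable_sequence[OF polish_imp_second_countable[OF TX(1)]] by (rule exE)
  then have A: "\<And>n. openin TX (A n)" "\<And>U x. openin TX U \<Longrightarrow> x \<in> U \<Longrightarrow> \<exists>n. x \<in> A n \<and> A n \<subseteq> U"
    by blast+
  obtain B :: "nat \<Rightarrow> 'g set" where "(\<forall>n. openin TG (B n)) \<and>
      (\<forall>U x. openin TG U \<longrightarrow> x \<in> U \<longrightarrow> (\<exists>n. x \<in> B n \<and> B n \<subseteq> U))"
    using second_countable_sequence[OF polish_imp_second_countable[OF TG(1)]] by (rule exE)
  then have B: "\<And>n. openin TG (B n)" "\<And>U x. openin TG U \<Longrightarrow> x \<in> U \<Longrightarrow> \<exists>n. x \<in> B n \<and> B n \<subseteq> U"
    by blast+
  have AM: "A n \<in> sets M" for n unfolding TX(3) by (rule borel_of_open[OF A(1)])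
  have sepA: "\<exists>n. p \<in> A n \<and> q \<notin> A n" if pq: "p \<in> space M" "q \<in> space M" "p \<noteq> q" for p q
  proof -
    obtain U V where "openin TX U" "openin TX V" "p \<in> U" "q \<in> V" "disjnt U V"
      using Hausdorff_space_disjoint_open[OF polish_imp_Hausdorff[OF TX(1)] pq[folded TX(2)]]
      by (elim exE conjE) (rule that)
    then show ?thesis using A(2) by (fastforce simp: disjnt_def)
  qed
  define D where "D k = vaught (A (fst (prod_decode k))) (B (snd (prod_decode k)))" for k
  have sep: "\<exists>k. x \<in> D k \<and> y \<notin> D k" if xy: "x \<in> space M" "y \<in> space M" "x \<noteq> y" for x y
  proof -
    \<comment> \<open>The group elements for which \<open>A n\<close> separates the translates of
      \<open>x\<close> and \<open>y\<close> in this order. These countably many sets cover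
      \<open>G\<close>, so one of them is nonmeager and hence comeager in some basic open
      \<open>B m\<close>.\<close>
    define S where "S n = hits (A n) x - hits (A n) y" for n
    have "carrier G \<subseteq> (\<Union>n. S n)"
    proof
      fix g assume g: "g \<in> carrier G"
      then have "\<phi> g x \<noteq> \<phi> g y" using act_inj xy by blast
      then obtain n where "\<phi> g x \<in> A n" "\<phi> g y \<notin> A n" using sepA[of "\<phi> g x" "\<phi> g y"] act_closed g xy by blast
      then show "g \<in> (\<Union>n. S n)" using g by (auto simp: S_def hits_def)
    qed
    moreover have "\<not> meager_in TG (carrier G)"
      using not_meager_in_open[OF TG_cm openin_topspace] TG(2) one_closed by auto
    ultimately have "\<not> meager_in TG (\<Union>n. S n)" using meager_in_subset by blast
    then obtain n where n: "\<not> meager_in TG (S n)" using meager_in_UN by blast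
    have "S n \<subseteq> topspace TG" by (auto simp: S_def hits_def TG(2))
    then have n': "\<not> meager_in TG (S n \<inter> topspace TG)" using n by (simp add: Int_absorb2)
    have "S n \<in> sets (borel_of TG)" unfolding S_def using hits_measurable AM xy by blast
    then obtain m where m: "B m \<noteq> {}" "meager_in TG (B m - S n)"
      using nonmeager_Int_iff_base[OF TG_cm baire_property_borel openin_topspace B, of "S n"] n' by blast
    \<comment> \<open>On \<open>B m\<close>, up to a meager set, \<open>g\<close> sends
      \<open>x\<close> into \<open>A n\<close> and \<open>y\<close> outside it. So the transform of
      \<open>A n\<close> over \<open>B m\<close> contains \<open>x\<close> but not
      \<open>y\<close>.\<close>
    have "\<not> meager_in TG (hits (A n) x \<inter> B m)"
    proof
      assume "meager_in TG (hits (A n) x \<inter> B m)"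
      then have "meager_in TG ((hits (A n) x \<inter> B m) \<union> (B m - S n))" using m(2) by (rule meager_in_Un)
      then have "meager_in TG (B m)" by (rule meager_in_subset) (auto simp: S_def)
      then show False using not_meager_in_open[OF TG_cm B(1) m(1)] by blast
    qed
    moreover have "meager_in TG (hits (A n) y \<inter> B m)"
      using m(2) by (rule meager_in_subset) (auto simp: S_def)
    ultimately show ?thesis
      using xy by (intro exI[of _ "prod_encode (n, m)"]) (auto simp: D_def vaught_def)
  qed
  show ?thesis
  proof (rule that[of D])
    show "D n \<in> sets M" for n unfolding D_def by (rule vaught_measurable[OF AM B(1)])
    show "openin TG (hits (D n) x)" if "x \<in> space M" for n x
      unfolding D_def by (rule vaught_orbit_open[OF AM B(1) that])
  qed (use sep in blast)
qed

end

subsection \<open>Convergence in measure\<close>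

lemma LIMSEQ_subsequence_principle:
  fixes a :: "nat \<Rightarrow> 'a :: metric_space"
  assumes "\<And>r :: nat \<Rightarrow> nat. strict_mono r \<Longrightarrow> \<exists>s. strict_mono s \<and> (\<lambda>n. a (r (s n))) \<longlonglongrightarrow> l"
  shows "a \<longlonglongrightarrow> l"
proof (rule ccontr)
  assume "\<not> a \<longlonglongrightarrow> l"
  then obtain e where e: "e > 0" "\<not> eventually (\<lambda>n. dist (a n) l < e) sequentially"
    by (auto simp: tendsto_iff)
  then have "infinite {n. \<not> dist (a n) l < e}"
    unfolding eventually_sequentially infinite_nat_iff_unbounded_le by blast
  then obtain r :: "nat \<Rightarrow> nat" where r: "strict_mono r" "\<And>n. r n \<in> {n. \<not> dist (a n) l < e}"
    using infinite_enumerate by blast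
  obtain s where "(\<lambda>n. a (r (s n))) \<longlonglongrightarrow> l" using assms[OF r(1)] by blast
  then have "eventually (\<lambda>n. dist (a (r (s n))) l < e) sequentially"
    using e(1) by (auto simp: tendsto_iff)
  then show False using r(2) by (auto simp: eventually_sequentially)
qed

lemma limitin_subseq:
  assumes "limitin T (\<lambda>n. f n) l sequentially" "strict_mono (r :: nat \<Rightarrow> nat)"
  shows "limitin T (\<lambda>n. f (r n)) l sequentially"
  using limitin_subsequence[OF assms(2,1)] by (simp add: o_def)

lemma limitin_metric_eq:
  assumes "Metric_space (topspace T) d" "Metric_space.mtopology (topspace T) d = T"
    and "\<And>n. f n \<in> topspace T" "l \<in> topspace T"
  shows "limitin T f l sequentially \<longleftrightarrow> (\<lambda>n. d (f n) l) \<longlonglongrightarrow> 0"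
  using Metric_space.limitin_metric_dist_null[OF assms(1), of f l sequentially] assms(2-) by simp

lemma measurable_compatible_metric:
  assumes T: "polish_topology T" and d: "compatible_bounded_metric T d"
    and f: "f \<in> measurable M (borel_of T)" and g: "g \<in> measurable M (borel_of T)"
  shows "(\<lambda>x. d (f x) (g x)) \<in> borel_measurable M"
proof -
  have ms: "Metric_space (topspace T) d" "Metric_space.mtopology (topspace T) d = T"
    using d by (auto simp: compatible_bounded_metric_def)
  have "continuous_map (prod_topology T T) euclidean (\<lambda>(x, y). d x y)"
    using continuous_map_metric[of "metric (topspace T, d)"] Metric_space.mtopology_of[OF ms(1)]
      Metric_space.mdist_metric[OF ms(1)] ms(2) by simp
  then have "(\<lambda>(x, y). d x y) \<in> measurable (borel_of (prod_topology T T)) borel"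
    using continuous_map_borel_measurable borel_of_euclidean by metis
  then have "(\<lambda>(x, y). d x y) \<in> measurable (borel_of T \<Otimes>\<^sub>M borel_of T) borel"
    using measurable_cong_sets[OF sets_borel_of_prod_topology[of T T] refl] polish_imp_second_countable[OF T] by blast
  from measurable_compose[OF measurable_Pair[OF f g] this] show ?thesis by simp
qed

text \<open>By regularity, the limit lies in an open \<open>U\<close> exactly when some basic set
  with closure inside \<open>U\<close> eventually contains the sequence, which is a countable
  combination of measurable conditions.\<close>

lemma measurable_limit_borel_of:
  assumes T: "polish_topology T" and F: "\<And>n::nat. F n \<in> measurable M (borel_of T)"
    and lim: "\<And>x. x \<in> space M \<Longrightarrow> limitin T (\<lambda>n. F n x) (f x) sequentially"
  shows "f \<in> measurable M (borel_of T)"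
proof (rule measurable_borel_ofI)
  show "f x \<in> topspace T" if "x \<in> space M" for x using lim[OF that] by (rule limitin_topspace)
  fix U assume U: "openin T U"
  have reg: "regular_space T"
    using T by (simp add: polish_topology_def completely_metrizable_imp_metrizable_space metrizable_imp_regular_space)
  obtain B :: "nat \<Rightarrow> 'a set" where "(\<forall>n. openin T (B n)) \<and>
      (\<forall>U x. openin T U \<longrightarrow> x \<in> U \<longrightarrow> (\<exists>n. x \<in> B n \<and> B n \<subseteq> U))"
    using second_countable_sequence[OF polish_imp_second_countable[OF T]] by (rule exE)
  then have B: "\<And>n. openin T (B n)" "\<And>U x. openin T U \<Longrightarrow> x \<in> U \<Longrightarrow> \<exists>n. x \<in> B n \<and> B n \<subseteq> U"
    by blast+
  have "{x \<in> space M. f x \<in> U} =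
      (\<Union>i\<in>{i. T closure_of B i \<subseteq> U}. \<Union>N. \<Inter>n\<in>{N..}. {x \<in> space M. F n x \<in> B i})"
  proof (intro equalityI subsetI)
    fix x assume x: "x \<in> {x \<in> space M. f x \<in> U}"
    obtain V C where V: "openin T V" "closedin T C" "f x \<in> V" "V \<subseteq> C" "C \<subseteq> U"
      using reg U x unfolding neighbourhood_base_of_closedin[symmetric] neighbourhood_base_of
      by (elim allE[where x = U] allE[where x = "f x"]) blast
    obtain i where i: "f x \<in> B i" "B i \<subseteq> V" using B(2)[OF V(1,3)] by blast
    have "T closure_of B i \<subseteq> U" using closure_of_minimal[of "B i" C T] i V by blast
    moreover obtain N where "\<And>n. n \<ge> N \<Longrightarrow> F n x \<in> B i"
      using limitinD[OF lim B(1) i(1)] x unfolding eventually_sequentially by blast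
    ultimately show "x \<in> (\<Union>i\<in>{i. T closure_of B i \<subseteq> U}. \<Union>N. \<Inter>n\<in>{N..}. {x \<in> space M. F n x \<in> B i})"
      using x by auto
  next
    fix x assume "x \<in> (\<Union>i\<in>{i. T closure_of B i \<subseteq> U}. \<Union>N. \<Inter>n\<in>{N..}. {x \<in> space M. F n x \<in> B i})"
    then obtain i N where i: "T closure_of B i \<subseteq> U" "\<And>n. n \<ge> N \<Longrightarrow> x \<in> space M \<and> F n x \<in> B i" by auto
    then have "x \<in> space M" by blast
    have "f x \<in> T closure_of B i"
      using limitin_closedin[OF lim[OF \<open>x \<in> space M\<close>], of "T closure_of B i"] i(2)
        closure_of_subset[of "B i" T] openin_subset[OF B(1)]
      by (auto simp: eventually_sequentially)
    then show "x \<in> {x \<in> space M. f x \<in> U}" using i \<open>x \<in> space M\<close> by auto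
  qed
  also have "\<dots> \<in> sets M"
  proof (intro sets.countable_UN'' sets.countable_INT' countable_Collect countableI_type)
    fix i N
    have "{x \<in> space M. F n x \<in> B i} \<in> sets M" for n
      using measurable_sets[OF F borel_of_open[OF B(1)], of n i] by (simp add: vimage_def Int_def conj_commute)
    then show "(\<lambda>n. {x \<in> space M. F n x \<in> B i}) ` {N..} \<subseteq> sets M" by auto
  qed auto
  finally show "{x \<in> space M. f x \<in> U} \<in> sets M" .
qed

text \<open>A metric-free form of convergence in measure, equivalent to convergence of the integrals
  of any compatible bounded metric on a Polish target. Testing on sets makes it directly comparable
  with weak convergence of transformations.\<close>

definition conv_in_measure ::
    "'x measure \<Rightarrow> 'y topology \<Rightarrow> (nat \<Rightarrow> 'x \<Rightarrow> 'y) \<Rightarrow> ('x \<Rightarrow> 'y) \<Rightarrow> bool" where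
  "conv_in_measure M T F f \<longleftrightarrow>
     (\<forall>U. openin T U \<longrightarrow> (\<lambda>n. measure M {x \<in> space M. f x \<in> U \<and> F n x \<notin> U}) \<longlonglongrightarrow> 0)"

lemma conv_in_measure_subseq:
  "conv_in_measure M T F f \<Longrightarrow> strict_mono r \<Longrightarrow> conv_in_measure M T (\<lambda>n. F (r n)) f"
  unfolding conv_in_measure_def using LIMSEQ_subseq_LIMSEQ[of "\<lambda>n. measure M {x \<in> space M. f x \<in> U \<and> F n x \<notin> U}" 0 r for U]
  by (simp add: o_def)

context prob_space
begin

lemma measurable_exceptional_set:
  assumes "f \<in> measurable M (borel_of T)" "g \<in> measurable M (borel_of T)" "openin T U"
  shows "{x \<in> space M. f x \<in> U \<and> g x \<notin> U} \<in> sets M"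
proof -
  have "{x \<in> space M. f x \<in> U \<and> g x \<notin> U} = (f -` U \<inter> space M) - (g -` U \<inter> space M)" by auto
  then show ?thesis using measurable_sets[OF assms(1) borel_of_open] measurable_sets[OF assms(2) borel_of_open] assms(3) by auto
qed

text \<open>Stage \<open>k\<close> controls the first \<open>k + 1\<close> basic open sets with
  error below \<open>(1/2) ^ k\<close>. By Borel-Cantelli almost every point is eventually outside
  all exceptional sets, and every basic set is tested from some stage on.\<close>

lemma conv_in_measure_AE_subseq:
  assumes T: "polish_topology T" and F: "\<And>n. F n \<in> measurable M (borel_of T)" and f: "f \<in> measurable M (borel_of T)"
    and conv: "conv_in_measure M T F f"
  shows "\<exists>s. strict_mono s \<and> (AE x in M. limitin T (\<lambda>n. F (s n) x) (f x) sequentially)"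
proof -
  obtain B :: "nat \<Rightarrow> 'b set" where "(\<forall>n. openin T (B n)) \<and>
      (\<forall>U x. openin T U \<longrightarrow> x \<in> U \<longrightarrow> (\<exists>n. x \<in> B n \<and> B n \<subseteq> U))"
    using second_countable_sequence[OF polish_imp_second_countable[OF T]] by (rule exE)
  then have B: "\<And>n. openin T (B n)" "\<And>U x. openin T U \<Longrightarrow> x \<in> U \<Longrightarrow> \<exists>n. x \<in> B n \<and> B n \<subseteq> U"
    by blast+
  define E where "E k n = (\<Union>i\<in>{..k}. {x \<in> space M. f x \<in> B i \<and> F n x \<notin> B i})" for k n
  have E: "E k n \<in> sets M" for k n
    unfolding E_def using measurable_exceptional_set[OF f F B(1)] by (intro sets.finite_UN) auto
  have lim: "(\<lambda>n. measure M (E k n)) \<longlonglongrightarrow> 0" for k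
  proof (rule tendsto_sandwich[of "\<lambda>_. 0" _ _ "\<lambda>n. \<Sum>i\<le>k. measure M {x \<in> space M. f x \<in> B i \<and> F n x \<notin> B i}"])
    show "(\<lambda>n. \<Sum>i\<le>k. measure M {x \<in> space M. f x \<in> B i \<and> F n x \<notin> B i}) \<longlonglongrightarrow> 0"
      using conv B(1) unfolding conv_in_measure_def by (intro tendsto_null_sum) auto
    show "\<forall>\<^sub>F n in sequentially. measure M (E k n) \<le> (\<Sum>i\<le>k. measure M {x \<in> space M. f x \<in> B i \<and> F n x \<notin> B i})"
      unfolding E_def using measurable_exceptional_set[OF f F B(1)]
      by (intro always_eventually allI finite_measure_subadditive_finite) auto
  qed auto
  have "\<exists>n>m. measure M (E k n) < (1/2) ^ k" for k m
  proof -
    have "eventually (\<lambda>n. measure M (E k n) < (1/2) ^ k) sequentially"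
      using lim[of k] by (intro order_tendstoD(2)) auto
    then obtain N where "\<And>n. n \<ge> N \<Longrightarrow> measure M (E k n) < (1/2) ^ k" unfolding eventually_sequentially by blast
    then show ?thesis by (intro exI[of _ "max N (Suc m)"]) auto
  qed
  then have "\<exists>s. \<forall>k. measure M (E k (s k)) < (1/2) ^ k \<and> s k < s (Suc k)"
    using dependent_nat_choice[of "\<lambda>k n. measure M (E k n) < (1/2) ^ k" "\<lambda>k n n'. n < n'"] by blast
  then obtain s where s: "\<And>k. measure M (E k (s k)) < (1/2) ^ k" "\<And>k. s k < s (Suc k)" by blast
  have "summable (\<lambda>k. measure M (E k (s k)))"
    by (intro summable_comparison_test'[OF summable_geometric[of "1/2::real"], of 0])
      (use s(1) in \<open>simp_all add: less_imp_le\<close>)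
  then have "AE x in M. eventually (\<lambda>k. x \<in> space M - E k (s k)) sequentially"
    by (intro borel_cantelli_AE1 E) (auto simp: emeasure_eq_measure)
  then have "AE x in M. limitin T (\<lambda>n. F (s n) x) (f x) sequentially"
    using AE_space
  proof eventually_elim
    case (elim x)
    show ?case
      unfolding limitin_def
    proof (intro conjI allI impI)
      show "f x \<in> topspace T" using measurable_space[OF f] elim by simp
      fix U assume U: "openin T U \<and> f x \<in> U"
      then obtain i where i: "f x \<in> B i" "B i \<subseteq> U" using B(2) by blast
      show "\<forall>\<^sub>F n in sequentially. F (s n) x \<in> U"
        using elim(1) eventually_ge_at_top[of i]
      proof eventually_elim
        case (elim n)
        then show ?case using i unfolding E_def by auto
      qed
    qed
  qed
  then show ?thesis using s(2) strict_mono_Suc_iff by blast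
qed

lemma measure_tendsto_0_subseq:
  assumes E: "\<And>n. E n \<in> sets M"
    and sub: "\<And>r :: nat \<Rightarrow> nat. strict_mono r \<Longrightarrow>
      \<exists>s. strict_mono s \<and> (AE x in M. eventually (\<lambda>n. x \<notin> E (r (s n))) sequentially)"
  shows "(\<lambda>n. measure M (E n)) \<longlonglongrightarrow> 0"
proof (rule LIMSEQ_subsequence_principle)
  fix r :: "nat \<Rightarrow> nat" assume "strict_mono r"
  then obtain s where s: "strict_mono s" "AE x in M. eventually (\<lambda>n. x \<notin> E (r (s n))) sequentially"
    using sub by blast
  have "(\<lambda>n. \<integral>x. indicator (E (r (s n))) x \<partial>M) \<longlonglongrightarrow> (\<integral>x. (0::real) \<partial>M)"
  proof (rule integral_dominated_convergence[where w = "\<lambda>_. 1"])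
    show "AE x in M. (\<lambda>n. indicator (E (r (s n))) x :: real) \<longlonglongrightarrow> 0"
      using s(2)
    proof eventually_elim
      case (elim x)
      then have "eventually (\<lambda>n. indicator (E (r (s n))) x = (0::real)) sequentially"
        by (rule eventually_mono) auto
      then show ?case by (rule tendsto_eventually)
    qed
  qed (use E in \<open>auto simp: indicator_def\<close>)
  then show "\<exists>s. strict_mono s \<and> (\<lambda>n. measure M (E (r (s n)))) \<longlonglongrightarrow> 0"
    using s(1) E by auto
qed

lemma conv_in_measureI_subseq:
  assumes F: "\<And>n. F n \<in> measurable M (borel_of T)" and f: "f \<in> measurable M (borel_of T)"
    and sub: "\<And>r :: nat \<Rightarrow> nat. strict_mono r \<Longrightarrow>
      \<exists>s. strict_mono s \<and> (AE x in M. limitin T (\<lambda>n. F (r (s n)) x) (f x) sequentially)"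
  shows "conv_in_measure M T F f"
  unfolding conv_in_measure_def
proof (intro allI impI measure_tendsto_0_subseq measurable_exceptional_set[OF f F])
  fix U and r :: "nat \<Rightarrow> nat" assume U: "openin T U" and "strict_mono r"
  then obtain s where s: "strict_mono s" "AE x in M. limitin T (\<lambda>n. F (r (s n)) x) (f x) sequentially"
    using sub by blast
  from s(2) have "AE x in M. eventually (\<lambda>n. x \<notin> {x \<in> space M. f x \<in> U \<and> F (r (s n)) x \<notin> U}) sequentially"
  proof eventually_elim
    case (elim x)
    show ?case
    proof (cases "f x \<in> U")
      case True
      then show ?thesis using limitinD[OF elim U] by (auto elim: eventually_mono)
    qed auto
  qed
  then show "\<exists>s. strict_mono s \<and>
      (AE x in M. eventually (\<lambda>n. x \<notin> {x \<in> space M. f x \<in> U \<and> F (r (s n)) x \<notin> U}) sequentially)"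
    using s(1) by blast
qed

lemma integrable_compatible_metric:
  assumes "polish_topology T" "compatible_bounded_metric T d"
    and "f \<in> measurable M (borel_of T)" and "g \<in> measurable M (borel_of T)"
  shows "integrable M (\<lambda>x. d (f x) (g x))"
proof -
  obtain b where b: "\<forall>x\<in>topspace T. \<forall>y\<in>topspace T. d x y \<le> b"
    using assms(2) by (auto simp: compatible_bounded_metric_def)
  have "AE x in M. norm (d (f x) (g x)) \<le> b"
    using b measurable_space[OF assms(3)] measurable_space[OF assms(4)] assms(2)
    by (auto simp: compatible_bounded_metric_def Metric_space.nonneg)
  then show ?thesis
    using measurable_compatible_metric[OF assms] by (intro integrable_const_bound)
qed

text \<open>Both directions go through almost everywhere convergent subsequences: dominated
  convergence, with the bound of \<open>d\<close>, yields the integrals, and convergence in mean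
  yields a pointwise convergent subsequence.\<close>

lemma conv_in_measure_iff_integral:
  assumes T: "polish_topology T" and d: "compatible_bounded_metric T d"
    and F: "\<And>n. F n \<in> measurable M (borel_of T)" and f: "f \<in> measurable M (borel_of T)"
  shows "conv_in_measure M T F f \<longleftrightarrow> (\<lambda>n. \<integral>x. d (F n x) (f x) \<partial>M) \<longlonglongrightarrow> 0"
proof -
  have ms: "Metric_space (topspace T) d" "Metric_space.mtopology (topspace T) d = T"
    using d by (auto simp: compatible_bounded_metric_def)
  interpret d: Metric_space "topspace T" d by fact
  obtain b where b: "\<And>x y. x \<in> topspace T \<Longrightarrow> y \<in> topspace T \<Longrightarrow> d x y \<le> b"
    using d by (auto simp: compatible_bounded_metric_def)
  note lim_iff = limitin_metric_eq[OF ms measurable_space[OF F, simplified] measurable_space[OF f, simplified]]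
  note meas = measurable_compatible_metric[OF T d F f]
  note int = integrable_compatible_metric[OF T d F f]
  show ?thesis
  proof
    assume conv: "conv_in_measure M T F f"
    show "(\<lambda>n. \<integral>x. d (F n x) (f x) \<partial>M) \<longlonglongrightarrow> 0"
    proof (rule LIMSEQ_subsequence_principle)
      fix r :: "nat \<Rightarrow> nat" assume "strict_mono r"
      then obtain s where s: "strict_mono s" "AE x in M. limitin T (\<lambda>n. F (r (s n)) x) (f x) sequentially"
        using conv_in_measure_AE_subseq[OF T F f conv_in_measure_subseq[OF conv]] by blast
      have "(\<lambda>n. \<integral>x. d (F (r (s n)) x) (f x) \<partial>M) \<longlonglongrightarrow> (\<integral>x. 0 \<partial>M)"
      proof (rule integral_dominated_convergence[where w = "\<lambda>_. b"])
        show "AE x in M. (\<lambda>n. d (F (r (s n)) x) (f x)) \<longlonglongrightarrow> 0"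
          using s(2) AE_space by eventually_elim (use lim_iff in simp)
        show "AE x in M. norm (d (F (r (s i)) x) (f x)) \<le> b" for i
          using b measurable_space[OF F] measurable_space[OF f] by auto
      qed (use meas in auto)
      then show "\<exists>s. strict_mono s \<and> (\<lambda>n. \<integral>x. d (F (r (s n)) x) (f x) \<partial>M) \<longlonglongrightarrow> 0" using s(1) by auto
    qed
  next
    assume lim: "(\<lambda>n. \<integral>x. d (F n x) (f x) \<partial>M) \<longlonglongrightarrow> 0"
    show "conv_in_measure M T F f"
    proof (rule conv_in_measureI_subseq[OF F f])
      fix r :: "nat \<Rightarrow> nat" assume r: "strict_mono r"
      have "(\<lambda>n. \<integral>x. norm (d (F (r n) x) (f x)) \<partial>M) \<longlonglongrightarrow> 0"
        using LIMSEQ_subseq_LIMSEQ[OF lim r] by (simp add: o_def)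
      from tendsto_L1_AE_subseq[OF int this]
      obtain s where s: "strict_mono s" "AE x in M. (\<lambda>n. d (F (r (s n)) x) (f x)) \<longlonglongrightarrow> 0"
        by blast
      from s(2) AE_space have "AE x in M. limitin T (\<lambda>n. F (r (s n)) x) (f x) sequentially"
        by eventually_elim (use lim_iff in simp)
      then show "\<exists>s. strict_mono s \<and> (AE x in M. limitin T (\<lambda>n. F (r (s n)) x) (f x) sequentially)"
        using s(1) by blast
    qed
  qed
qed

lemma conv_in_measure_unique:
  assumes T: "polish_topology T" and F: "\<And>n. F n \<in> measurable M (borel_of T)"
    and f: "f \<in> measurable M (borel_of T)" "conv_in_measure M T F f"
    and g: "g \<in> measurable M (borel_of T)" "conv_in_measure M T F g"
  shows "AE x in M. f x = g x"
proof -
  obtain s where s: "strict_mono s" "AE x in M. limitin T (\<lambda>n. F (s n) x) (f x) sequentially"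
    using conv_in_measure_AE_subseq[OF T F f] by blast
  obtain t where t: "strict_mono t" "AE x in M. limitin T (\<lambda>n. F (s (t n)) x) (g x) sequentially"
    using conv_in_measure_AE_subseq[OF T F g(1) conv_in_measure_subseq[OF g(2) s(1)]] by blast
  from s(2) t(2) show ?thesis
  proof eventually_elim
    case (elim x)
    then show ?case
      using limitin_Hausdorff_unique[OF limitin_subseq[OF elim(1) t(1)] elim(2)] polish_imp_Hausdorff[OF T] by simp
  qed
qed

lemma conv_in_measure_cong_AE:
  assumes F: "\<And>n. F n \<in> measurable M (borel_of T)" and f: "f \<in> measurable M (borel_of T)"
    and F': "\<And>n. F' n \<in> measurable M (borel_of T)" and f': "f' \<in> measurable M (borel_of T)"
    and "\<And>n. AE x in M. F n x = F' n x" "AE x in M. f x = f' x"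
  shows "conv_in_measure M T F f \<longleftrightarrow> conv_in_measure M T F' f'"
proof -
  have "measure M {x \<in> space M. f x \<in> U \<and> F n x \<notin> U} = measure M {x \<in> space M. f' x \<in> U \<and> F' n x \<notin> U}"
    if U: "openin T U" for U n
  proof (rule measure_eq_AE)
    show "AE x in M. (x \<in> {x \<in> space M. f x \<in> U \<and> F n x \<notin> U}) = (x \<in> {x \<in> space M. f' x \<in> U \<and> F' n x \<notin> U})"
      using assms(5)[of n] assms(6) by eventually_elim auto
  qed (use measurable_exceptional_set[OF f F U] measurable_exceptional_set[OF f' F' U] in auto)
  then show ?thesis unfolding conv_in_measure_def by simp
qed

lemma conv_in_measure_continuous2:
  assumes T: "polish_topology T" and m: "continuous_map (prod_topology T T) T (\<lambda>(x, y). m x y)"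
    and F: "\<And>n. F n \<in> measurable M (borel_of T)" and f: "f \<in> measurable M (borel_of T)"
    and H: "\<And>n. H n \<in> measurable M (borel_of T)" and h: "h \<in> measurable M (borel_of T)"
    and conv: "conv_in_measure M T F f" "conv_in_measure M T H h"
  shows "conv_in_measure M T (\<lambda>n x. m (F n x) (H n x)) (\<lambda>x. m (f x) (h x))"
proof -
  have "(\<lambda>(x, y). m x y) \<in> measurable (borel_of T \<Otimes>\<^sub>M borel_of T) (borel_of T)"
    using continuous_map_borel_measurable[OF m]
      measurable_cong_sets[OF sets_borel_of_prod_topology[of T T] refl] polish_imp_second_countable[OF T] by blast
  then have meas: "(\<lambda>x. m (p x) (q x)) \<in> measurable M (borel_of T)"
    if "p \<in> measurable M (borel_of T)" "q \<in> measurable M (borel_of T)" for p q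
    using measurable_compose[OF measurable_Pair[OF that], of "\<lambda>(x, y). m x y"] by simp
  show ?thesis
  proof (rule conv_in_measureI_subseq)
    fix r :: "nat \<Rightarrow> nat" assume r: "strict_mono r"
    obtain s where s: "strict_mono s" "AE x in M. limitin T (\<lambda>n. F (r (s n)) x) (f x) sequentially"
      using conv_in_measure_AE_subseq[OF T F f conv_in_measure_subseq[OF conv(1) r]] by blast
    have rs: "strict_mono (r \<circ> s)" using r s(1) by (rule strict_mono_o)
    obtain t where t: "strict_mono t" "AE x in M. limitin T (\<lambda>n. H ((r \<circ> s) (t n)) x) (h x) sequentially"
      using conv_in_measure_AE_subseq[OF T H h conv_in_measure_subseq[OF conv(2) rs]] by blast
    have "AE x in M. limitin T (\<lambda>n. m (F (r (s (t n))) x) (H (r (s (t n))) x)) (m (f x) (h x)) sequentially"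
      using s(2) t(2)
    proof eventually_elim
      case (elim x)
      have "limitin (prod_topology T T) (\<lambda>n. (F (r (s (t n))) x, H (r (s (t n))) x)) (f x, h x) sequentially"
        unfolding limitin_pairwise using limitin_subseq[OF elim(1) t(1)] elim(2) by (simp add: o_def)
      from continuous_map_limit[OF m this] show ?case by (simp add: o_def)
    qed
    then show "\<exists>s. strict_mono s \<and> (AE x in M. limitin T (\<lambda>n. m (F (r (s n)) x) (H (r (s n)) x)) (m (f x) (h x)) sequentially)"
      using strict_mono_o[OF s(1) t(1)] by (intro exI[of _ "s \<circ> t"]) (simp add: o_def)
  qed (use meas F f H h in auto)
qed

lemma conv_in_measure_continuous:
  assumes T: "polish_topology T" and m: "continuous_map T T' m"
    and F: "\<And>n. F n \<in> measurable M (borel_of T)" and f: "f \<in> measurable M (borel_of T)"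
    and conv: "conv_in_measure M T F f"
  shows "conv_in_measure M T' (\<lambda>n x. m (F n x)) (\<lambda>x. m (f x))"
  unfolding conv_in_measure_def
proof (intro allI impI)
  fix U assume U: "openin T' U"
  define V where "V = {x \<in> topspace T. m x \<in> U}"
  have "openin T V" unfolding V_def using m U by (rule openin_continuous_map_preimage)
  moreover have "{x \<in> space M. m (f x) \<in> U \<and> m (F n x) \<notin> U} = {x \<in> space M. f x \<in> V \<and> F n x \<notin> V}" for n
    using measurable_space[OF F] measurable_space[OF f] by (auto simp: V_def)
  ultimately show "(\<lambda>n. measure M {x \<in> space M. m (f x) \<in> U \<and> m (F n x) \<notin> U}) \<longlonglongrightarrow> 0"
    using conv by (simp add: conv_in_measure_def)
qed

end


subsection \<open>The space of measurable maps up to null sets\<close>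

lemma equiv_ae_rel: "equiv (measurable M N) (ae_rel M N)"
proof (rule equivI)
  show "ae_rel M N \<subseteq> measurable M N \<times> measurable M N" by (auto simp: ae_rel_def)
  show "refl_on (measurable M N) (ae_rel M N)" by (auto simp: refl_on_def ae_rel_def)
  show "sym (ae_rel M N)" by (auto simp: sym_def ae_rel_def eq_commute)
  show "trans (ae_rel M N)"
  proof (rule transI)
    fix f g h assume "(f, g) \<in> ae_rel M N" "(g, h) \<in> ae_rel M N"
    then have *: "f \<in> measurable M N" "h \<in> measurable M N" "AE x in M. f x = g x" "AE x in M. g x = h x"
      by (auto simp: ae_rel_def)
    from *(3,4) have "AE x in M. f x = h x" by eventually_elim simp
    then show "(f, h) \<in> ae_rel M N" using * by (simp add: ae_rel_def)
  qed
qed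

lemma ae_class_in_L0: "f \<in> measurable M N \<Longrightarrow> ae_class M N f \<in> L0 M N"
  unfolding ae_class_def L0_def by (rule quotientI)

lemma ae_class_eq_iff:
  "f \<in> measurable M N \<Longrightarrow> g \<in> measurable M N \<Longrightarrow> ae_class M N f = ae_class M N g \<longleftrightarrow> (AE x in M. f x = g x)"
  unfolding ae_class_def using eq_equiv_class_iff[OF equiv_ae_rel, of f M N g] by (simp add: ae_rel_def)

lemma in_ae_class_iff:
  "f \<in> measurable M N \<Longrightarrow> g \<in> ae_class M N f \<longleftrightarrow> g \<in> measurable M N \<and> (AE x in M. f x = g x)"
  by (auto simp: ae_class_def ae_rel_def)

lemma rep_ae_class:
  assumes f: "f \<in> measurable M N"
  shows "rep (ae_class M N f) \<in> measurable M N" "AE x in M. rep (ae_class M N f) x = f x"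
proof -
  have "f \<in> ae_class M N f" using f by (simp add: in_ae_class_iff)
  then have "rep (ae_class M N f) \<in> ae_class M N f" unfolding rep_def by (rule someI[of "\<lambda>g. g \<in> ae_class M N f"])
  then have *: "rep (ae_class M N f) \<in> measurable M N" "AE x in M. f x = rep (ae_class M N f) x"
    using f by (auto simp: in_ae_class_iff)
  show "rep (ae_class M N f) \<in> measurable M N" by (rule *(1))
  from *(2) show "AE x in M. rep (ae_class M N f) x = f x" by eventually_elim simp
qed

lemma rep_L0:
  assumes "C \<in> L0 M N"
  shows "rep C \<in> measurable M N" "ae_class M N (rep C) = C"
proof -
  obtain f where f: "f \<in> measurable M N" "C = ae_class M N f"
    using assms unfolding L0_def ae_class_def by (rule quotientE)
  show "rep C \<in> measurable M N" using rep_ae_class(1)[OF f(1)] f(2) by simp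
  then show "ae_class M N (rep C) = C"
    using rep_ae_class[OF f(1)] f by (simp add: ae_class_eq_iff)
qed

lemma L0_eqI: "C \<in> L0 M N \<Longrightarrow> D \<in> L0 M N \<Longrightarrow> AE x in M. rep C x = rep D x \<Longrightarrow> C = D"
  using ae_class_eq_iff[OF rep_L0(1) rep_L0(1), of C M N D] rep_L0(2)[of C M N] rep_L0(2)[of D M N] by simp

section \<open>Complete bounded metrics, countable approximation and step functions\<close>

lemma polish_bounded_complete_metric:
  assumes "polish_topology T"
  shows "\<exists>d. compatible_bounded_metric T d \<and> Metric_space.mcomplete (topspace T) d \<and> (\<forall>x y. d x y \<le> 1)"
proof -
  obtain A d where ms: "Metric_space A d" and mc: "Metric_space.mcomplete A d" and T: "T = Metric_space.mtopology A d"
    using assms by (auto simp: polish_topology_def completely_metrizable_space_def)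
  interpret Metric_space A d by fact
  have "topspace T = A" by (simp add: T)
  moreover have "capped_dist 1 x y \<le> 1" for x y by (simp add: capped_dist_def)
  ultimately show ?thesis
    using mc T unfolding compatible_bounded_metric_def
    by (intro exI[of _ "capped_dist 1"]) (auto simp: capped_dist mtopology_capped_metric mcomplete_capped_metric)
qed

text \<open>A countable base is closed off under complements and binary unions in countably many
  rounds. The sets approximable by the resulting algebra form a sigma-algebra that contains all open
  sets; countable unions are first cut to finite ones by continuity of the measure.\<close>

lemma countable_dense_subalgebra:
  assumes "finite_measure M" and sc: "second_countable T" and M: "sets M = sets (borel_of T)"
  shows "\<exists>\<A>. countable \<A> \<and> \<A> \<subseteq> sets M \<and> (\<forall>B\<in>sets M. \<forall>e>0. \<exists>A\<in>\<A>. measure M (sym_diff A B) < e)"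
proof -
  interpret finite_measure M by fact
  have spM: "space M = topspace T" using sets_eq_imp_space_eq[OF M] by simp
  obtain B :: "nat \<Rightarrow> 'a set" where "(\<forall>n. openin T (B n)) \<and>
      (\<forall>U x. openin T U \<longrightarrow> x \<in> U \<longrightarrow> (\<exists>n. x \<in> B n \<and> B n \<subseteq> U))"
    using second_countable_sequence[OF sc] by (rule exE)
  then have B: "\<And>n. openin T (B n)" "\<And>U x. openin T U \<Longrightarrow> x \<in> U \<Longrightarrow> \<exists>n. x \<in> B n \<and> B n \<subseteq> U"
    by blast+
  define step where "step \<C> = \<C> \<union> (\<lambda>A. topspace T - A) ` \<C> \<union> (\<lambda>(A, A'). A \<union> A') ` (\<C> \<times> \<C>)" for \<C> :: "'a set set"
  define S where "S = rec_nat (insert {} (range B)) (\<lambda>_. step)"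
  have S: "S 0 = insert {} (range B)" "S (Suc n) = step (S n)" for n by (simp_all add: S_def)
  define \<A> where "\<A> = (\<Union>n. S n)"
  have "countable (S n)" for n by (induction n) (auto simp: S step_def)
  then have c: "countable \<A>" by (auto simp: \<A>_def)
  have "S n \<subseteq> sets M" for n
  proof (induction n)
    case 0
    then show ?case using B(1) by (auto simp: S M intro: borel_of_open)
  next
    case (Suc n)
    then have "topspace T - A \<in> sets M" if "A \<in> S n" for A
      using sets.compl_sets[of A M] that spM by auto
    then show ?case using Suc unfolding S step_def by auto
  qed
  then have \<A>M: "\<A> \<subseteq> sets M" by (auto simp: \<A>_def)
  have mono: "S m \<subseteq> S n" if "m \<le> n" for m n
    using that by (induction rule: dec_induct) (auto simp: S step_def)
  have compl: "topspace T - A \<in> \<A>" if A: "A \<in> \<A>" for A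
  proof -
    obtain n where "A \<in> S n" using A by (auto simp: \<A>_def)
    then have "topspace T - A \<in> S (Suc n)" by (auto simp: S step_def)
    then show ?thesis unfolding \<A>_def by blast
  qed
  have un: "A \<union> A' \<in> \<A>" if A: "A \<in> \<A>" "A' \<in> \<A>" for A A'
  proof -
    obtain m n where "A \<in> S m" "A' \<in> S n" using A by (auto simp: \<A>_def)
    then have "A \<in> S (max m n)" "A' \<in> S (max m n)" using mono[of m "max m n"] mono[of n "max m n"] by auto
    then have "A \<union> A' \<in> S (Suc (max m n))" by (auto simp: S step_def)
    then show ?thesis unfolding \<A>_def by blast
  qed
  define dense where "dense C \<longleftrightarrow> C \<in> sets M \<and> (\<forall>e>0. \<exists>A\<in>\<A>. measure M (sym_diff A C) < e)" for C
  have dense_A: "dense A" if "A \<in> \<A>" for A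
    using that \<A>M unfolding dense_def by (auto intro!: bexI[of _ A])
  have sd: "sym_diff A C \<in> sets M" if "A \<in> \<A>" "C \<in> sets M" for A C using that \<A>M by auto
  have dense_Un: "dense (C \<union> D)" if CD: "dense C" "dense D" for C D
    unfolding dense_def
  proof (intro conjI allI impI)
    show CDM: "C \<union> D \<in> sets M" using CD by (auto simp: dense_def)
    fix e :: real assume e: "e > 0"
    obtain A where A: "A \<in> \<A>" "measure M (sym_diff A C) < e / 2"
      using CD(1) e unfolding dense_def by (meson half_gt_zero)
    obtain A' where A': "A' \<in> \<A>" "measure M (sym_diff A' D) < e / 2"
      using CD(2) e unfolding dense_def by (meson half_gt_zero)
    have CM: "C \<in> sets M" "D \<in> sets M" using CD by (auto simp: dense_def)
    have "measure M (sym_diff (A \<union> A') (C \<union> D)) \<le> measure M (sym_diff A C \<union> sym_diff A' D)"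
      using sd[OF A(1) CM(1)] sd[OF A'(1) CM(2)] by (intro finite_measure_mono) auto
    also have "\<dots> \<le> measure M (sym_diff A C) + measure M (sym_diff A' D)"
      using sd[OF A(1) CM(1)] sd[OF A'(1) CM(2)] by (intro measure_Un_le)
    finally show "\<exists>A\<in>\<A>. measure M (sym_diff A (C \<union> D)) < e"
      using A A' un[OF A(1) A'(1)] by (intro bexI[of _ "A \<union> A'"]) auto
  qed
  have dense_compl: "dense (topspace T - C)" if C: "dense C" for C
    unfolding dense_def
  proof (intro conjI allI impI)
    have CM: "C \<in> sets M" using C by (auto simp: dense_def)
    then show "topspace T - C \<in> sets M" using sets.compl_sets[of C M] spM by simp
    fix e :: real assume e: "e > 0"
    then obtain A where A: "A \<in> \<A>" "measure M (sym_diff A C) < e" using C unfolding dense_def by blast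
    have "sym_diff (topspace T - A) (topspace T - C) = sym_diff A C"
      using \<A>M A(1) CM sets.sets_into_space[of _ M] spM by blast
    then show "\<exists>A\<in>\<A>. measure M (sym_diff A (topspace T - C)) < e"
      using A compl by (intro bexI[of _ "topspace T - A"]) auto
  qed
  have dense_UN: "dense (\<Union>i. C i)" if C: "\<And>i::nat. dense (C i)" for C
    unfolding dense_def
  proof (intro conjI allI impI)
    have CM: "C i \<in> sets M" for i using C by (auto simp: dense_def)
    show UM: "(\<Union>i. C i) \<in> sets M" using CM by auto
    fix e :: real assume e: "e > 0"
    define D where "D n = (\<Union>i\<in>{..n}. C i)" for n
    have DM: "D n \<in> sets M" for n unfolding D_def using CM by auto
    have D: "dense (D n)" for n
    proof (induction n)
      case (Suc n)
      have "D (Suc n) = D n \<union> C (Suc n)" by (auto simp: D_def atMost_Suc)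
      then show ?case using dense_Un[OF Suc C] by simp
    qed (use C in \<open>simp add: D_def\<close>)
    have "(\<lambda>n. measure M (D n)) \<longlonglongrightarrow> measure M (\<Union>n. D n)"
    proof (rule finite_Lim_measure_incseq)
      show "range D \<subseteq> sets M" using DM by auto
      show "incseq D" unfolding incseq_def D_def by (intro allI impI UN_mono) auto
    qed
    also have "(\<Union>n. D n) = (\<Union>i. C i)" by (auto simp: D_def)
    finally have "eventually (\<lambda>n. measure M (D n) > measure M (\<Union>i. C i) - e / 2) sequentially"
      using e by (intro order_tendstoD(1)) auto
    then obtain n where n: "measure M (D n) > measure M (\<Union>i. C i) - e / 2"
      by (auto simp: eventually_sequentially)
    obtain A where A: "A \<in> \<A>" "measure M (sym_diff A (D n)) < e / 2"
      using D[of n] e unfolding dense_def by (meson half_gt_zero)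
    have Dsub: "D n \<subseteq> (\<Union>i. C i)" by (auto simp: D_def)
    have "measure M (sym_diff A (\<Union>i. C i)) \<le> measure M (sym_diff A (D n) \<union> ((\<Union>i. C i) - D n))"
      using sd[OF A(1) DM] UM DM Dsub by (intro finite_measure_mono) auto
    also have "\<dots> \<le> measure M (sym_diff A (D n)) + measure M ((\<Union>i. C i) - D n)"
      using sd[OF A(1) DM] UM DM by (intro measure_Un_le) auto
    also have "measure M ((\<Union>i. C i) - D n) = measure M (\<Union>i. C i) - measure M (D n)"
      using UM DM Dsub by (intro finite_measure_Diff)
    finally show "\<exists>A\<in>\<A>. measure M (sym_diff A (\<Union>i. C i)) < e"
      using A n by (intro bexI[of _ A]) auto
  qed
  have dense_open: "dense U" if U: "openin T U" for U
  proof -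
    have "U = (\<Union>n. if B n \<subseteq> U then B n else {})" using openin_Union_base[of T B, OF B(2) U] by (auto split: if_splits)
    moreover have "dense (if B n \<subseteq> U then B n else {})" for n
    proof -
      have "B n \<in> S 0" "{} \<in> S 0" by (auto simp: S)
      then have "B n \<in> \<A>" "{} \<in> \<A>" unfolding \<A>_def by blast+
      then show ?thesis using dense_A by auto
    qed
    ultimately show ?thesis using dense_UN[of "\<lambda>n. if B n \<subseteq> U then B n else {}"] by simp
  qed
  have dense_empty: "dense {}"
    by (rule dense_A) (auto simp: \<A>_def S intro!: exI[of _ 0])
  have "dense C" if "C \<in> sigma_sets (topspace T) {U. openin T U}" for C
    using that by induction (auto intro: dense_open dense_empty dense_compl dense_UN)
  then have "dense C" if "C \<in> sets M" for C using that by (simp add: M sets_borel_of)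
  then show ?thesis using c \<A>M unfolding dense_def by blast
qed

text \<open>A step function given by a list of set-value pairs, with default \<open>c\<close>. The
  first matching pair decides, so the sets may overlap and can be taken from any dense family
  without making them disjoint.\<close>

fun select :: "'y \<Rightarrow> ('a set \<times> 'y) list \<Rightarrow> 'a \<Rightarrow> 'y" where
  "select c [] x = c"
| "select c (p # l) x = (if x \<in> fst p then snd p else select c l x)"

lemma select_measurable:
  "c \<in> topspace T \<Longrightarrow> set l \<subseteq> sets M \<times> topspace T \<Longrightarrow> select c l \<in> measurable M (borel_of T)"
proof (induction l)
  case Nil
  then show ?case by (simp add: measurable_const)
next
  case (Cons p l)
  then have "select c l \<in> measurable M (borel_of T)" "fst p \<in> sets M" "snd p \<in> topspace T" by auto
  then have "(\<lambda>x. if x \<in> fst p then snd p else select c l x) \<in> measurable M (borel_of T)"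
    by (intro measurable_If_set measurable_const) auto
  then show ?case by (simp add: fun_eq_iff[symmetric])
qed

lemma select_in:
  "\<exists>p\<in>set l. x \<in> fst p \<Longrightarrow> \<exists>p\<in>set l. x \<in> fst p \<and> select c l x = snd p"
  by (induction l) auto

context prob_space
begin

lemma Metric_space_L0:
  assumes T: "polish_topology T" and d: "compatible_bounded_metric T d"
  shows "Metric_space (L0 M (borel_of T)) (L0_dist M d)"
proof -
  interpret d: Metric_space "topspace T" d using d by (simp add: compatible_bounded_metric_def)
  note int = integrable_compatible_metric[OF T d]
  show ?thesis
  proof
    show "0 \<le> L0_dist M d F H" for F H by (simp add: L0_dist_def)
    show "L0_dist M d F H = L0_dist M d H F" for F H by (simp add: L0_dist_def d.commute)
  next
    fix F H assume FH: "F \<in> L0 M (borel_of T)" "H \<in> L0 M (borel_of T)"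
    note m = rep_L0(1)[OF FH(1)] rep_L0(1)[OF FH(2)]
    have "L0_dist M d F H = 0 \<longleftrightarrow> (AE x in M. d (rep F x) (rep H x) = 0)"
      unfolding L0_dist_def using int[OF m] by (intro integral_nonneg_eq_0_iff_AE) auto
    also have "\<dots> \<longleftrightarrow> (AE x in M. rep F x = rep H x)"
    proof (rule AE_cong)
      fix x assume "x \<in> space M"
      then have "rep F x \<in> topspace T" "rep H x \<in> topspace T" using m[THEN measurable_space] by auto
      then show "d (rep F x) (rep H x) = 0 \<longleftrightarrow> rep F x = rep H x" by simp
    qed
    also have "\<dots> \<longleftrightarrow> F = H" using L0_eqI[OF FH] by auto
    finally show "L0_dist M d F H = 0 \<longleftrightarrow> F = H" .
  next
    fix F H K assume FHK: "F \<in> L0 M (borel_of T)" "H \<in> L0 M (borel_of T)" "K \<in> L0 M (borel_of T)"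
    note m = FHK[THEN rep_L0(1)]
    have "L0_dist M d F K \<le> (\<integral>x. d (rep F x) (rep H x) + d (rep H x) (rep K x) \<partial>M)"
      unfolding L0_dist_def using int[OF m(1,3)] int[OF m(1,2)] int[OF m(2,3)] m[THEN measurable_space]
      by (intro integral_mono) (auto intro!: d.triangle)
    also have "\<dots> = L0_dist M d F H + L0_dist M d H K"
      unfolding L0_dist_def using int[OF m(1,2)] int[OF m(2,3)] by simp
    finally show "L0_dist M d F K \<le> L0_dist M d F H + L0_dist M d H K" .
  qed
qed

lemma topspace_L0_topology:
  "polish_topology T \<Longrightarrow> compatible_bounded_metric T d \<Longrightarrow> topspace (L0_topology M T d) = L0 M (borel_of T)"
  unfolding L0_topology_def by (rule Metric_space.topspace_mtopology[OF Metric_space_L0])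

lemma limitin_L0_iff:
  assumes T: "polish_topology T" and d: "compatible_bounded_metric T d"
    and F: "\<And>n. F n \<in> L0 M (borel_of T)" and f: "f \<in> L0 M (borel_of T)"
  shows "limitin (L0_topology M T d) F f sequentially \<longleftrightarrow> conv_in_measure M T (\<lambda>n. rep (F n)) (rep f)"
  unfolding L0_topology_def Metric_space.limitin_metric_dist_null[OF Metric_space_L0[OF T d]]
    conv_in_measure_iff_integral[OF T d rep_L0(1)[OF F] rep_L0(1)[OF f]]
  using F f by (simp add: L0_dist_def)

lemma limitin_L0_ae_class_iff:
  assumes T: "polish_topology T" and d: "compatible_bounded_metric T d"
    and F: "\<And>n. F n \<in> measurable M (borel_of T)" and f: "f \<in> measurable M (borel_of T)"
  shows "limitin (L0_topology M T d) (\<lambda>n. ae_class M (borel_of T) (F n)) (ae_class M (borel_of T) f) sequentially \<longleftrightarrow>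
    conv_in_measure M T F f"
  unfolding limitin_L0_iff[OF T d ae_class_in_L0[OF F] ae_class_in_L0[OF f]]
  by (intro conv_in_measure_cong_AE rep_ae_class F f)

lemma L0_topology_independent:
  assumes T: "polish_topology T" and d: "compatible_bounded_metric T d" and d': "compatible_bounded_metric T d'"
  shows "L0_topology M T d = L0_topology M T d'"
  unfolding L0_topology_def
proof (rule mtopology_eq_sequentially[OF Metric_space_L0[OF T d] Metric_space_L0[OF T d']])
  fix F :: "nat \<Rightarrow> _" and f assume "range F \<subseteq> L0 M (borel_of T)" "f \<in> L0 M (borel_of T)"
  then have *: "\<And>n. rep (F n) \<in> measurable M (borel_of T)" "rep f \<in> measurable M (borel_of T)"
    using rep_L0(1) by blast+
  show "(\<lambda>n. L0_dist M d (F n) f) \<longlonglongrightarrow> 0 \<longleftrightarrow> (\<lambda>n. L0_dist M d' (F n) f) \<longlonglongrightarrow> 0"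
    unfolding L0_dist_def conv_in_measure_iff_integral[OF T d *, symmetric]
      conv_in_measure_iff_integral[OF T d' *, symmetric] ..
qed

text \<open>A Cauchy sequence has a subsequence whose consecutive distances are almost surely eventually at most \<open>2\<^sup>-\<^sup>n\<close>, by
  Markov's inequality and Borel--Cantelli.\<close>

lemma mcomplete_L0:
  assumes T: "polish_topology T" and d: "compatible_bounded_metric T d"
    and mc: "Metric_space.mcomplete (topspace T) d"
  shows "Metric_space.mcomplete (L0 M (borel_of T)) (L0_dist M d)"
proof -
  interpret L: Metric_space "L0 M (borel_of T)" "L0_dist M d" by (rule Metric_space_L0[OF T d])
  interpret d: Metric_space "topspace T" d using d by (simp add: compatible_bounded_metric_def)
  have dT: "d.mtopology = T" using d by (simp add: compatible_bounded_metric_def)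
  note int = integrable_compatible_metric[OF T d]
  note meas = measurable_compatible_metric[OF T d]
  show ?thesis
    unfolding L.mcomplete_def
  proof (intro allI impI)
    fix F assume F: "L.MCauchy F"
    then have FL: "\<And>n. F n \<in> L0 M (borel_of T)" by (auto simp: L.MCauchy_def)
    have m: "rep (F n) \<in> measurable M (borel_of T)" for n by (rule rep_L0(1)[OF FL])
    \<comment> \<open>The rate \<open>(1/4) ^ k\<close> for the integrals leaves
      \<open>(1/2) ^ k\<close> for both the pointwise threshold and, by Markov's inequality, the
      measure of the set where it is exceeded.\<close>
    have "\<exists>N. \<forall>n\<ge>N. \<forall>n'\<ge>N. L0_dist M d (F n) (F n') < (1/4) ^ k" for k
      using F unfolding L.MCauchy_def by (metis zero_less_power zero_less_divide_1_iff zero_less_numeral)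
    then obtain N where N: "\<And>k n n'. n \<ge> N k \<Longrightarrow> n' \<ge> N k \<Longrightarrow> L0_dist M d (F n) (F n') < (1/4) ^ k" by metis
    \<comment> \<open>Summing the successors makes \<open>r\<close> strictly increasing and keeps
      \<open>r k\<close> above \<open>N k\<close>.\<close>
    define r where "r k = (\<Sum>i\<le>k. Suc (N i))" for k
    have rN: "r k \<ge> N k" for k unfolding r_def by (induction k) auto
    have "r k < r (Suc k)" for k by (simp add: r_def)
    then have r: "strict_mono r" by (simp add: strict_mono_Suc_iff)
    define f where "f k = rep (F (r k))" for k
    have fm: "f k \<in> measurable M (borel_of T)" for k unfolding f_def by (rule m)
    have fT: "f k x \<in> topspace T" if "x \<in> space M" for k x using measurable_space[OF fm that] by simp
    define A where "A k = {x \<in> space M. (1/2) ^ k \<le> d (f k x) (f (Suc k) x)}" for k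
    have A: "A k \<in> sets M" for k unfolding A_def using meas[OF fm fm] by simp
    have "measure M (A k) \<le> (1/2) ^ k" for k
    proof -
      have "measure M (A k) \<le> (\<integral>x. d (f k x) (f (Suc k) x) \<partial>M) / (1/2) ^ k"
        unfolding A_def using int[OF fm fm] by (intro integral_Markov_inequality_measure[where A = "{}"]) auto
      also have "(\<integral>x. d (f k x) (f (Suc k) x) \<partial>M) \<le> (1/4) ^ k"
      proof -
        have "r k \<le> r (Suc k)" using r by (simp add: strict_mono_less_eq)
        then show ?thesis
          using N[of k "r k" "r (Suc k)"] rN[of k] unfolding f_def L0_dist_def by linarith
      qed
      then have "(\<integral>x. d (f k x) (f (Suc k) x) \<partial>M) / (1/2) ^ k \<le> (1/4) ^ k / (1/2) ^ k"
        by (intro divide_right_mono) auto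
      also have "\<dots> = (1/2) ^ k" by (simp add: power_divide[symmetric])
      finally show ?thesis .
    qed
    then have "summable (\<lambda>k. measure M (A k))"
      by (intro summable_comparison_test'[OF summable_geometric[of "1/2::real"], of 0]) (simp_all add: measure_nonneg)
    then have "AE x in M. eventually (\<lambda>k. x \<in> space M - A k) sequentially"
      by (intro borel_cantelli_AE1 A) (auto simp: emeasure_eq_measure)
    then obtain N0 where N0: "N0 \<in> null_sets M"
      "\<And>x. x \<in> space M - N0 \<Longrightarrow> eventually (\<lambda>k. x \<in> space M - A k) sequentially"
      by (auto elim!: AE_E3)
    have lim: "\<exists>l. limitin T (\<lambda>k. f k x) l sequentially" if x: "x \<in> space M - N0" for x
    proof -
      obtain K where K: "\<And>k. k \<ge> K \<Longrightarrow> d (f k x) (f (Suc k) x) < (1/2) ^ k"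
        using N0(2)[OF x] x unfolding A_def eventually_sequentially by (auto simp: not_le)
      \<comment> \<open>The bound is the exact tail of the geometric series, so that the induction
        telescopes.\<close>
      have chain: "d (f k x) (f (k + j) x) \<le> 2 * (1/2) ^ k - 2 * (1/2) ^ (k + j)" if k: "k \<ge> K" for k j
      proof (induction j)
        case (Suc j)
        have "d (f k x) (f (k + Suc j) x) \<le> d (f k x) (f (k + j) x) + d (f (k + j) x) (f (Suc (k + j)) x)"
          using d.triangle[of "f k x" "f (k + j) x" "f (Suc (k + j)) x"] fT x by auto
        moreover have "(1/2::real) ^ (k + Suc j) = (1/2) ^ (k + j) / 2" by simp
        moreover have "d (f (k + j) x) (f (Suc (k + j)) x) < (1/2) ^ (k + j)" using K[of "k + j"] k by simp
        ultimately show ?case using Suc by linarith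
      qed (use fT x in auto)
      have "d.MCauchy (\<lambda>k. f k x)"
        unfolding d.MCauchy_def
      proof (intro conjI allI impI)
        show "range (\<lambda>k. f k x) \<subseteq> topspace T" using fT x by auto
        fix e :: real assume "e > 0"
        then obtain j where j: "(1/2) ^ j < e / 4" using real_arch_pow_inv[of "e/4" "1/2::real"] by auto
        define k where "k = max j K"
        have kj: "(1/2::real) ^ k \<le> (1/2) ^ j" by (intro power_decreasing) (auto simp: k_def)
        have near: "d (f k x) (f n x) < e / 2" if "n \<ge> k" for n
        proof -
          have "d (f k x) (f n x) \<le> 2 * (1/2) ^ k - 2 * (1/2) ^ n"
            using chain[of k "n - k"] that by (simp add: k_def)
          also have "\<dots> \<le> 2 * (1/2) ^ k" by simp
          finally show ?thesis using j kj by linarith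
        qed
        have "d (f n x) (f n' x) < e" if "k \<le> n" "k \<le> n'" for n n'
          using near[OF that(1)] near[OF that(2)] d.triangle''[of "f n x" "f k x" "f n' x"] fT x
          by (auto simp: d.commute)
        then show "\<exists>N. \<forall>n n'. N \<le> n \<longrightarrow> N \<le> n' \<longrightarrow> d (f n x) (f n' x) < e" by blast
      qed
      then show ?thesis using mc dT unfolding d.mcomplete_def by metis
    qed
    obtain x0 where x0: "x0 \<in> space M" using not_empty by blast
    define c where "c = f 0 x0"
    have c: "c \<in> topspace T" unfolding c_def by (rule fT[OF x0])
    \<comment> \<open>On the null set both the sequence and the limit are replaced by the constant
      \<open>c\<close>. The convergence then holds at every point, as measurability of the limit
      requires.\<close>
    define g where "g x = (if x \<in> N0 then c else SOME l. limitin T (\<lambda>k. f k x) l sequentially)" for x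
    have glim: "limitin T (\<lambda>k. f k x) (g x) sequentially" if "x \<in> space M - N0" for x
      using someI_ex[OF lim[OF that]] that by (simp add: g_def)
    have "g \<in> measurable M (borel_of T)"
    proof (rule measurable_limit_borel_of[OF T, where F = "\<lambda>n x. if x \<in> N0 then c else f n x"])
      show "(\<lambda>x. if x \<in> N0 then c else f n x) \<in> measurable M (borel_of T)" for n
        using N0(1) c fm by (intro measurable_If_set) (auto simp: null_sets_def)
      show "limitin T (\<lambda>n. if x \<in> N0 then c else f n x) (g x) sequentially" if "x \<in> space M" for x
        using glim[of x] that c by (cases "x \<in> N0") (auto simp: g_def)
    qed
    then have g: "g \<in> measurable M (borel_of T)" .
    have AEg: "AE x in M. limitin T (\<lambda>k. f k x) (g x) sequentially"
      using AE_not_in[OF N0(1)] AE_space by eventually_elim (use glim in blast)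
    have "conv_in_measure M T f g"
    proof (rule conv_in_measureI_subseq[OF fm g])
      fix s :: "nat \<Rightarrow> nat" assume s: "strict_mono s"
      have "AE x in M. limitin T (\<lambda>k. f (s k) x) (g x) sequentially"
        using AEg by eventually_elim (rule limitin_subseq[OF _ s])
      then show "\<exists>t. strict_mono t \<and> (AE x in M. limitin T (\<lambda>n. f (s (t n)) x) (g x) sequentially)"
        by (intro exI[of _ id]) (auto simp: strict_mono_def)
    qed
    then have "limitin (L0_topology M T d) (\<lambda>k. ae_class M (borel_of T) (f k)) (ae_class M (borel_of T) g) sequentially"
      by (simp add: limitin_L0_ae_class_iff[OF T d fm g])
    then have "limitin L.mtopology (F \<circ> r) (ae_class M (borel_of T) g) sequentially"
      using rep_L0(2)[OF FL] by (simp add: f_def L0_topology_def o_def)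
    then show "\<exists>l. limitin L.mtopology F l sequentially"
      using L.MCauchy_convergent_subsequence[OF F r] by blast
  qed
qed

text \<open>The given \<open>d\<close> may be incomplete; since the topology does not depend on it,
  a complete compatible metric takes its place.\<close>

lemma completely_metrizable_L0:
  assumes T: "polish_topology T" and d: "compatible_bounded_metric T d"
  shows "completely_metrizable_space (L0_topology M T d)"
proof -
  obtain d' where d': "compatible_bounded_metric T d'" "Metric_space.mcomplete (topspace T) d'"
    using polish_bounded_complete_metric[OF T] by blast
  show ?thesis
    unfolding L0_topology_independent[OF T d d'(1)] unfolding L0_topology_def
    by (rule Metric_space.completely_metrizable_space_mtopology[OF Metric_space_L0[OF T d'(1)] mcomplete_L0[OF T d']])
qed

text \<open>The dense set consists of step functions with values in a countable dense subset of the
  target, on sets from a countable family dense in the measure algebra.\<close>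

lemma separable_L0:
  assumes M: "second_countable X" "sets M = sets (borel_of X)"
    and T: "polish_topology T" and d: "compatible_bounded_metric T d"
  shows "separable_space (L0_topology M T d)"
proof -
  obtain d' where d': "compatible_bounded_metric T d'" "\<And>x y. d' x y \<le> 1"
    using polish_bounded_complete_metric[OF T] by blast
  interpret L: Metric_space "L0 M (borel_of T)" "L0_dist M d'" by (rule Metric_space_L0[OF T d'(1)])
  interpret d: Metric_space "topspace T" d' using d'(1) by (simp add: compatible_bounded_metric_def)
  have dT: "d.mtopology = T" using d'(1) by (simp add: compatible_bounded_metric_def)
  note int = integrable_compatible_metric[OF T d'(1)]
  note meas = measurable_compatible_metric[OF T d'(1)]
  obtain \<A> where "countable \<A> \<and> \<A> \<subseteq> sets M \<and> (\<forall>B\<in>sets M. \<forall>e>0. \<exists>A\<in>\<A>. measure M (sym_diff A B) < e)"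
    using countable_dense_subalgebra[OF finite_measure_axioms M] by (rule exE)
  then have \<A>: "countable \<A>" "\<A> \<subseteq> sets M" "\<And>B e. B \<in> sets M \<Longrightarrow> e > 0 \<Longrightarrow> \<exists>A\<in>\<A>. measure M (sym_diff A B) < e"
    by simp_all
  obtain C where C: "countable C" "C \<subseteq> topspace T" "T closure_of C = topspace T"
    using T by (auto simp: polish_topology_def separable_space_def)
  show ?thesis
  proof (cases "C = {}")
    case True
    then have "topspace T = {}" using C by simp
    then have "measurable M (borel_of T) = {}" using not_empty by (auto simp: measurable_def)
    then have "L0 M (borel_of T) = {}" by (simp add: L0_def)
    then show ?thesis
      unfolding separable_space_def topspace_L0_topology[OF T d] by (intro exI[of _ "{}"]) auto
  next
    case False
    then obtain c where c: "c \<in> C" by blast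
    define g where "g = from_nat_into C"
    have g: "range g = C" unfolding g_def using C False by (intro range_from_nat_into)
    have gT: "g i \<in> topspace T" for i using g C by blast
    define Q where "Q = (\<lambda>l. ae_class M (borel_of T) (select c l)) ` lists (\<A> \<times> C)"
    have cT: "c \<in> topspace T" using c C by blast
    have sel: "select c l \<in> measurable M (borel_of T)" if "l \<in> lists (\<A> \<times> C)" for l
      using that \<A>(2) C(2) by (intro select_measurable cT) auto
    have QL: "Q \<subseteq> L0 M (borel_of T)" unfolding Q_def using sel by (auto intro: ae_class_in_L0)
    have "\<exists>q\<in>Q. L0_dist M d' F q < e" if F: "F \<in> L0 M (borel_of T)" and e: "e > 0" for F and e :: real
    proof -
      define f where "f = rep F"
      have f: "f \<in> measurable M (borel_of T)" unfolding f_def by (rule rep_L0(1)[OF F])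
      have fT: "f x \<in> topspace T" if "x \<in> space M" for x using measurable_space[OF f that] by simp
      define B where "B i = {x \<in> space M. d' (f x) (g i) < e / 4}" for i
      have B: "B i \<in> sets M" for i
        unfolding B_def using meas[OF f measurable_const[of "g i" "borel_of T"]] gT by simp
      have cov: "(\<Union>n. \<Union>i\<in>{..<n}. B i) = space M"
      proof
        show "space M \<subseteq> (\<Union>n. \<Union>i\<in>{..<n}. B i)"
        proof
          fix x assume x: "x \<in> space M"
          then have "f x \<in> d.mtopology closure_of C" using C(3) fT dT by simp
          then obtain y where "y \<in> C" "y \<in> d.mball (f x) (e/4)"
            using e unfolding d.metric_closure_of
          by (elim CollectE conjE allE[where x = "e/4"]) auto
          then obtain i where "d' (f x) (g i) < e / 4" using g by (metis d.in_mball imageE)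
          then have "x \<in> (\<Union>j\<in>{..<Suc i}. B j)" using x by (auto simp: B_def)
          then show "x \<in> (\<Union>n. \<Union>i\<in>{..<n}. B i)" by blast
        qed
      qed (auto simp: B_def)
      have "(\<lambda>n. measure M (\<Union>i\<in>{..<n}. B i)) \<longlonglongrightarrow> measure M (\<Union>n. \<Union>i\<in>{..<n}. B i)"
      proof (rule finite_Lim_measure_incseq)
        show "range (\<lambda>n. \<Union>i\<in>{..<n}. B i) \<subseteq> sets M" using B by auto
        show "incseq (\<lambda>n. \<Union>i\<in>{..<n}. B i)" unfolding incseq_def by (intro allI impI UN_mono) auto
      qed
      then have "eventually (\<lambda>n. measure M (\<Union>i\<in>{..<n}. B i) > 1 - e / 4) sequentially"
        using e unfolding cov prob_space by (intro order_tendstoD(1)) auto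
      then obtain n where n: "measure M (\<Union>i\<in>{..<n}. B i) > 1 - e / 4" by (auto simp: eventually_sequentially)
      \<comment> \<open>The denominator is chosen so that the errors over the \<open>n\<close> sets
        used below add up to at most \<open>e / 4\<close>; the \<open>+ 1\<close> avoids division by
        zero.\<close>
      have "\<exists>A\<in>\<A>. measure M (sym_diff A (B i)) < e / (4 * (real n + 1))" for i
        using e by (intro \<A>(3) B) auto
      then obtain A where A: "\<And>i. A i \<in> \<A>" "\<And>i. measure M (sym_diff (A i) (B i)) < e / (4 * (real n + 1))" by metis
      define l where "l = map (\<lambda>i. (A i, g i)) [0..<n]"
      have l: "l \<in> lists (\<A> \<times> C)" using A(1) g by (auto simp: l_def)
      \<comment> \<open>Off \<open>bad\<close> the sets \<open>A i\<close> and \<open>B i\<close>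
        agree for \<open>i < n\<close> and at least one of them contains the point. Any pair picked
        by \<open>select\<close> then has a value within \<open>e / 4\<close> of
        \<open>f x\<close>.\<close>
      define bad where "bad = (\<Union>i\<in>{..<n}. sym_diff (A i) (B i)) \<union> (space M - (\<Union>i\<in>{..<n}. B i))"
      have sdM: "sym_diff (A i) (B i) \<in> sets M" for i using A(1)[of i] \<A>(2) B[of i] by auto
      have bad1: "(\<Union>i\<in>{..<n}. sym_diff (A i) (B i)) \<in> sets M"
        by (rule sets.finite_UN) (use sdM in blast)+
      have bad2: "space M - (\<Union>i\<in>{..<n}. B i) \<in> sets M"
        using B by (intro sets.compl_sets sets.finite_UN) auto
      have bad: "bad \<in> sets M" unfolding bad_def by (rule sets.Un[OF bad1 bad2])
      have "measure M bad \<le> measure M (\<Union>i\<in>{..<n}. sym_diff (A i) (B i)) + measure M (space M - (\<Union>i\<in>{..<n}. B i))"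
        unfolding bad_def by (rule measure_Un_le[OF bad1 bad2])
      also have "measure M (space M - (\<Union>i\<in>{..<n}. B i)) = 1 - measure M (\<Union>i\<in>{..<n}. B i)"
        using B by (intro prob_compl) auto
      also have "measure M (\<Union>i\<in>{..<n}. sym_diff (A i) (B i)) \<le> (\<Sum>i<n. measure M (sym_diff (A i) (B i)))"
        using sdM by (intro finite_measure_subadditive_finite) auto
      also have "\<dots> \<le> (\<Sum>i<n. e / (4 * (real n + 1)))" using A(2) by (intro sum_mono less_imp_le)
      also have "\<dots> \<le> e / 4" using e by (simp add: field_simps)
      finally have bad_small: "measure M bad < e / 2" using n by linarith
      \<comment> \<open>On \<open>bad\<close> only the bound \<open>1\<close> of the metric is
        available. The integral is therefore at most \<open>e / 4\<close> plus the measure of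
        \<open>bad\<close>, and this sum is below \<open>3 e / 4\<close>.\<close>
      have pt: "d' (f x) (select c l x) \<le> e / 4 + indicator bad x" if x: "x \<in> space M" for x
      proof (cases "x \<in> bad")
        case True
        then show ?thesis using d'(2)[of "f x" "select c l x"] e by simp
      next
        case False
        then have AB: "\<And>i. i < n \<Longrightarrow> x \<in> A i \<longleftrightarrow> x \<in> B i" and "\<exists>i<n. x \<in> B i"
          using x unfolding bad_def by auto
        then have "\<exists>p\<in>set l. x \<in> fst p" by (auto simp: l_def)
        then obtain i where "i < n" "x \<in> A i" "select c l x = g i"
          using select_in[of l x c] by (auto simp: l_def)
        then show ?thesis using AB False by (auto simp: B_def)
      qed
      have "L0_dist M d' F (ae_class M (borel_of T) (select c l)) = (\<integral>x. d' (f x) (select c l x) \<partial>M)"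
        unfolding L0_dist_def f_def[symmetric]
      proof (rule integral_cong_AE)
        show "AE x in M. d' (f x) (rep (ae_class M (borel_of T) (select c l)) x) = d' (f x) (select c l x)"
          using rep_ae_class(2)[OF sel[OF l]] by eventually_elim simp
      qed (intro meas f sel[OF l] rep_ae_class(1))+
      also have "\<dots> \<le> (\<integral>x. e / 4 + indicator bad x \<partial>M)"
        using pt bad by (intro integral_mono int f sel[OF l]) (auto intro!: Bochner_Integration.integrable_add integrable_real_indicator simp: emeasure_eq_measure)
      also have "\<dots> = e / 4 + measure M bad"
        using bad by (subst Bochner_Integration.integral_add) (auto simp: prob_space emeasure_eq_measure)
      finally have "L0_dist M d' F (ae_class M (borel_of T) (select c l)) < e" using bad_small e by linarith
      then show ?thesis using l unfolding Q_def by blast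
    qed
    then have "L.mtopology closure_of Q = L0 M (borel_of T)"
      unfolding L.metric_closure_of L.in_mball using QL by blast
    moreover have "countable Q" unfolding Q_def using \<A> C by auto
    ultimately show ?thesis
      unfolding L0_topology_independent[OF T d d'(1)] unfolding separable_space_def L0_topology_def
      using QL by (intro exI[of _ Q]) simp
  qed
qed

lemma second_countable_L0:
  assumes "second_countable X" "sets M = sets (borel_of X)"
    and "polish_topology T" and "compatible_bounded_metric T d"
  shows "second_countable (L0_topology M T d)"
  using separable_L0[OF assms] completely_metrizable_L0[OF assms(3,4)]
  by (simp add: completely_metrizable_imp_metrizable_space metrizable_separable_imp_second_countable)

end

subsection \<open>Measure-preserving maps\<close>

text \<open>Bijectivity is left out on purpose: this weaker property survives limits in measure,
  whereas invertibility may be lost.\<close>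

definition mp_map :: "'x measure \<Rightarrow> ('x \<Rightarrow> 'x) \<Rightarrow> bool" where
  "mp_map M S \<longleftrightarrow> S \<in> measurable M M \<and> distr M M S = M"

lemma mp_mapD: "mp_map M S \<Longrightarrow> S \<in> measurable M M" "mp_map M S \<Longrightarrow> distr M M S = M"
  by (auto simp: mp_map_def)

lemma mp_bijections_mp_map: "T \<in> mp_bijections M \<Longrightarrow> mp_map M T"
  by (auto simp: mp_bijections_def mp_map_def)

lemma mp_map_measure:
  assumes "mp_map M S" "A \<in> sets M"
  shows "measure M {x \<in> space M. S x \<in> A} = measure M A"
proof -
  have "measure M A = measure (distr M M S) A" using assms by (simp add: mp_map_def)
  also have "\<dots> = measure M (S -` A \<inter> space M)" using assms by (intro measure_distr) (auto simp: mp_map_def)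
  also have "S -` A \<inter> space M = {x \<in> space M. S x \<in> A}" by auto
  finally show ?thesis by simp
qed

lemma mp_map_AE:
  assumes "mp_map M S" "AE x in M. P x"
  shows "AE x in M. P (S x)"
  by (rule AE_distrD[OF mp_mapD(1)[OF assms(1)]], subst mp_mapD(2)[OF assms(1)], rule assms(2))

lemma mp_map_compose: "mp_map M S \<Longrightarrow> mp_map M T \<Longrightarrow> mp_map M (S \<circ> T)"
  by (auto simp: mp_map_def distr_distr[symmetric] measurable_comp)

lemma mp_map_cong_AE:
  assumes "mp_map M T" "S \<in> measurable M M" "AE x in M. S x = T x"
  shows "mp_map M S"
  using assms distr_cong_AE[of M M M M S T] by (auto simp: mp_map_def)

lemma mp_bijections_id: "(\<lambda>x. x) \<in> mp_bijections M"
  by (auto simp: mp_bijections_def distr_id2 bij_betw_def inj_on_def)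

lemma mp_bijections_compose:
  "S \<in> mp_bijections M \<Longrightarrow> T \<in> mp_bijections M \<Longrightarrow> S \<circ> T \<in> mp_bijections M"
  using mp_map_compose[of M S T] by (auto simp: mp_bijections_def mp_map_def intro: bij_betw_trans)

text \<open>Preimages under the inverse are images under \<open>T\<close>, and these are Borel by
  the Lusin-Souslin theorem.\<close>

lemma mp_bijections_inv:
  assumes M: "standard_borel M" and T: "T \<in> mp_bijections M"
  shows "the_inv_into (space M) T \<in> mp_bijections M"
    "\<And>x. x \<in> space M \<Longrightarrow> the_inv_into (space M) T (T x) = x"
    "\<And>x. x \<in> space M \<Longrightarrow> T (the_inv_into (space M) T x) = x"
proof -
  define S where "S = the_inv_into (space M) T"
  have bij: "bij_betw T (space M) (space M)" and Tm: "T \<in> measurable M M" using T by (auto simp: mp_bijections_def)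
  then have inj: "inj_on T (space M)" by (auto simp: bij_betw_def)
  show inv1: "the_inv_into (space M) T (T x) = x" if "x \<in> space M" for x
    using inj that by (rule the_inv_into_f_f)
  show inv2: "T (the_inv_into (space M) T x) = x" if "x \<in> space M" for x
    using bij that by (metis bij_betw_def f_the_inv_into_f)
  have bijS: "bij_betw S (space M) (space M)" unfolding S_def by (rule bij_betw_the_inv_into[OF bij])
  have pre: "S -` A \<inter> space M = T ` A" if A: "A \<in> sets M" for A
  proof
    show "S -` A \<inter> space M \<subseteq> T ` A"
    proof
      fix x assume "x \<in> S -` A \<inter> space M"
      then have "T (S x) = x" "S x \<in> A" using inv2 by (auto simp: S_def)
      then show "x \<in> T ` A" by (metis imageI)
    qed
    show "T ` A \<subseteq> S -` A \<inter> space M"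
      using sets.sets_into_space[OF A] inv1 measurable_space[OF Tm] by (auto simp: S_def subset_iff)
  qed
  have Sm: "S \<in> measurable M M"
  proof (rule measurableI)
    show "S x \<in> space M" if "x \<in> space M" for x using bijS that by (auto simp: bij_betw_def)
    show "S -` A \<inter> space M \<in> sets M" if "A \<in> sets M" for A
      unfolding pre[OF that] by (rule standard_borel_bij_image[OF M Tm bij that])
  qed
  have "distr M M S = M"
  proof (rule measure_eqI)
    fix A assume "A \<in> sets (distr M M S)"
    then have A: "A \<in> sets M" by simp
    have TA: "T ` A \<in> sets M" by (rule standard_borel_bij_image[OF M Tm bij A])
    have "emeasure (distr M M S) A = emeasure M (T ` A)" using A Sm pre by (simp add: emeasure_distr)
    also have "\<dots> = emeasure (distr M M T) (T ` A)" using T by (simp add: mp_bijections_def)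
    also have "\<dots> = emeasure M (T -` T ` A \<inter> space M)" using TA Tm by (simp add: emeasure_distr)
    also have "T -` T ` A \<inter> space M = A"
      using inj sets.sets_into_space[OF A] by (auto simp: inj_on_def subset_iff)
    finally show "emeasure (distr M M S) A = emeasure M A" .
  qed simp
  then show "the_inv_into (space M) T \<in> mp_bijections M"
    using bijS Sm by (simp add: mp_bijections_def S_def)
qed

text \<open>The weak topology phrased with preimages, which are meaningful for representatives that
  are not bijective. The one-sided difference suffices for measure-preserving maps by
  \<open>exceptional_set_sym\<close>; \<open>image_tendsto\<close> recovers the formulation with
  images.\<close>

definition weakly_converges :: "'x measure \<Rightarrow> (nat \<Rightarrow> 'x \<Rightarrow> 'x) \<Rightarrow> ('x \<Rightarrow> 'x) \<Rightarrow> bool" where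
  "weakly_converges M F S \<longleftrightarrow>
     (\<forall>A\<in>sets M. (\<lambda>n. measure M {x \<in> space M. S x \<in> A \<and> F n x \<notin> A}) \<longlonglongrightarrow> 0)"

lemma measurable_eq_borel_of:
  "sets M = sets (borel_of T) \<Longrightarrow> measurable N M = measurable N (borel_of T)"
  by (rule measurable_cong_sets) auto

lemma sets_Collect_eq_borel_of:
  assumes T: "polish_topology T" and f: "f \<in> measurable M (borel_of T)" "g \<in> measurable M (borel_of T)"
  shows "{x \<in> space M. f x = g x} \<in> sets M"
proof -
  obtain d where d: "compatible_bounded_metric T d" using polish_bounded_complete_metric[OF T] by blast
  interpret d: Metric_space "topspace T" d using d by (simp add: compatible_bounded_metric_def)
  have "{x \<in> space M. f x = g x} = {x \<in> space M. d (f x) (g x) = 0}"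
    using measurable_space[OF f(1)] measurable_space[OF f(2)] by auto
  also have "\<dots> \<in> sets M" using measurable_compatible_metric[OF T d f] by simp
  finally show ?thesis .
qed

context prob_space
begin

lemma exceptional_set_sets:
  assumes "S \<in> measurable M M" "T \<in> measurable M M" "A \<in> sets M"
  shows "{x \<in> space M. S x \<in> A \<and> T x \<notin> A} \<in> sets M"
proof -
  have "{x \<in> space M. S x \<in> A \<and> T x \<notin> A} = (S -` A \<inter> space M) - (T -` A \<inter> space M)" by auto
  then show ?thesis using assms by (auto intro: measurable_sets)
qed

text \<open>Both preimages have the measure of \<open>A\<close>, so removing their common part
  leaves equal amounts. This is what makes convergence on a set pass to its complement.\<close>

lemma exceptional_set_sym:
  assumes S: "mp_map M S" and T: "mp_map M T" and A: "A \<in> sets M"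
  shows "measure M {x \<in> space M. S x \<in> A \<and> T x \<notin> A} = measure M {x \<in> space M. T x \<in> A \<and> S x \<notin> A}"
proof -
  have Sm: "S -` A \<inter> space M \<in> sets M" and Tm: "T -` A \<inter> space M \<in> sets M"
    using mp_mapD(1)[OF S] mp_mapD(1)[OF T] A by (auto intro: measurable_sets)
  have "measure M ((S -` A \<inter> space M) - (T -` A \<inter> space M)) =
      measure M (S -` A \<inter> space M) - measure M ((S -` A \<inter> space M) \<inter> (T -` A \<inter> space M))"
    using Sm Tm by (intro finite_measure_Diff')
  moreover have "measure M ((T -` A \<inter> space M) - (S -` A \<inter> space M)) =
      measure M (T -` A \<inter> space M) - measure M ((T -` A \<inter> space M) \<inter> (S -` A \<inter> space M))"
    using Sm Tm by (intro finite_measure_Diff')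
  moreover have "S -` A \<inter> space M = {x \<in> space M. S x \<in> A}" "T -` A \<inter> space M = {x \<in> space M. T x \<in> A}" by auto
  then have "measure M (S -` A \<inter> space M) = measure M (T -` A \<inter> space M)"
    using mp_map_measure[OF S A] mp_map_measure[OF T A] by simp
  ultimately have "measure M ((S -` A \<inter> space M) - (T -` A \<inter> space M)) = measure M ((T -` A \<inter> space M) - (S -` A \<inter> space M))"
    by (simp add: Int_commute)
  moreover have "(S -` A \<inter> space M) - (T -` A \<inter> space M) = {x \<in> space M. S x \<in> A \<and> T x \<notin> A}"
    "(T -` A \<inter> space M) - (S -` A \<inter> space M) = {x \<in> space M. T x \<in> A \<and> S x \<notin> A}" by auto
  ultimately show ?thesis by simp
qed

text \<open>For measure-preserving maps it suffices to check convergence on a generating family; countable unions are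
  approximated by finite ones uniformly in \<open>n\<close> because every \<open>F n\<close> preserves the measure.\<close>

lemma weakly_converges_generated:
  assumes F: "\<And>n. mp_map M (F n)" and S: "mp_map M S"
    and gen: "sets M = sigma_sets (space M) \<D>"
    and lim: "\<And>A. A \<in> \<D> \<Longrightarrow> (\<lambda>n. measure M {x \<in> space M. S x \<in> A \<and> F n x \<notin> A}) \<longlonglongrightarrow> 0"
  shows "weakly_converges M F S"
  unfolding weakly_converges_def
proof
  fix A assume "A \<in> sets M"
  then have "A \<in> sigma_sets (space M) \<D>" by (simp add: gen)
  then show "(\<lambda>n. measure M {x \<in> space M. S x \<in> A \<and> F n x \<notin> A}) \<longlonglongrightarrow> 0"
  proof induction
    case (Compl A)
    then have A: "A \<in> sets M" by (simp add: gen)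
    have "{x \<in> space M. S x \<in> space M - A \<and> F n x \<notin> space M - A} = {x \<in> space M. F n x \<in> A \<and> S x \<notin> A}" for n
      using measurable_space[OF mp_mapD(1)[OF S]] measurable_space[OF mp_mapD(1)[OF F]] by auto
    then show ?case using Compl.IH exceptional_set_sym[OF F S A] by simp
  next
    case (Union A)
    then have A: "A i \<in> sets M" for i by (simp add: gen)
    show ?case
    proof (rule tendstoI)
      fix e :: real assume e: "e > 0"
      define D where "D m = (\<Union>i\<in>{..m}. A i)" for m
      have D: "D m \<in> sets M" for m unfolding D_def using A by auto
      have U: "(\<Union>i. A i) \<in> sets M" using A by auto
      have "(\<lambda>m. measure M (D m)) \<longlonglongrightarrow> measure M (\<Union>m. D m)"
      proof (rule finite_Lim_measure_incseq)
        show "incseq D" unfolding incseq_def D_def by (intro allI impI UN_mono) auto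
      qed (use D in auto)
      also have "(\<Union>m. D m) = (\<Union>i. A i)" by (auto simp: D_def)
      finally have "eventually (\<lambda>m. measure M (D m) > measure M (\<Union>i. A i) - e / 2) sequentially"
        using e by (intro order_tendstoD(1)) auto
      then obtain m where m: "measure M (D m) > measure M (\<Union>i. A i) - e / 2" by (auto simp: eventually_sequentially)
      have "measure M ((\<Union>i. A i) - D m) = measure M (\<Union>i. A i) - measure M (D m)"
        using U D by (intro finite_measure_Diff) (auto simp: D_def)
      then have small: "measure M ((\<Union>i. A i) - D m) < e / 2" using m by simp
      have "(\<lambda>n. \<Sum>i\<le>m. measure M {x \<in> space M. S x \<in> A i \<and> F n x \<notin> A i}) \<longlonglongrightarrow> 0"
        using Union.IH by (intro tendsto_null_sum)
      then have "eventually (\<lambda>n. (\<Sum>i\<le>m. measure M {x \<in> space M. S x \<in> A i \<and> F n x \<notin> A i}) < e / 2) sequentially"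
        using e by (intro order_tendstoD(2)) auto
      then show "\<forall>\<^sub>F n in sequentially. dist (measure M {x \<in> space M. S x \<in> (\<Union>i. A i) \<and> F n x \<notin> (\<Union>i. A i)}) 0 < e"
      proof eventually_elim
        case (elim n)
        have E: "{x \<in> space M. S x \<in> A i \<and> F n x \<notin> A i} \<in> sets M" for i
          by (intro exceptional_set_sets A mp_mapD S F)
        have R: "{x \<in> space M. S x \<in> (\<Union>i. A i) - D m} \<in> sets M"
          using measurable_sets[OF mp_mapD(1)[OF S] sets.Diff[OF U D[of m]]] by (simp add: vimage_def Int_def conj_commute)
        have "measure M {x \<in> space M. S x \<in> (\<Union>i. A i) \<and> F n x \<notin> (\<Union>i. A i)} \<le>
            measure M ({x \<in> space M. S x \<in> (\<Union>i. A i) - D m} \<union> (\<Union>i\<in>{..m}. {x \<in> space M. S x \<in> A i \<and> F n x \<notin> A i}))"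
          using E R by (intro finite_measure_mono sets.Un sets.finite_UN) (auto simp: D_def)
        also have "\<dots> \<le> measure M {x \<in> space M. S x \<in> (\<Union>i. A i) - D m} +
            measure M (\<Union>i\<in>{..m}. {x \<in> space M. S x \<in> A i \<and> F n x \<notin> A i})"
          using E R by (intro measure_Un_le sets.finite_UN) auto
        also have "measure M {x \<in> space M. S x \<in> (\<Union>i. A i) - D m} = measure M ((\<Union>i. A i) - D m)"
          by (rule mp_map_measure[OF S sets.Diff[OF U D]])
        also have "measure M (\<Union>i\<in>{..m}. {x \<in> space M. S x \<in> A i \<and> F n x \<notin> A i}) \<le>
            (\<Sum>i\<le>m. measure M {x \<in> space M. S x \<in> A i \<and> F n x \<notin> A i})"
          using E by (intro finite_measure_subadditive_finite) auto
        finally show ?case using elim small by (simp add: dist_real_def)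
      qed
    qed
  qed (use lim in auto)
qed

lemma weakly_converges_sym:
  assumes F: "\<And>n. mp_map M (F n)" and S: "mp_map M S" and "weakly_converges M F S" and A: "A \<in> sets M"
  shows "(\<lambda>n. measure M {x \<in> space M. F n x \<in> A \<and> S x \<notin> A}) \<longlonglongrightarrow> 0"
  using assms(3) A exceptional_set_sym[OF F S A] unfolding weakly_converges_def by simp

text \<open>The test sets are preimages of open sets under \<open>f\<close>, which are merely Borel;
  this is why weak convergence has to be available on all Borel sets and not just on open
  ones.\<close>

lemma weakly_converges_imp_conv_in_measure:
  assumes w: "weakly_converges M F S" and F: "\<And>n. F n \<in> measurable M M" and S: "S \<in> measurable M M"
    and f: "f \<in> measurable M (borel_of T)"
  shows "conv_in_measure M T (\<lambda>n x. f (F n x)) (\<lambda>x. f (S x))"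
  unfolding conv_in_measure_def
proof (intro allI impI)
  fix U assume U: "openin T U"
  have A: "f -` U \<inter> space M \<in> sets M" by (rule measurable_sets[OF f borel_of_open[OF U]])
  have eq: "{x \<in> space M. f (S x) \<in> U \<and> f (F n x) \<notin> U} = {x \<in> space M. S x \<in> f -` U \<inter> space M \<and> F n x \<notin> f -` U \<inter> space M}" for n
    using measurable_space[OF F] measurable_space[OF S] by auto
  show "(\<lambda>n. measure M {x \<in> space M. f (S x) \<in> U \<and> f (F n x) \<notin> U}) \<longlonglongrightarrow> 0"
    unfolding eq using w A unfolding weakly_converges_def by blast
qed

text \<open>Triangle inequality through \<open>h (F n x)\<close>. The first integral equals the
  distance of \<open>H n\<close> and \<open>h\<close> because \<open>F n\<close> preserves the
  measure; the second tends to zero by weak convergence applied to the single map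
  \<open>h\<close>.\<close>

lemma conv_in_measure_compose:
  assumes T: "polish_topology T"
    and H: "\<And>n. H n \<in> measurable M (borel_of T)" and h: "h \<in> measurable M (borel_of T)" and conv: "conv_in_measure M T H h"
    and F: "\<And>n. mp_map M (F n)" and S: "S \<in> measurable M M" and w: "weakly_converges M F S"
  shows "conv_in_measure M T (\<lambda>n x. H n (F n x)) (\<lambda>x. h (S x))"
proof -
  obtain d where d: "compatible_bounded_metric T d" using polish_bounded_complete_metric[OF T] by blast
  interpret d: Metric_space "topspace T" d using d by (simp add: compatible_bounded_metric_def)
  note Fm = mp_mapD(1)[OF F]
  note m1 = measurable_compose[OF Fm H] and m2 = measurable_compose[OF Fm h] and m3 = measurable_compose[OF S h]
  note int = integrable_compatible_metric[OF T d]
  have "(\<lambda>n. \<integral>x. d (H n x) (h x) \<partial>M) \<longlonglongrightarrow> 0"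
    using conv conv_in_measure_iff_integral[OF T d H h] by simp
  moreover have "(\<integral>x. d (H n (F n x)) (h (F n x)) \<partial>M) = (\<integral>x. d (H n x) (h x) \<partial>M)" for n
    using integral_distr[OF Fm measurable_compatible_metric[OF T d H h], of n n] mp_mapD(2)[OF F] by simp
  ultimately have "(\<lambda>n. \<integral>x. d (H n (F n x)) (h (F n x)) \<partial>M) \<longlonglongrightarrow> 0" by simp
  moreover have "(\<lambda>n. \<integral>x. d (h (F n x)) (h (S x)) \<partial>M) \<longlonglongrightarrow> 0"
    using weakly_converges_imp_conv_in_measure[OF w Fm S h] conv_in_measure_iff_integral[OF T d m2 m3] by simp
  ultimately have sum: "(\<lambda>n. (\<integral>x. d (H n (F n x)) (h (F n x)) \<partial>M) + (\<integral>x. d (h (F n x)) (h (S x)) \<partial>M)) \<longlonglongrightarrow> 0"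
    using tendsto_add by fastforce
  have le: "(\<integral>x. d (H n (F n x)) (h (S x)) \<partial>M) \<le>
      (\<integral>x. d (H n (F n x)) (h (F n x)) \<partial>M) + (\<integral>x. d (h (F n x)) (h (S x)) \<partial>M)" for n
  proof -
    have "(\<integral>x. d (H n (F n x)) (h (S x)) \<partial>M) \<le> (\<integral>x. d (H n (F n x)) (h (F n x)) + d (h (F n x)) (h (S x)) \<partial>M)"
      using int[OF m1[of n n] m3] int[OF m1[of n n] m2[of n]] int[OF m2[of n] m3]
        measurable_space[OF m1[of n n]] measurable_space[OF m2[of n]] measurable_space[OF m3]
      by (intro integral_mono Bochner_Integration.integrable_add) (auto intro!: d.triangle)
    then show ?thesis using int[OF m1[of n n] m2[of n]] int[OF m2[of n] m3] by simp
  qed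
  have "(\<lambda>n. \<integral>x. d (H n (F n x)) (h (S x)) \<partial>M) \<longlonglongrightarrow> 0"
    by (rule tendsto_sandwich[OF _ _ tendsto_const sum]) (use le in \<open>auto intro!: always_eventually\<close>)
  then show ?thesis using conv_in_measure_iff_integral[OF T d m1 m3, of "\<lambda>n. n"] by simp
qed

text \<open>Change of variables by \<open>F n\<close>: the exceptional set of the inverses at
  \<open>A\<close> is pulled back to the set where \<open>F n x \<in> B\<close> and
  \<open>x \<notin> A\<close>, with \<open>B\<close> the preimage of \<open>A\<close> under
  \<open>S'\<close>. Almost everywhere \<open>x \<in> A\<close> means \<open>S x \<in> B\<close>, so
  this is a reversed exceptional set of \<open>F\<close> and \<open>S\<close> at
  \<open>B\<close>.\<close>

lemma weakly_converges_inverse: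
  assumes F: "\<And>n. mp_map M (F n)" "\<And>n. mp_map M (F' n)" "\<And>n. AE x in M. F' n (F n x) = x"
    and S: "mp_map M S" "mp_map M S'" "AE x in M. S' (S x) = x"
    and w: "weakly_converges M F S"
  shows "weakly_converges M F' S'"
  unfolding weakly_converges_def
proof
  fix A assume A: "A \<in> sets M"
  define B where "B = {x \<in> space M. S' x \<in> A}"
  have B: "B \<in> sets M"
    unfolding B_def using measurable_sets[OF mp_mapD(1)[OF S(2)] A] by (simp add: vimage_def Int_def conj_commute)
  have "measure M {x \<in> space M. S' x \<in> A \<and> F' n x \<notin> A} = measure M {x \<in> space M. F n x \<in> B \<and> S x \<notin> B}" for n
  proof -
    have E: "{x \<in> space M. S' x \<in> A \<and> F' n x \<notin> A} \<in> sets M"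
      by (intro exceptional_set_sets A mp_mapD S F)
    have "measure M {x \<in> space M. S' x \<in> A \<and> F' n x \<notin> A} =
        measure M {x \<in> space M. F n x \<in> {x \<in> space M. S' x \<in> A \<and> F' n x \<notin> A}}"
      by (rule mp_map_measure[OF F(1) E, symmetric])
    also have "\<dots> = measure M {x \<in> space M. F n x \<in> B \<and> S x \<notin> B}"
    proof (rule measure_eq_AE)
      show "AE x in M. x \<in> {x \<in> space M. F n x \<in> {x \<in> space M. S' x \<in> A \<and> F' n x \<notin> A}} \<longleftrightarrow>
          x \<in> {x \<in> space M. F n x \<in> B \<and> S x \<notin> B}"
        using F(3)[of n] S(3) AE_space
      proof eventually_elim
        case (elim x)
        then show ?case using measurable_space[OF mp_mapD(1)[OF S(1)]] by (auto simp: B_def)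
      qed
      show "{x \<in> space M. F n x \<in> {x \<in> space M. S' x \<in> A \<and> F' n x \<notin> A}} \<in> sets M"
        using measurable_sets[OF mp_mapD(1)[OF F(1)] E, of n] by (simp add: vimage_def Int_def conj_commute)
      show "{x \<in> space M. F n x \<in> B \<and> S x \<notin> B} \<in> sets M"
        by (intro exceptional_set_sets B mp_mapD S F)
    qed
    finally show ?thesis .
  qed
  then show "(\<lambda>n. measure M {x \<in> space M. S' x \<in> A \<and> F' n x \<notin> A}) \<longlonglongrightarrow> 0"
    using weakly_converges_sym[OF F(1) S(1) w B] by simp
qed

text \<open>The two notions differ only in testing open sets or all Borel sets; for
  measure-preserving maps convergence on the generating open sets extends.\<close>

lemma conv_in_measure_mp_iff:
  assumes T: "sets M = sets (borel_of T)" and F: "\<And>n. mp_map M (F n)" and S: "mp_map M S"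
  shows "conv_in_measure M T F S \<longleftrightarrow> weakly_converges M F S"
proof
  have spM: "space M = topspace T" using sets_eq_imp_space_eq[OF T] by simp
  show "weakly_converges M F S \<Longrightarrow> conv_in_measure M T F S"
    unfolding weakly_converges_def conv_in_measure_def T using borel_of_open by blast
  assume "conv_in_measure M T F S"
  then show "weakly_converges M F S"
    by (intro weakly_converges_generated[OF F S, of "{U. openin T U}"]) (auto simp: T spM sets_borel_of conv_in_measure_def)
qed

text \<open>The limit \<open>S\<close> satisfies \<open>\<mu>(S \<in> U) \<le> \<mu>(U)\<close> for open \<open>U\<close>, hence \<open>\<ge>\<close> for closed sets, and open sets are increasing
  unions of closed ones.\<close>

lemma mp_map_limit:
  assumes T: "polish_topology T" "sets M = sets (borel_of T)"
    and F: "\<And>n. mp_map M (F n)" and S: "S \<in> measurable M M" and conv: "conv_in_measure M T F S"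
  shows "mp_map M S"
proof -
  have spM: "space M = topspace T" using sets_eq_imp_space_eq[OF T(2)] by simp
  note MT = measurable_eq_borel_of[OF T(2)]
  have m: "{x \<in> space M. R x \<in> A} \<in> sets M" if "R \<in> measurable M M" "A \<in> sets M" for R A
    using measurable_sets[OF that] by (simp add: vimage_def Int_def conj_commute)
  have op: "measure M {x \<in> space M. S x \<in> U} \<le> measure M U" if U: "openin T U" for U
  proof -
    have UM: "U \<in> sets M" unfolding T(2) by (rule borel_of_open[OF U])
    have "measure M {x \<in> space M. S x \<in> U} \<le> measure M U + measure M {x \<in> space M. S x \<in> U \<and> F n x \<notin> U}" for n
    proof -
      have "measure M {x \<in> space M. S x \<in> U} \<le> measure M ({x \<in> space M. F n x \<in> U} \<union> {x \<in> space M. S x \<in> U \<and> F n x \<notin> U})"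
        using m[OF mp_mapD(1)[OF F] UM] exceptional_set_sets[OF S mp_mapD(1)[OF F] UM] by (intro finite_measure_mono) auto
      also have "\<dots> \<le> measure M {x \<in> space M. F n x \<in> U} + measure M {x \<in> space M. S x \<in> U \<and> F n x \<notin> U}"
        using m[OF mp_mapD(1)[OF F] UM] exceptional_set_sets[OF S mp_mapD(1)[OF F] UM] by (intro measure_Un_le) auto
      finally show ?thesis using mp_map_measure[OF F UM] by simp
    qed
    moreover have "(\<lambda>n. measure M U + measure M {x \<in> space M. S x \<in> U \<and> F n x \<notin> U}) \<longlonglongrightarrow> measure M U + 0"
      using conv U unfolding conv_in_measure_def by (intro tendsto_intros) auto
    ultimately show ?thesis using LIMSEQ_le_const by fastforce
  qed
  have cl: "measure M {x \<in> space M. S x \<in> C} \<ge> measure M C" if C: "closedin T C" for C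
  proof -
    have CM: "C \<in> sets M" unfolding T(2) by (rule borel_of_closed[OF C])
    have "measure M {x \<in> space M. S x \<in> space M - C} = 1 - measure M {x \<in> space M. S x \<in> C}"
    proof -
      have "{x \<in> space M. S x \<in> space M - C} = space M - {x \<in> space M. S x \<in> C}" using measurable_space[OF S] by auto
      then show ?thesis using prob_compl[OF m[OF S CM]] by simp
    qed
    moreover have "measure M (space M - C) = 1 - measure M C" by (rule prob_compl[OF CM])
    moreover have "openin T (space M - C)" unfolding spM using C by blast
    ultimately show ?thesis using op[of "space M - C"] by simp
  qed
  have eq: "measure M {x \<in> space M. S x \<in> U} = measure M U" if U: "openin T U" for U
  proof (rule antisym[OF op[OF U]])
    have "fsigma_in T U"
      using T(1) U by (intro open_imp_fsigma_in) (auto simp: polish_topology_def completely_metrizable_imp_metrizable_space)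
    then obtain C :: "nat \<Rightarrow> 'a set" where C: "\<And>n. closedin T (C n)" "\<And>n. C n \<subseteq> C (Suc n)" "\<Union>(range C) = U"
      by (auto simp: fsigma_in_ascending)
    have CM: "C n \<in> sets M" for n unfolding T(2) by (rule borel_of_closed[OF C(1)])
    have "(\<lambda>n. measure M (C n)) \<longlonglongrightarrow> measure M (\<Union>n. C n)"
      using CM C(2) by (intro finite_Lim_measure_incseq) (auto intro: incseq_SucI)
    moreover have "measure M (C n) \<le> measure M {x \<in> space M. S x \<in> U}" for n
    proof -
      have "measure M (C n) \<le> measure M {x \<in> space M. S x \<in> C n}" by (rule cl[OF C(1)])
      also have "\<dots> \<le> measure M {x \<in> space M. S x \<in> U}"
        using C(3) m[OF S] borel_of_open[OF U] T(2) by (intro finite_measure_mono) auto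
      finally show ?thesis .
    qed
    ultimately show "measure M U \<le> measure M {x \<in> space M. S x \<in> U}"
      using C(3) by (intro LIMSEQ_le_const2[of "\<lambda>n. measure M (C n)"]) auto
  qed
  have "distr M M S = M"
  proof (rule measure_eqI_generator_eq[where E = "{U. openin T U}" and \<Omega> = "space M" and A = "\<lambda>_. space M"])
    show "emeasure (distr M M S) U = emeasure M U" if "U \<in> {U. openin T U}" for U
    proof -
      have "U \<in> sets M" using that T(2) borel_of_open by auto
      moreover have "S -` U \<inter> space M = {x \<in> space M. S x \<in> U}" by auto
      ultimately show ?thesis using eq[of U] that S by (simp add: emeasure_distr emeasure_eq_measure)
    qed
    show "emeasure (distr M M S) (space M) \<noteq> \<infinity>" for i :: nat
      using S by (simp add: emeasure_distr emeasure_eq_measure)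
  qed (auto simp: Int_stable_def T(2) sets_borel_of spM dest: openin_subset)
  then show ?thesis using S by (simp add: mp_map_def)
qed

text \<open>Two almost everywhere inverse maps are modified to the identity outside a conull set invariant under both.\<close>

lemma mp_bijection_modification:
  assumes T: "polish_topology T" "sets M = sets (borel_of T)"
    and S: "mp_map M S" and S': "mp_map M S'"
    and inv: "AE x in M. S' (S x) = x" "AE x in M. S (S' x) = x"
  shows "\<exists>R\<in>mp_bijections M. AE x in M. S x = R x"
proof -
  note MT = measurable_eq_borel_of[OF T(2)]
  note Sm = mp_mapD(1)[OF S] and S'm = mp_mapD(1)[OF S']
  define Z where "Z = rec_nat {x \<in> space M. S' (S x) = x \<and> S (S' x) = x}
      (\<lambda>_ Z. Z \<inter> (S -` Z \<inter> space M) \<inter> (S' -` Z \<inter> space M))"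
  have Z: "Z 0 = {x \<in> space M. S' (S x) = x \<and> S (S' x) = x}"
    "Z (Suc n) = Z n \<inter> (S -` Z n \<inter> space M) \<inter> (S' -` Z n \<inter> space M)" for n
    by (simp_all add: Z_def)
  have eq: "{x \<in> space M. P x = x} \<in> sets M" if "P \<in> measurable M M" for P
    using that measurable_ident_sets[OF T(2)] by (intro sets_Collect_eq_borel_of[OF T(1)]) (simp_all add: MT)
  have "{x \<in> space M. S' (S x) = x} \<in> sets M" "{x \<in> space M. S (S' x) = x} \<in> sets M"
    using measurable_compose[OF Sm S'm] measurable_compose[OF S'm Sm] by (auto intro: eq)
  then have "{x \<in> space M. S' (S x) = x} \<inter> {x \<in> space M. S (S' x) = x} \<in> sets M" by (rule sets.Int)
  moreover have "{x \<in> space M. S' (S x) = x} \<inter> {x \<in> space M. S (S' x) = x} = Z 0" by (auto simp: Z)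
  ultimately have Z0: "Z 0 \<in> sets M" by simp
  have ZM: "Z n \<in> sets M" for n
  proof (induction n)
    case (Suc n)
    then show ?case unfolding Z by (intro sets.Int measurable_sets[OF Sm] measurable_sets[OF S'm])
  qed (rule Z0)
  have ZA: "AE x in M. x \<in> Z n" for n
  proof (induction n)
    case 0
    from inv AE_space show ?case by eventually_elim (simp add: Z)
  next
    case (Suc n)
    from Suc mp_map_AE[OF S Suc] mp_map_AE[OF S' Suc] AE_space show ?case by eventually_elim (simp add: Z)
  qed
  define W where "W = (\<Inter>n. Z n)"
  have WM: "W \<in> sets M" unfolding W_def using ZM by (intro sets.countable_INT') auto
  have WA: "AE x in M. x \<in> W" unfolding W_def using ZA by (simp add: AE_all_countable)
  have W_inv: "S x \<in> W" "S' x \<in> W" "S' (S x) = x" "S (S' x) = x" "x \<in> space M" if "x \<in> W" for x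
  proof -
    have *: "x \<in> Z n" for n using that by (simp add: W_def)
    have "S x \<in> Z n" "S' x \<in> Z n" for n using *[of "Suc n"] by (auto simp: Z)
    then show "S x \<in> W" "S' x \<in> W" by (auto simp: W_def)
    show "S' (S x) = x" "S (S' x) = x" "x \<in> space M" using *[of 0] by (auto simp: Z)
  qed
  define R where "R x = (if x \<in> W then S x else x)" for x
  have Rm: "R \<in> measurable M M" unfolding R_def using WM Sm by (intro measurable_If_set) auto
  have AER: "AE x in M. R x = S x" using WA by eventually_elim (simp add: R_def)
  have "bij_betw R (space M) (space M)"
  proof (rule bij_betw_byWitness[where f' = "\<lambda>x. if x \<in> W then S' x else x"])
    show "\<forall>a\<in>space M. (if R a \<in> W then S' (R a) else R a) = a"
      "\<forall>a\<in>space M. R (if a \<in> W then S' a else a) = a"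
      using W_inv by (auto simp: R_def)
    show "R ` space M \<subseteq> space M" "(\<lambda>x. if x \<in> W then S' x else x) ` space M \<subseteq> space M"
      using measurable_space[OF Sm] measurable_space[OF S'm] by (auto simp: R_def)
  qed
  moreover have "mp_map M R" by (rule mp_map_cong_AE[OF S Rm AER])
  ultimately have "R \<in> mp_bijections M" by (auto simp: mp_bijections_def mp_map_def)
  moreover have "AE x in M. S x = R x" using AER by eventually_elim simp
  ultimately show ?thesis by blast
qed

end

subsection \<open>The lifts of an orbit full group\<close>

text \<open>The metric \<open>d\<close> is the one in the statement and may be incomplete;
  \<open>dG\<close> and \<open>dX\<close> are complete compatible metrics used for the Cauchy
  arguments.\<close>

locale orbit_full = polish_borel_action G TG M \<phi> + prob_space M
  for G :: "('g, 'm) monoid_scheme" (structure) and TG :: "'g topology"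
    and M :: "'x measure" and \<phi> :: "'g \<Rightarrow> 'x \<Rightarrow> 'x" +
  fixes d dG :: "'g \<Rightarrow> 'g \<Rightarrow> real" and TX :: "'x topology" and dX :: "'x \<Rightarrow> 'x \<Rightarrow> real"
  assumes d: "compatible_bounded_metric TG d"
    and dG: "compatible_bounded_metric TG dG" "Metric_space.mcomplete (topspace TG) dG"
    and TX: "polish_topology TX" "topspace TX = space M" "sets M = sets (borel_of TX)"
    and dX: "compatible_bounded_metric TX dX" "Metric_space.mcomplete (topspace TX) dX"
begin

abbreviation BG :: "'g measure" where "BG \<equiv> borel_of TG"

lemma measurable_TX: "measurable N M = measurable N (borel_of TX)"
  by (rule measurable_eq_borel_of[OF TX(3)])

lemma ae_class_TX: "ae_class M M = ae_class M (borel_of TX)"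
  by (simp add: ae_class_def ae_rel_def measurable_TX fun_eq_iff)

abbreviation act :: "('x \<Rightarrow> 'g) \<Rightarrow> 'x \<Rightarrow> 'x" where "act f \<equiv> \<lambda>x. \<phi> (f x) x"

lemma BG_carrier: "f \<in> measurable M BG \<Longrightarrow> x \<in> space M \<Longrightarrow> f x \<in> carrier G"
  using measurable_space[of f M BG x] by (simp add: TG(2))

lemma act_measurable: "f \<in> measurable M BG \<Longrightarrow> act f \<in> measurable M M"
  using measurable_compose[OF measurable_Pair[of f M BG, OF _ measurable_ident_sets[OF refl]] action_measurable] by simp

lemma act_cong_AE: "AE x in M. f x = g x \<Longrightarrow> AE x in M. act f x = act g x"
  by (auto elim: eventually_mono)

text \<open>Membership of the class in \<open>Aut M\<close>, expressed for a single representative.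
  It is invariant under changes on null sets and stable under pointwise composition.\<close>

definition aut :: "('x \<Rightarrow> 'x) \<Rightarrow> bool" where
  "aut S \<longleftrightarrow> S \<in> measurable M M \<and> (\<exists>T\<in>mp_bijections M. AE x in M. S x = T x)"

definition aut_inv :: "('x \<Rightarrow> 'x) \<Rightarrow> 'x \<Rightarrow> 'x" where
  "aut_inv S = the_inv_into (space M) (SOME T. T \<in> mp_bijections M \<and> (AE x in M. S x = T x))"

lemma mp_bijections_aut: "T \<in> mp_bijections M \<Longrightarrow> aut T"
  by (auto simp: aut_def mp_bijections_def)

lemma aut_mp_map: "aut S \<Longrightarrow> mp_map M S"
  unfolding aut_def using mp_map_cong_AE mp_bijections_mp_map by metis

lemma aut_measurable: "aut S \<Longrightarrow> S \<in> measurable M M"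
  by (simp add: aut_def)

lemma aut_AE: "aut S \<Longrightarrow> AE x in M. P x \<Longrightarrow> AE x in M. P (S x)"
  by (rule mp_map_AE[OF aut_mp_map])

lemma aut_cong_AE: "aut T \<Longrightarrow> S \<in> measurable M M \<Longrightarrow> AE x in M. S x = T x \<Longrightarrow> aut S"
proof -
  assume "aut T" "S \<in> measurable M M" and ST: "AE x in M. S x = T x"
  then obtain R where R: "R \<in> mp_bijections M" "AE x in M. T x = R x" by (auto simp: aut_def)
  from ST R(2) have "AE x in M. S x = R x" by eventually_elim simp
  then show "aut S" using R(1) \<open>S \<in> measurable M M\<close> by (auto simp: aut_def)
qed

lemma aut_compose:
  assumes S: "aut S" and T: "aut T"
  shows "aut (\<lambda>x. S (T x))"
proof -
  obtain S' where S': "S' \<in> mp_bijections M" "AE x in M. S x = S' x" using S by (auto simp: aut_def)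
  obtain T' where T': "T' \<in> mp_bijections M" "AE x in M. T x = T' x" using T by (auto simp: aut_def)
  from aut_AE[OF T S'(2)] T'(2) have "AE x in M. S (T x) = (S' \<circ> T') x" by eventually_elim simp
  then show ?thesis
    using measurable_compose[OF aut_measurable[OF T] aut_measurable[OF S]] mp_bijections_compose[OF S'(1) T'(1)]
    unfolding aut_def by (intro conjI bexI[of _ "S' \<circ> T'"])
qed

lemma aut_inv:
  assumes S: "aut S"
  shows "aut (aut_inv S)" "AE x in M. aut_inv S (S x) = x" "AE x in M. S (aut_inv S x) = x"
proof -
  define T where "T = (SOME T. T \<in> mp_bijections M \<and> (AE x in M. S x = T x))"
  have T: "T \<in> mp_bijections M" "AE x in M. S x = T x"
    using S someI_ex[of "\<lambda>T. T \<in> mp_bijections M \<and> (AE x in M. S x = T x)"] unfolding T_def aut_def by blast+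
  have eq: "aut_inv S = the_inv_into (space M) T" by (simp add: aut_inv_def T_def)
  note inv = mp_bijections_inv[OF standard T(1)]
  show a: "aut (aut_inv S)" unfolding eq by (rule mp_bijections_aut[OF inv(1)])
  from T(2) AE_space show "AE x in M. aut_inv S (S x) = x"
    by eventually_elim (simp add: eq inv(2))
  from aut_AE[OF a T(2)] AE_space show "AE x in M. S (aut_inv S x) = x"
    by eventually_elim (simp add: eq inv(3))
qed

lemma Aut_iff: "C \<in> Aut M \<longleftrightarrow> C \<in> L0 M M \<and> aut (rep C)"
proof
  assume "C \<in> Aut M"
  then obtain T where T: "T \<in> mp_bijections M" "C = ae_class M M T" by (auto simp: Aut_def)
  then have "T \<in> measurable M M" by (simp add: mp_bijections_def)
  then show "C \<in> L0 M M \<and> aut (rep C)"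
    using T aut_cong_AE[OF mp_bijections_aut[OF T(1)]] rep_ae_class ae_class_in_L0 by blast
next
  assume C: "C \<in> L0 M M \<and> aut (rep C)"
  then obtain T where T: "T \<in> mp_bijections M" "AE x in M. rep C x = T x" by (auto simp: aut_def)
  then have "C = ae_class M M T"
    using C rep_L0[of C M M] ae_class_eq_iff[of "rep C" M M T] by (auto simp: mp_bijections_def)
  then show "C \<in> Aut M" using T by (auto simp: Aut_def)
qed

lemma ae_class_in_Aut_iff: "S \<in> measurable M M \<Longrightarrow> ae_class M M S \<in> Aut M \<longleftrightarrow> aut S"
proof -
  assume S: "S \<in> measurable M M"
  note r = rep_ae_class[OF S]
  from r(2) have "AE x in M. S x = rep (ae_class M M S) x" by eventually_elim simp
  then show ?thesis
    unfolding Aut_iff using r aut_cong_AE S ae_class_in_L0[OF S] by blast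
qed

section \<open>Lifts as functions and as classes; continuity of the action on lifts\<close>

definition lifts :: "('x \<Rightarrow> 'g) set" where
  "lifts = {f \<in> measurable M BG. aut (act f)}"

lemma lifts_measurable: "f \<in> lifts \<Longrightarrow> f \<in> measurable M BG"
  by (simp add: lifts_def)

lemma lifts_aut: "f \<in> lifts \<Longrightarrow> aut (act f)"
  by (simp add: lifts_def)

lemma Phi_ae_class:
  assumes f: "f \<in> measurable M BG"
  shows "Phi M \<phi> (ae_class M BG f) = ae_class M M (act f)"
proof -
  note r = rep_ae_class[OF f]
  show ?thesis unfolding Phi_def
    using ae_class_eq_iff[OF act_measurable[OF r(1)] act_measurable[OF f]] act_cong_AE[OF r(2)] by simp
qed

abbreviation lift_classes :: "('x \<Rightarrow> 'g) set set" where "lift_classes \<equiv> orbit_full_lift TG M \<phi>"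

lemma lift_classesE:
  assumes "F \<in> lift_classes"
  shows "rep F \<in> lifts" "F = ae_class M BG (rep F)" "F \<in> L0 M BG"
proof -
  show F: "F \<in> L0 M BG" using assms by (simp add: orbit_full_lift_def)
  show eq: "F = ae_class M BG (rep F)" using rep_L0(2)[OF F] by simp
  have "ae_class M M (act (rep F)) \<in> Aut M"
    using assms Phi_ae_class[OF rep_L0(1)[OF F]] eq by (simp add: orbit_full_lift_def)
  then show "rep F \<in> lifts"
    using rep_L0(1)[OF F] ae_class_in_Aut_iff[OF act_measurable] by (simp add: lifts_def)
qed

lemma ae_class_lift: "f \<in> lifts \<Longrightarrow> ae_class M BG f \<in> lift_classes"
  using ae_class_in_L0[of f M BG] Phi_ae_class[of f] ae_class_in_Aut_iff[OF act_measurable, of f]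
  by (simp add: lifts_def orbit_full_lift_def)

text \<open>Along an almost everywhere convergent subsequence, \<open>f n x\<close> eventually
  enters the open set \<open>hits D x\<close> once \<open>h x\<close> is in it. Openness along
  orbits thus replaces continuity of the action.\<close>

lemma conv_in_measure_orbit_open:
  assumes f: "\<And>n. f n \<in> measurable M BG" "h \<in> measurable M BG" and conv: "conv_in_measure M TG f h"
    and D: "D \<in> sets M" "\<And>x. x \<in> space M \<Longrightarrow> openin TG (hits D x)"
  shows "(\<lambda>n. measure M {x \<in> space M. act h x \<in> D \<and> act (f n) x \<notin> D}) \<longlonglongrightarrow> 0"
proof (rule measure_tendsto_0_subseq)
  show "{x \<in> space M. act h x \<in> D \<and> act (f n) x \<notin> D} \<in> sets M" for n
    by (intro exceptional_set_sets act_measurable f D(1))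
  fix r :: "nat \<Rightarrow> nat" assume "strict_mono r"
  then obtain s where s: "strict_mono s" "AE x in M. limitin TG (\<lambda>n. f (r (s n)) x) (h x) sequentially"
    using conv_in_measure_AE_subseq[OF TG(1) f conv_in_measure_subseq[OF conv]] by blast
  from s(2) AE_space
  have "AE x in M. eventually (\<lambda>n. x \<notin> {x \<in> space M. act h x \<in> D \<and> act (f (r (s n))) x \<notin> D}) sequentially"
  proof eventually_elim
    case (elim x)
    show ?case
    proof (cases "act h x \<in> D")
      case True
      then have "h x \<in> hits D x" using BG_carrier[OF f(2)] elim by (simp add: hits_def)
      then have "eventually (\<lambda>n. f (r (s n)) x \<in> hits D x) sequentially"
        using limitinD[OF elim(1) D(2)] elim(2) by blast
      then show ?thesis by eventually_elim (simp add: hits_def)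
    qed simp
  qed
  then show "\<exists>s. strict_mono s \<and>
      (AE x in M. eventually (\<lambda>n. x \<notin> {x \<in> space M. act h x \<in> D \<and> act (f (r (s n))) x \<notin> D}) sequentially)"
    using s(1) by blast
qed

text \<open>Although the action is only Borel, \<open>\<Phi>\<close> is continuous on lifts: convergence on orbit-open sets is automatic, and these
  generate the Borel sets.\<close>

lemma act_weakly_converges:
  assumes f: "\<And>n. f n \<in> lifts" and h: "h \<in> lifts" and conv: "conv_in_measure M TG f h"
  shows "weakly_converges M (\<lambda>n. act (f n)) (act h)"
proof -
  obtain D :: "nat \<Rightarrow> 'x set" where D: "\<And>n. D n \<in> sets M" "\<And>n x. x \<in> space M \<Longrightarrow> openin TG (hits (D n) x)"
    "\<And>x y. x \<in> space M \<Longrightarrow> y \<in> space M \<Longrightarrow> x \<noteq> y \<Longrightarrow> \<exists>n. x \<in> D n \<and> y \<notin> D n"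
    by (rule separating_orbit_open_family) blast
  have "sets M = sigma_sets (space M) (range D)"
    unfolding TX(3) TX(2)[symmetric]
    using D(1,3) TX by (intro separating_family_generates) (metis+)
  then show ?thesis
  proof (rule weakly_converges_generated[rotated 2])
    show "(\<lambda>n. measure M {x \<in> space M. act h x \<in> A \<and> act (f n) x \<notin> A}) \<longlonglongrightarrow> 0" if "A \<in> range D" for A
      using that conv_in_measure_orbit_open[OF lifts_measurable[OF f] lifts_measurable[OF h] conv] D(1,2) by auto
  qed (use f h lifts_aut aut_mp_map in auto)
qed

lemma act_conv_in_measure:
  assumes f: "\<And>n. f n \<in> lifts" and h: "h \<in> lifts" and conv: "conv_in_measure M TG f h"
  shows "conv_in_measure M TX (\<lambda>n. act (f n)) (act h)"
  using act_weakly_converges[OF assms] conv_in_measure_mp_iff[OF TX(3) aut_mp_map[OF lifts_aut[OF f]] aut_mp_map[OF lifts_aut[OF h]]]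
  by simp

lemma aut_inv_weakly_converges:
  assumes "\<And>n. aut (S n)" "aut R" "weakly_converges M S R"
  shows "weakly_converges M (\<lambda>n. aut_inv (S n)) (aut_inv R)"
  by (rule weakly_converges_inverse[where F = S and F' = "\<lambda>n. aut_inv (S n)" and S = R and S' = "aut_inv R",
        OF aut_mp_map[OF assms(1)] aut_mp_map[OF aut_inv(1)[OF assms(1)]] aut_inv(2)[OF assms(1)]
          aut_mp_map[OF assms(2)] aut_mp_map[OF aut_inv(1)[OF assms(2)]] aut_inv(2)[OF assms(2)] assms(3)])

lemma aut_inv_conv_in_measure:
  assumes "\<And>n. aut (S n)" "aut R" "weakly_converges M S R"
  shows "conv_in_measure M TX (\<lambda>n. aut_inv (S n)) (aut_inv R)"
  using aut_inv_weakly_converges[OF assms]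
    conv_in_measure_mp_iff[OF TX(3) aut_mp_map[OF aut_inv(1)[OF assms(1)]] aut_mp_map[OF aut_inv(1)[OF assms(2)]]]
  by simp

lemma lifts_closed:
  assumes f: "\<And>n. f n \<in> lifts" and h: "h \<in> measurable M BG" and conv: "conv_in_measure M TG f h"
    and S: "S \<in> measurable M M" "conv_in_measure M TX (\<lambda>n. act (f n)) S"
    and R: "R \<in> measurable M M" "conv_in_measure M TX (\<lambda>n. aut_inv (act (f n))) R"
  shows "h \<in> lifts"
proof -
  note a = lifts_aut[OF f]
  note fm = lifts_measurable[OF f]
  have mpS: "mp_map M S" by (rule mp_map_limit[OF TX(1,3) aut_mp_map[OF a] S])
  have mpR: "mp_map M R" by (rule mp_map_limit[OF TX(1,3) aut_mp_map[OF aut_inv(1)[OF a]] R])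
  have wS: "weakly_converges M (\<lambda>n. act (f n)) S"
    using conv_in_measure_mp_iff[OF TX(3) aut_mp_map[OF a] mpS] S(2) by simp
  have wR: "weakly_converges M (\<lambda>n. aut_inv (act (f n))) R"
    using conv_in_measure_mp_iff[OF TX(3) aut_mp_map[OF aut_inv(1)[OF a]] mpR] R(2) by simp
  \<comment> \<open>\<open>Q' n \<circ> P' n\<close> is the identity almost everywhere and converges
    in measure to \<open>Q \<circ> P\<close>; limits are unique. It is applied in both
    orders.\<close>
  have limit_id: "AE x in M. Q (P x) = x"
    if P: "\<And>n. aut (P' n)" "P \<in> measurable M M" "weakly_converges M P' P"
      and Q: "\<And>n. aut (Q' n)" "Q \<in> measurable M M" "conv_in_measure M TX Q' Q"
      and QP: "\<And>n. AE x in M. Q' n (P' n x) = x" for P' P Q' Q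
  proof -
    note Pm = aut_measurable[OF P(1)] and Qm = aut_measurable[OF Q(1)]
    have "conv_in_measure M TX (\<lambda>n x. Q' n (P' n x)) (\<lambda>x. Q (P x))"
      using Qm Q(2) by (intro conv_in_measure_compose[where H = Q' and h = Q and F = P' and S = P, OF TX(1) _ _ Q(3)
            aut_mp_map[OF P(1)] P(2,3)]) (simp_all add: measurable_TX)
    then have c: "conv_in_measure M TX (\<lambda>n x. x) (\<lambda>x. Q (P x))"
      using conv_in_measure_cong_AE[of "\<lambda>n x. Q' n (P' n x)" TX "\<lambda>x. Q (P x)" "\<lambda>n x. x" "\<lambda>x. Q (P x)"] QP
        measurable_compose[OF Pm Qm] measurable_compose[OF P(2) Q(2)] measurable_ident_sets[OF TX(3)]
      by (simp add: measurable_TX[symmetric])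
    have "conv_in_measure M TX (\<lambda>n x. x) (\<lambda>x. x)" by (simp add: conv_in_measure_def)
    then show ?thesis
      using conv_in_measure_unique[OF TX(1) _ _ c, of "\<lambda>x. x"] measurable_compose[OF P(2) Q(2)] measurable_ident_sets[OF TX(3)]
      by (simp add: measurable_TX[symmetric])
  qed
  have "AE x in M. R (S x) = x"
    by (rule limit_id[OF a S(1) wS aut_inv(1)[OF a] R aut_inv(2)[OF a]])
  moreover have "AE x in M. S (R x) = x"
    by (rule limit_id[OF aut_inv(1)[OF a] R(1) wR a S aut_inv(3)[OF a]])
  ultimately obtain T where T: "T \<in> mp_bijections M" "AE x in M. S x = T x"
    using mp_bijection_modification[OF TX(1,3) mpS mpR] by blast
  then have autS: "aut S" using S(1) by (auto simp: aut_def)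
  obtain D :: "nat \<Rightarrow> 'x set" where D: "\<And>n. D n \<in> sets M" "\<And>n x. x \<in> space M \<Longrightarrow> openin TG (hits (D n) x)"
    "\<And>x y. x \<in> space M \<Longrightarrow> y \<in> space M \<Longrightarrow> x \<noteq> y \<Longrightarrow> \<exists>n. x \<in> D n \<and> y \<notin> D n"
    by (rule separating_orbit_open_family) blast
  \<comment> \<open>Orbit-openness carries membership in \<open>D i\<close> from
    \<open>act h x\<close> to \<open>act (f n) x\<close>, and weak convergence carries it on to
    \<open>S x\<close>, each up to small measure. One inclusion is enough because \<open>D\<close>
    separates ordered pairs of points.\<close>
  have "AE x in M. act h x \<in> D i \<longrightarrow> S x \<in> D i" for i
  proof -
    have E: "{x \<in> space M. P x \<in> D i \<and> Q x \<notin> D i} \<in> sets M" if "P \<in> measurable M M" "Q \<in> measurable M M" for P Q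
      using that by (intro exceptional_set_sets D(1))
    have "measure M {x \<in> space M. act h x \<in> D i \<and> S x \<notin> D i} \<le>
        measure M {x \<in> space M. act h x \<in> D i \<and> act (f n) x \<notin> D i} +
        measure M {x \<in> space M. act (f n) x \<in> D i \<and> S x \<notin> D i}" for n
    proof -
      have "measure M {x \<in> space M. act h x \<in> D i \<and> S x \<notin> D i} \<le>
          measure M ({x \<in> space M. act h x \<in> D i \<and> act (f n) x \<notin> D i} \<union> {x \<in> space M. act (f n) x \<in> D i \<and> S x \<notin> D i})"
        using E[OF act_measurable[OF h] act_measurable[OF fm]] E[OF act_measurable[OF fm] S(1)]
        by (intro finite_measure_mono sets.Un) auto
      also have "\<dots> \<le> measure M {x \<in> space M. act h x \<in> D i \<and> act (f n) x \<notin> D i} +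
          measure M {x \<in> space M. act (f n) x \<in> D i \<and> S x \<notin> D i}"
        using E[OF act_measurable[OF h] act_measurable[OF fm]] E[OF act_measurable[OF fm] S(1)] by (intro measure_Un_le)
      finally show ?thesis .
    qed
    moreover have "(\<lambda>n. measure M {x \<in> space M. act h x \<in> D i \<and> act (f n) x \<notin> D i} +
        measure M {x \<in> space M. act (f n) x \<in> D i \<and> S x \<notin> D i}) \<longlonglongrightarrow> 0 + 0"
      using conv_in_measure_orbit_open[OF fm h conv D(1,2)] weakly_converges_sym[OF aut_mp_map[OF a] mpS wS D(1)]
      by (intro tendsto_add)
    ultimately have "measure M {x \<in> space M. act h x \<in> D i \<and> S x \<notin> D i} \<le> 0"
      using LIMSEQ_le_const by fastforce
    then have "measure M {x \<in> space M. act h x \<in> D i \<and> S x \<notin> D i} = 0" by (simp add: measure_le_0_iff)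
    then have "{x \<in> space M. act h x \<in> D i \<and> S x \<notin> D i} \<in> null_sets M"
      using E[OF act_measurable[OF h] S(1)] by (simp add: null_sets_def emeasure_eq_measure)
    from AE_not_in[OF this] AE_space show ?thesis by eventually_elim auto
  qed
  then have "AE x in M. \<forall>i. act h x \<in> D i \<longrightarrow> S x \<in> D i" by (simp add: AE_all_countable)
  then have "AE x in M. act h x = S x"
    using AE_space
  proof eventually_elim
    case (elim x)
    then show ?case
      using D(3)[of "act h x" "S x"] measurable_space[OF S(1)] measurable_space[OF act_measurable[OF h]] by blast
  qed
  then show ?thesis using aut_cong_AE[OF autS act_measurable[OF h]] h by (simp add: lifts_def)
qed

subsection \<open>The topology on the lifts\<close>

abbreviation lift_topology :: "('x \<Rightarrow> 'g) set topology" where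
  "lift_topology \<equiv> subtopology (L0_topology M TG d) lift_classes"

lemma topspace_lift_topology: "topspace lift_topology = lift_classes"
  using topspace_L0_topology[OF TG(1) d] by (auto simp: orbit_full_lift_def)

lemma limitin_lift_topology_iff:
  assumes "\<And>n. F n \<in> lift_classes" "H \<in> lift_classes"
  shows "limitin lift_topology F H sequentially \<longleftrightarrow> conv_in_measure M TG (\<lambda>n. rep (F n)) (rep H)"
  using limitin_L0_iff[OF TG(1) d lift_classesE(3)[OF assms(1)] lift_classesE(3)[OF assms(2)]] assms
  by (simp add: limitin_subtopology)

lemma limitin_ae_class_lift_iff:
  assumes f: "\<And>n. f n \<in> lifts" and h: "h \<in> lifts"
  shows "limitin lift_topology (\<lambda>n. ae_class M BG (f n)) (ae_class M BG h) sequentially \<longleftrightarrow> conv_in_measure M TG f h"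
  using limitin_L0_ae_class_iff[OF TG(1) d lifts_measurable[OF f] lifts_measurable[OF h]] ae_class_lift f h
  by (simp add: limitin_subtopology)

definition Psi :: "('x \<Rightarrow> 'g) set \<Rightarrow> ('x \<Rightarrow> 'x) set" where
  "Psi F = ae_class M (borel_of TX) (aut_inv (act (rep F)))"

text \<open>The second and third terms make the images and their inverses Cauchy, so that limits of
  both exist and certify an invertible limit. Neither term changes the topology, by
  \<open>lift_dist_tendsto_iff\<close>.\<close>

definition lift_dist :: "('x \<Rightarrow> 'g) set \<Rightarrow> ('x \<Rightarrow> 'g) set \<Rightarrow> real" where
  "lift_dist F H = L0_dist M dG F H + L0_dist M dX (Phi M \<phi> F) (Phi M \<phi> H) + L0_dist M dX (Psi F) (Psi H)"

lemma Phi_lift: "F \<in> lift_classes \<Longrightarrow> Phi M \<phi> F = ae_class M (borel_of TX) (act (rep F))"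
  by (simp add: Phi_def ae_class_TX)

lemma Phi_Psi_L0:
  assumes "F \<in> lift_classes"
  shows "Phi M \<phi> F \<in> L0 M (borel_of TX)" "Psi F \<in> L0 M (borel_of TX)"
  using assms lift_classesE(1)[OF assms] lifts_aut aut_measurable aut_inv(1)
  by (auto simp: Phi_lift Psi_def measurable_TX[symmetric] intro!: ae_class_in_L0)

lemma Metric_space_lift: "Metric_space lift_classes lift_dist"
proof -
  interpret LG: Metric_space "L0 M BG" "L0_dist M dG" by (rule Metric_space_L0[OF TG(1) dG(1)])
  interpret LX: Metric_space "L0 M (borel_of TX)" "L0_dist M dX" by (rule Metric_space_L0[OF TX(1) dX(1)])
  show ?thesis
  proof
    show "0 \<le> lift_dist F H" for F H by (simp add: lift_dist_def)
    show "lift_dist F H = lift_dist H F" for F H by (simp add: lift_dist_def LG.commute LX.commute)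
  next
    fix F H assume FH: "F \<in> lift_classes" "H \<in> lift_classes"
    have "lift_dist F H = 0 \<longleftrightarrow> L0_dist M dG F H = 0 \<and> L0_dist M dX (Phi M \<phi> F) (Phi M \<phi> H) = 0 \<and> L0_dist M dX (Psi F) (Psi H) = 0"
      unfolding lift_dist_def by (smt (verit) LG.nonneg LX.nonneg)
    then show "lift_dist F H = 0 \<longleftrightarrow> F = H"
      using lift_classesE(3)[OF FH(1)] lift_classesE(3)[OF FH(2)] Phi_Psi_L0[OF FH(1)] Phi_Psi_L0[OF FH(2)] by auto
  next
    fix F H K assume FHK: "F \<in> lift_classes" "H \<in> lift_classes" "K \<in> lift_classes"
    show "lift_dist F K \<le> lift_dist F H + lift_dist H K"
      using LG.triangle[OF FHK[THEN lift_classesE(3)]] LX.triangle[OF FHK[THEN Phi_Psi_L0(1)]]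
        LX.triangle[OF FHK[THEN Phi_Psi_L0(2)]] unfolding lift_dist_def by linarith
  qed
qed

lemma L0_dist_tendsto_iff:
  assumes T: "polish_topology T" "compatible_bounded_metric T e"
    and f: "\<And>n. f n \<in> measurable M (borel_of T)" and h: "h \<in> measurable M (borel_of T)"
  shows "(\<lambda>n. L0_dist M e (ae_class M (borel_of T) (f n)) (ae_class M (borel_of T) h)) \<longlonglongrightarrow> 0 \<longleftrightarrow> conv_in_measure M T f h"
  unfolding limitin_L0_ae_class_iff[where F = f and f = h, OF T f h, symmetric] L0_topology_def
    Metric_space.limitin_metric_dist_null[OF Metric_space_L0[OF T]]
  using ae_class_in_L0[OF f] ae_class_in_L0[OF h] by simp

text \<open>For a limit that is itself a lift, the two extra terms vanish automatically:
  \<open>act\<close> is continuous on lifts, and inversion is continuous for weak convergence. The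
  new terms constrain only Cauchy sequences.\<close>

lemma lift_dist_tendsto_iff:
  assumes F: "\<And>n. F n \<in> lift_classes" and H: "H \<in> lift_classes"
  shows "(\<lambda>n. lift_dist (F n) H) \<longlonglongrightarrow> 0 \<longleftrightarrow> conv_in_measure M TG (\<lambda>n. rep (F n)) (rep H)"
proof
  note f = lift_classesE(1)[OF F] and h = lift_classesE(1)[OF H]
  note iff = L0_dist_tendsto_iff[OF TG(1) dG(1) lifts_measurable[OF f] lifts_measurable[OF h],
      folded lift_classesE(2)[OF F] lift_classesE(2)[OF H]]
  {
    assume "(\<lambda>n. lift_dist (F n) H) \<longlonglongrightarrow> 0"
    then have "(\<lambda>n. L0_dist M dG (F n) H) \<longlonglongrightarrow> 0"
    proof (rule tendsto_sandwich[rotated 3])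
      show "\<forall>\<^sub>F n in sequentially. L0_dist M dG (F n) H \<le> lift_dist (F n) H"
        using Metric_space.nonneg[OF Metric_space_L0[OF TX(1) dX(1)]] by (auto simp: lift_dist_def)
      show "\<forall>\<^sub>F n in sequentially. 0 \<le> L0_dist M dG (F n) H"
        using Metric_space.nonneg[OF Metric_space_L0[OF TG(1) dG(1)]] by auto
    qed auto
    then show "conv_in_measure M TG (\<lambda>n. rep (F n)) (rep H)" using iff by simp
  }
  assume conv: "conv_in_measure M TG (\<lambda>n. rep (F n)) (rep H)"
  note w = act_weakly_converges[OF f h conv]
  have m: "aut S \<Longrightarrow> S \<in> measurable M (borel_of TX)" for S using aut_measurable by (simp add: measurable_TX)
  have "(\<lambda>n. L0_dist M dX (Phi M \<phi> (F n)) (Phi M \<phi> H)) \<longlonglongrightarrow> 0"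
    unfolding Phi_lift[OF F] Phi_lift[OF H]
    using L0_dist_tendsto_iff[OF TX(1) dX(1) m[OF lifts_aut[OF f]] m[OF lifts_aut[OF h]]] act_conv_in_measure[OF f h conv] by simp
  moreover have "(\<lambda>n. L0_dist M dX (Psi (F n)) (Psi H)) \<longlonglongrightarrow> 0"
    unfolding Psi_def
    using L0_dist_tendsto_iff[OF TX(1) dX(1) m[OF aut_inv(1)[OF lifts_aut[OF f]]] m[OF aut_inv(1)[OF lifts_aut[OF h]]]]
      aut_inv_conv_in_measure[OF lifts_aut[OF f] lifts_aut[OF h] w] by simp
  moreover have "(\<lambda>n. L0_dist M dG (F n) H) \<longlonglongrightarrow> 0" using iff conv by simp
  ultimately have "(\<lambda>n. L0_dist M dG (F n) H + L0_dist M dX (Phi M \<phi> (F n)) (Phi M \<phi> H) + L0_dist M dX (Psi (F n)) (Psi H)) \<longlonglongrightarrow> 0 + 0 + 0"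
    by (intro tendsto_add)
  then show "(\<lambda>n. lift_dist (F n) H) \<longlonglongrightarrow> 0" by (simp add: lift_dist_def)
qed

lemma mtopology_lift: "Metric_space.mtopology lift_classes lift_dist = lift_topology"
proof -
  have ms: "Metric_space (L0 M BG) (L0_dist M d)" by (rule Metric_space_L0[OF TG(1) d])
  have sub: "lift_classes \<subseteq> L0 M BG" by (auto simp: orbit_full_lift_def)
  have "Metric_space.mtopology lift_classes lift_dist = Metric_space.mtopology lift_classes (L0_dist M d)"
  proof (rule mtopology_eq_sequentially[OF Metric_space_lift Metric_space.subspace[OF ms sub]])
    fix F :: "nat \<Rightarrow> _" and H assume "range F \<subseteq> lift_classes" and H: "H \<in> lift_classes"
    then have F: "\<And>n. F n \<in> lift_classes" by auto
    show "(\<lambda>n. lift_dist (F n) H) \<longlonglongrightarrow> 0 \<longleftrightarrow> (\<lambda>n. L0_dist M d (F n) H) \<longlonglongrightarrow> 0"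
      unfolding lift_dist_tendsto_iff[OF F H]
      using L0_dist_tendsto_iff[OF TG(1) d lifts_measurable[OF lift_classesE(1)[OF F]] lifts_measurable[OF lift_classesE(1)[OF H]],
          folded lift_classesE(2)[OF F] lift_classesE(2)[OF H]] by simp
  qed
  also have "\<dots> = lift_topology"
    unfolding L0_topology_def by (rule Submetric.mtopology_submetric[OF Submetric.intro[OF ms Submetric_axioms.intro[OF sub]]])
  finally show ?thesis .
qed

text \<open>Each term of \<open>lift_dist\<close> yields a Cauchy sequence in a complete space of
  classes. The three limits are exactly the data of \<open>lifts_closed\<close>, which returns the
  limit of the lifts to the lifts.\<close>

lemma completely_metrizable_lift: "completely_metrizable_space lift_topology"
proof -
  interpret LG: Metric_space "L0 M BG" "L0_dist M dG" by (rule Metric_space_L0[OF TG(1) dG(1)])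
  interpret LX: Metric_space "L0 M (borel_of TX)" "L0_dist M dX" by (rule Metric_space_L0[OF TX(1) dX(1)])
  interpret E: Metric_space lift_classes lift_dist by (rule Metric_space_lift)
  have "E.mcomplete"
    unfolding E.mcomplete_def
  proof (intro allI impI)
    fix F assume C: "E.MCauchy F"
    then have F: "\<And>n. F n \<in> lift_classes" by (auto simp: E.MCauchy_def)
    have le: "L0_dist M dG A B \<le> lift_dist A B" "L0_dist M dX (Phi M \<phi> A) (Phi M \<phi> B) \<le> lift_dist A B"
      "L0_dist M dX (Psi A) (Psi B) \<le> lift_dist A B" for A B
      unfolding lift_dist_def by (smt (verit) LG.nonneg LX.nonneg)+
    have "LG.MCauchy F"
      unfolding LG.MCauchy_def using C lift_classesE(3)[OF F] le(1) unfolding E.MCauchy_def by (meson image_subsetI le_less_trans)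
    then obtain H where H: "limitin LG.mtopology F H sequentially"
      using mcomplete_L0[OF TG(1) dG] unfolding LG.mcomplete_def by blast
    have "LX.MCauchy (\<lambda>n. Phi M \<phi> (F n))"
      unfolding LX.MCauchy_def using C Phi_Psi_L0(1)[OF F] le(2) unfolding E.MCauchy_def by (meson image_subsetI le_less_trans)
    then obtain S where S: "limitin LX.mtopology (\<lambda>n. Phi M \<phi> (F n)) S sequentially"
      using mcomplete_L0[OF TX(1) dX] unfolding LX.mcomplete_def by blast
    have "LX.MCauchy (\<lambda>n. Psi (F n))"
      unfolding LX.MCauchy_def using C Phi_Psi_L0(2)[OF F] le(3) unfolding E.MCauchy_def by (meson image_subsetI le_less_trans)
    then obtain R where R: "limitin LX.mtopology (\<lambda>n. Psi (F n)) R sequentially"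
      using mcomplete_L0[OF TX(1) dX] unfolding LX.mcomplete_def by blast
    note f = lift_classesE(1)[OF F]
    have HL: "H \<in> L0 M BG" and SL: "S \<in> L0 M (borel_of TX)" and RL: "R \<in> L0 M (borel_of TX)"
      using limitin_topspace[OF H] limitin_topspace[OF S] limitin_topspace[OF R] by simp_all
    have m: "aut P \<Longrightarrow> P \<in> measurable M (borel_of TX)" for P using aut_measurable by (simp add: measurable_TX)
    have cH: "conv_in_measure M TG (\<lambda>n. rep (F n)) (rep H)"
      using limitin_L0_iff[OF TG(1) dG(1) lift_classesE(3)[OF F] HL] H by (simp add: L0_topology_def)
    have cS: "conv_in_measure M TX (\<lambda>n. act (rep (F n))) (rep S)"
      using limitin_L0_ae_class_iff[OF TX(1) dX(1) m[OF lifts_aut[OF f]] rep_L0(1)[OF SL]] S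
      by (simp add: L0_topology_def Phi_lift[OF F] rep_L0(2)[OF SL])
    have cR: "conv_in_measure M TX (\<lambda>n. aut_inv (act (rep (F n)))) (rep R)"
      using limitin_L0_ae_class_iff[OF TX(1) dX(1) m[OF aut_inv(1)[OF lifts_aut[OF f]]] rep_L0(1)[OF RL]] R
      by (simp add: L0_topology_def Psi_def rep_L0(2)[OF RL])
    have "rep H \<in> lifts"
      using rep_L0(1)[OF SL] rep_L0(1)[OF RL]
      by (intro lifts_closed[OF f rep_L0(1)[OF HL] cH _ cS _ cR]) (simp_all add: measurable_TX)
    then have Hl: "H \<in> lift_classes" using ae_class_lift rep_L0(2)[OF HL] by metis
    then have "limitin E.mtopology F H sequentially"
      unfolding E.limitin_metric_dist_null using lift_dist_tendsto_iff[OF F Hl] cH F by simp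
    then show "\<exists>H. limitin E.mtopology F H sequentially" by blast
  qed
  then show ?thesis using E.completely_metrizable_space_mtopology mtopology_lift by simp
qed

lemma second_countable_lift: "second_countable lift_topology"
  using second_countable_L0[OF polish_imp_second_countable[OF TX(1)] TX(3) TG(1) d] by (rule second_countable_subtopology)

lemma metrizable_lift: "metrizable_space lift_topology"
  using completely_metrizable_lift by (rule completely_metrizable_imp_metrizable_space)

end

subsection \<open>Topological groups and products of open maps\<close>

text \<open>Choose neighbourhoods \<open>W\<close> of the identity and \<open>V\<close> of
  \<open>x\<close> with \<open>WV\<close> inside \<open>U\<close>. A point \<open>y\<close> in the
  closure of \<open>V\<close> has some \<open>v\<close> in \<open>V\<close> with \<open>y\<close>
  times the inverse of \<open>v\<close> in \<open>W\<close>, so \<open>y\<close> lies in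
  \<open>WV\<close>.\<close>

lemma topological_group_imp_regular_space:
  assumes H: "topological_group H S"
  shows "regular_space S"
  unfolding neighbourhood_base_of_closedin[symmetric] neighbourhood_base_of
proof (intro allI impI)
  fix U x assume "openin S U \<and> x \<in> U"
  then have U: "openin S U" "x \<in> U" by auto
  interpret group H using H by (simp add: topological_group_def)
  have S: "topspace S = carrier H" using H by (simp add: topological_group_def)
  have mult: "continuous_map (prod_topology S S) S (\<lambda>(x, y). x \<otimes>\<^bsub>H\<^esub> y)"
    and inv: "continuous_map S S (\<lambda>x. inv\<^bsub>H\<^esub> x)"
    using H by (auto simp: topological_group_def)
  have x: "x \<in> carrier H" using U openin_subset S by fastforce
  have "openin (prod_topology S S) {p \<in> topspace (prod_topology S S). (\<lambda>(x, y). x \<otimes>\<^bsub>H\<^esub> y) p \<in> U}"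
    using mult U(1) by (rule openin_continuous_map_preimage)
  moreover have "(\<one>\<^bsub>H\<^esub>, x) \<in> {p \<in> topspace (prod_topology S S). (\<lambda>(x, y). x \<otimes>\<^bsub>H\<^esub> y) p \<in> U}"
    using x U S by simp
  ultimately have "\<exists>W V. openin S W \<and> openin S V \<and> \<one>\<^bsub>H\<^esub> \<in> W \<and> x \<in> V \<and>
      W \<times> V \<subseteq> {p \<in> topspace (prod_topology S S). (\<lambda>(x, y). x \<otimes>\<^bsub>H\<^esub> y) p \<in> U}"
    unfolding openin_prod_topology_alt by simp
  then obtain W V where W: "openin S W" "\<one>\<^bsub>H\<^esub> \<in> W" and V: "openin S V" "x \<in> V"
    and WV: "W \<times> V \<subseteq> {p \<in> topspace (prod_topology S S). (\<lambda>(x, y). x \<otimes>\<^bsub>H\<^esub> y) p \<in> U}"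
    by (elim exE conjE) (rule that)
  have "S closure_of V \<subseteq> U"
  proof
    fix y assume y: "y \<in> S closure_of V"
    then have yH: "y \<in> carrier H" using closure_of_subset_topspace S by fastforce
    define N where "N = {z \<in> topspace S. y \<otimes>\<^bsub>H\<^esub> inv\<^bsub>H\<^esub> z \<in> W}"
    have "continuous_map S (prod_topology S S) (\<lambda>z. (y, inv\<^bsub>H\<^esub> z))"
      using yH S inv by (intro continuous_map_pairedI) auto
    from continuous_map_compose[OF this mult] have "continuous_map S S (\<lambda>z. y \<otimes>\<^bsub>H\<^esub> inv\<^bsub>H\<^esub> z)"
      by (simp add: o_def)
    then have "openin S N" unfolding N_def using W(1) by (rule openin_continuous_map_preimage)
    moreover have "y \<in> N" using yH W S by (simp add: N_def)
    ultimately obtain v where v: "v \<in> V" "v \<in> N" using y unfolding in_closure_of by blast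
    then have "v \<in> carrier H" using V(1) openin_subset S by fastforce
    then have "y = (y \<otimes>\<^bsub>H\<^esub> inv\<^bsub>H\<^esub> v) \<otimes>\<^bsub>H\<^esub> v" using yH by (simp add: m_assoc)
    moreover have "(y \<otimes>\<^bsub>H\<^esub> inv\<^bsub>H\<^esub> v, v) \<in> W \<times> V" using v by (simp add: N_def)
    ultimately show "y \<in> U" using WV by auto
  qed
  then show "\<exists>V C. openin S V \<and> closedin S C \<and> x \<in> V \<and> V \<subseteq> C \<and> C \<subseteq> U"
    using V closure_of_subset[OF openin_subset[OF V(1)]] by (intro exI[of _ V] exI[of _ "S closure_of V"]) auto
qed

text \<open>Products of quotient maps need not be quotient maps, but products of open maps are open.
  This lets multiplication descend from pairs of lifts.\<close>

lemma open_map_prod: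
  assumes f: "open_map X Y f" and g: "open_map X' Y' g"
  shows "open_map (prod_topology X X') (prod_topology Y Y') (\<lambda>(x, y). (f x, g y))"
  unfolding open_map_def
proof (intro allI impI)
  fix U assume U: "openin (prod_topology X X') U"
  show "openin (prod_topology Y Y') ((\<lambda>(x, y). (f x, g y)) ` U)"
    unfolding openin_prod_topology_alt
  proof (intro allI impI)
    fix a b assume "(a, b) \<in> (\<lambda>(x, y). (f x, g y)) ` U"
    then obtain x y where xy: "(x, y) \<in> U" "a = f x" "b = g y" by auto
    then have "\<exists>A B. openin X A \<and> openin X' B \<and> x \<in> A \<and> y \<in> B \<and> A \<times> B \<subseteq> U"
      using U unfolding openin_prod_topology_alt by simp
    then obtain A B where AB: "openin X A" "openin X' B" "x \<in> A" "y \<in> B" "A \<times> B \<subseteq> U"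
      by (elim exE conjE) (rule that)
    have "f ` A \<times> g ` B \<subseteq> (\<lambda>(x, y). (f x, g y)) ` U"
    proof
      fix p assume "p \<in> f ` A \<times> g ` B"
      then obtain x' y' where "x' \<in> A" "y' \<in> B" "p = (f x', g y')" by auto
      then show "p \<in> (\<lambda>(x, y). (f x, g y)) ` U" using AB(5) by (intro image_eqI[of _ _ "(x', y')"]) auto
    qed
    moreover have "openin Y (f ` A)" "openin Y' (g ` B)"
      using f g AB(1,2) by (simp_all add: open_map_def)
    ultimately show "\<exists>A B. openin Y A \<and> openin Y' B \<and> a \<in> A \<and> b \<in> B \<and> A \<times> B \<subseteq> (\<lambda>(x, y). (f x, g y)) ` U"
      using AB xy by (intro exI[of _ "f ` A"] exI[of _ "g ` B"]) auto
  qed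
qed

context orbit_full
begin

subsection \<open>The orbit full group\<close>

abbreviation RG :: "('x \<Rightarrow> 'x) set monoid" where "RG \<equiv> orbit_full_group G M \<phi>"
abbreviation RT :: "('x \<Rightarrow> 'x) set topology" where "RT \<equiv> orbit_full_topology G TG d M \<phi>"

text \<open>The relation that \<open>g\<close> sends \<open>x\<close> to \<open>T x\<close> is
  Borel, with nonempty sections almost everywhere; uniformization modulo null sets chooses
  \<open>g\<close> measurably.\<close>

lemma orbit_selector:
  assumes T: "T \<in> mp_bijections M" and orb: "AE x in M. T x \<in> orbit G \<phi> x"
  shows "\<exists>f\<in>lifts. AE x in M. act f x = T x"
proof -
  have Tm: "T \<in> measurable M M" using T by (simp add: mp_bijections_def)
  define B where "B = {p \<in> space (M \<Otimes>\<^sub>M BG). \<phi> (snd p) (fst p) = T (fst p)}"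
  have swap: "(\<lambda>p. (snd p, fst p)) \<in> measurable (M \<Otimes>\<^sub>M BG) (BG \<Otimes>\<^sub>M M)" by measurable
  have "(\<lambda>p. \<phi> (snd p) (fst p)) \<in> measurable (M \<Otimes>\<^sub>M BG) M"
    using measurable_compose[OF swap action_measurable] by simp
  moreover have "(\<lambda>p. T (fst p)) \<in> measurable (M \<Otimes>\<^sub>M BG) M" using Tm by measurable
  ultimately have B: "B \<in> sets (M \<Otimes>\<^sub>M BG)"
    unfolding B_def measurable_TX[of "M \<Otimes>\<^sub>M BG"]
    by (rule sets_Collect_eq_borel_of[OF TX(1)])
  have "AE x in M. \<exists>g. (x, g) \<in> B"
    using orb AE_space by eventually_elim (auto simp: B_def space_pair_measure orbit_def TG(2))
  then obtain f where f: "f \<in> measurable M BG" "AE x in M. (x, f x) \<in> B"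
    using borel_uniformization[OF prob_space_axioms TX(1,3) TG(1) B] by blast
  from f(2) have AE: "AE x in M. act f x = T x" by eventually_elim (simp add: B_def)
  then have "f \<in> lifts"
    using f(1) aut_cong_AE[OF mp_bijections_aut[OF T] act_measurable[OF f(1)] AE] by (simp add: lifts_def)
  then show ?thesis using AE by blast
qed

lemma orbit_full_set_eq: "orbit_full_set G M \<phi> = (\<lambda>f. ae_class M M (act f)) ` lifts"
proof
  show "orbit_full_set G M \<phi> \<subseteq> (\<lambda>f. ae_class M M (act f)) ` lifts"
  proof
    fix C assume "C \<in> orbit_full_set G M \<phi>"
    then obtain T where T: "T \<in> mp_bijections M" "AE x in M. T x \<in> orbit G \<phi> x" "C = ae_class M M T"
      by (auto simp: orbit_full_set_def)
    obtain f where f: "f \<in> lifts" "AE x in M. act f x = T x" using orbit_selector[OF T(1,2)] by blast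
    then have "C = ae_class M M (act f)"
      using T ae_class_eq_iff[OF act_measurable[OF lifts_measurable[OF f(1)]], of T] by (simp add: mp_bijections_def)
    then show "C \<in> (\<lambda>f. ae_class M M (act f)) ` lifts" using f(1) by blast
  qed
  show "(\<lambda>f. ae_class M M (act f)) ` lifts \<subseteq> orbit_full_set G M \<phi>"
  proof
    fix C assume "C \<in> (\<lambda>f. ae_class M M (act f)) ` lifts"
    then obtain f where f: "f \<in> lifts" "C = ae_class M M (act f)" by blast
    then obtain T where T: "T \<in> mp_bijections M" "AE x in M. act f x = T x" using lifts_aut by (auto simp: aut_def)
    have "C = ae_class M M T"
      using T f(2) ae_class_eq_iff[OF act_measurable[OF lifts_measurable[OF f(1)]], of T] by (simp add: mp_bijections_def)
    moreover have "AE x in M. T x \<in> orbit G \<phi> x"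
      using T(2) AE_space
    proof eventually_elim
      case (elim x)
      then show ?case using BG_carrier[OF lifts_measurable[OF f(1)]] unfolding orbit_def by force
    qed
    ultimately show "C \<in> orbit_full_set G M \<phi>" using T(1) by (auto simp: orbit_full_set_def)
  qed
qed

section \<open>The group structure computed on lifts\<close>

lemma carrier_RG: "carrier RG = orbit_full_set G M \<phi>"
  by (simp add: orbit_full_group_def)

lemma act_class_RG: "f \<in> lifts \<Longrightarrow> ae_class M M (act f) \<in> carrier RG"
  unfolding carrier_RG orbit_full_set_eq by blast

lemma RG_cases:
  assumes "C \<in> carrier RG"
  obtains f where "f \<in> lifts" "C = ae_class M M (act f)"
  using assms unfolding carrier_RG orbit_full_set_eq by blast

lemma Phi_image: "Phi M \<phi> ` lift_classes = carrier RG"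
proof
  show "Phi M \<phi> ` lift_classes \<subseteq> carrier RG"
    using lift_classesE(1) act_class_RG by (auto simp: Phi_def)
  show "carrier RG \<subseteq> Phi M \<phi> ` lift_classes"
  proof
    fix C assume "C \<in> carrier RG"
    then obtain f where f: "f \<in> lifts" "C = ae_class M M (act f)" by (rule RG_cases)
    then have "C = Phi M \<phi> (ae_class M BG f)" using Phi_ae_class[OF lifts_measurable[OF f(1)]] by simp
    then show "C \<in> Phi M \<phi> ` lift_classes" using ae_class_lift[OF f(1)] by blast
  qed
qed

text \<open>Evaluating \<open>f\<close> at the moved point \<open>act h x\<close> is what makes
  \<open>act\<close> turn this product into composition.\<close>

definition lift_mult :: "('x \<Rightarrow> 'g) \<Rightarrow> ('x \<Rightarrow> 'g) \<Rightarrow> 'x \<Rightarrow> 'g" where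
  "lift_mult f h = (\<lambda>x. f (act h x) \<otimes> h x)"

definition lift_inv :: "('x \<Rightarrow> 'g) \<Rightarrow> 'x \<Rightarrow> 'g" where
  "lift_inv f = (\<lambda>x. inv (f (aut_inv (act f) x)))"

lemma BG_mult_measurable:
  assumes "f \<in> measurable N BG" "h \<in> measurable N BG"
  shows "(\<lambda>x. f x \<otimes> h x) \<in> measurable N BG"
proof -
  have "(\<lambda>(x, y). x \<otimes> y) \<in> measurable (BG \<Otimes>\<^sub>M BG) BG"
    using continuous_map_borel_measurable[OF TG(3)]
      measurable_cong_sets[OF sets_borel_of_prod_topology[of TG TG] refl] polish_imp_second_countable[OF TG(1)] by blast
  from measurable_compose[OF measurable_Pair[OF assms] this] show ?thesis by simp
qed

lemma act_lift_mult:
  assumes f: "f \<in> measurable M BG" and h: "h \<in> measurable M BG" and x: "x \<in> space M"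
  shows "act (lift_mult f h) x = act f (act h x)"
proof -
  have hx: "h x \<in> carrier G" by (rule BG_carrier[OF h x])
  then have "act h x \<in> space M" using act_closed x by blast
  then show ?thesis
    unfolding lift_mult_def using composition_rule[OF x BG_carrier[OF f] hx] by simp
qed

lemma lift_mult_lifts:
  assumes f: "f \<in> lifts" and h: "h \<in> lifts"
  shows "lift_mult f h \<in> lifts"
proof -
  note fm = lifts_measurable[OF f] and hm = lifts_measurable[OF h]
  have m: "lift_mult f h \<in> measurable M BG"
    unfolding lift_mult_def by (intro BG_mult_measurable measurable_compose[OF act_measurable[OF hm] fm] hm)
  moreover have "aut (act (lift_mult f h))"
    by (rule aut_cong_AE[OF aut_compose[OF lifts_aut[OF f] lifts_aut[OF h]] act_measurable[OF m]])
      (use act_lift_mult[OF fm hm] in auto)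
  ultimately show ?thesis by (simp add: lifts_def)
qed

lemma one_lifts: "(\<lambda>x. \<one>) \<in> lifts"
proof -
  have "(\<lambda>x. \<one>) \<in> measurable M BG" by (simp add: TG(2))
  moreover have "aut (\<lambda>x. \<phi> \<one> x)"
    by (rule aut_cong_AE[OF mp_bijections_aut[OF mp_bijections_id] act_measurable[OF calculation]])
      (use act_one in auto)
  ultimately show ?thesis by (simp add: lifts_def)
qed

text \<open>With \<open>y\<close> the preimage of \<open>x\<close>, the element \<open>f y\<close>
  moves \<open>y\<close> to \<open>x\<close>, so its inverse moves \<open>x\<close> back to
  \<open>y\<close>.\<close>

lemma act_lift_inv:
  assumes f: "f \<in> lifts"
  shows "AE x in M. act (lift_inv f) x = aut_inv (act f) x"
  using aut_inv(3)[OF lifts_aut[OF f]] AE_space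
proof eventually_elim
  case (elim x)
  define y where "y = aut_inv (act f) x"
  have "y \<in> space M" using measurable_space[OF aut_measurable[OF aut_inv(1)[OF lifts_aut[OF f]]] elim(2)] by (simp add: y_def)
  then have "\<phi> (inv (f y)) x = y"
    using elim(1) orbit_sym_aux[OF BG_carrier[OF lifts_measurable[OF f]], of y y x] by (simp add: y_def)
  then show ?case by (simp add: lift_inv_def y_def)
qed

lemma lift_inv_lifts:
  assumes f: "f \<in> lifts"
  shows "lift_inv f \<in> lifts"
proof -
  note a = aut_inv(1)[OF lifts_aut[OF f]]
  have m: "lift_inv f \<in> measurable M BG"
    unfolding lift_inv_def
    by (rule measurable_compose[OF measurable_compose[OF aut_measurable[OF a] lifts_measurable[OF f]]
          continuous_map_borel_measurable[OF TG(4)]])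
  then show ?thesis
    using aut_cong_AE[OF a act_measurable[OF m] act_lift_inv[OF f]] by (simp add: lifts_def)
qed

text \<open>The null set on which the chosen representative of \<open>S\<close> differs from
  \<open>S\<close> is pulled back along \<open>T\<close>, and it stays null because \<open>T\<close>
  preserves the measure.\<close>

lemma mult_ae_class:
  assumes S: "aut S" and T: "aut T"
  shows "ae_class M M S \<otimes>\<^bsub>RG\<^esub> ae_class M M T = ae_class M M (\<lambda>x. S (T x))"
proof -
  note Sm = aut_measurable[OF S] and Tm = aut_measurable[OF T]
  note rS = rep_ae_class[OF Sm] and rT = rep_ae_class[OF Tm]
  have "AE x in M. (rep (ae_class M M S) \<circ> rep (ae_class M M T)) x = S (T x)"
    using aut_AE[OF T rS(2)] rT(2) by eventually_elim simp
  then have "ae_class M M (rep (ae_class M M S) \<circ> rep (ae_class M M T)) = ae_class M M (\<lambda>x. S (T x))"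
    using ae_class_eq_iff[OF measurable_comp[OF rT(1) rS(1)] measurable_compose[OF Tm Sm]] by simp
  then show ?thesis by (simp add: orbit_full_group_def)
qed

lemma mult_act_class:
  assumes f: "f \<in> lifts" and h: "h \<in> lifts"
  shows "ae_class M M (act f) \<otimes>\<^bsub>RG\<^esub> ae_class M M (act h) = ae_class M M (act (lift_mult f h))"
  unfolding mult_ae_class[OF lifts_aut[OF f] lifts_aut[OF h]]
  using ae_class_eq_iff[OF aut_measurable[OF aut_compose[OF lifts_aut[OF f] lifts_aut[OF h]]]
      aut_measurable[OF lifts_aut[OF lift_mult_lifts[OF f h]]]]
    act_lift_mult[OF lifts_measurable[OF f] lifts_measurable[OF h]] by auto

lemma one_RG: "\<one>\<^bsub>RG\<^esub> = ae_class M M (\<lambda>x. x)"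
  by (simp add: orbit_full_group_def)

lemma one_act_class: "\<one>\<^bsub>RG\<^esub> = ae_class M M (act (\<lambda>x. \<one>))"
  unfolding one_RG
  using ae_class_eq_iff[OF _ act_measurable[OF lifts_measurable[OF one_lifts]], of "\<lambda>x. x"] act_one by auto

lemma inv_act_class_mult:
  assumes f: "f \<in> lifts"
  shows "ae_class M M (act (lift_inv f)) \<otimes>\<^bsub>RG\<^esub> ae_class M M (act f) = \<one>\<^bsub>RG\<^esub>"
proof -
  have "AE x in M. act (lift_inv f) (act f x) = x"
    using aut_AE[OF lifts_aut[OF f] act_lift_inv[OF f]] aut_inv(2)[OF lifts_aut[OF f]]
    by eventually_elim simp
  then show ?thesis
    unfolding mult_ae_class[OF lifts_aut[OF lift_inv_lifts[OF f]] lifts_aut[OF f]] one_RG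
    using ae_class_eq_iff[OF aut_measurable[OF aut_compose[OF lifts_aut[OF lift_inv_lifts[OF f]] lifts_aut[OF f]]], of "\<lambda>x. x"]
    by simp
qed

lemma group_RG: "group RG"
proof (rule groupI)
  fix C D assume C: "C \<in> carrier RG" and D: "D \<in> carrier RG"
  obtain f where f: "f \<in> lifts" "C = ae_class M M (act f)" using C by (rule RG_cases)
  obtain h where h: "h \<in> lifts" "D = ae_class M M (act h)" using D by (rule RG_cases)
  show "C \<otimes>\<^bsub>RG\<^esub> D \<in> carrier RG"
    unfolding f h mult_act_class[OF f(1) h(1)] by (rule act_class_RG[OF lift_mult_lifts[OF f(1) h(1)]])
  fix E assume E: "E \<in> carrier RG"
  obtain k where k: "k \<in> lifts" "E = ae_class M M (act k)" using E by (rule RG_cases)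
  note a = lifts_aut[OF f(1)] lifts_aut[OF h(1)] lifts_aut[OF k(1)]
  show "C \<otimes>\<^bsub>RG\<^esub> D \<otimes>\<^bsub>RG\<^esub> E = C \<otimes>\<^bsub>RG\<^esub> (D \<otimes>\<^bsub>RG\<^esub> E)"
    unfolding f h k mult_ae_class[OF a(1,2)] mult_ae_class[OF a(2,3)]
      mult_ae_class[OF aut_compose[OF a(1,2)] a(3)] mult_ae_class[OF a(1) aut_compose[OF a(2,3)]] ..
next
  show "\<one>\<^bsub>RG\<^esub> \<in> carrier RG" unfolding one_act_class by (rule act_class_RG[OF one_lifts])
next
  fix C assume C: "C \<in> carrier RG"
  obtain f where f: "f \<in> lifts" "C = ae_class M M (act f)" using C by (rule RG_cases)
  show "\<one>\<^bsub>RG\<^esub> \<otimes>\<^bsub>RG\<^esub> C = C"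
    unfolding one_RG f mult_ae_class[OF mp_bijections_aut[OF mp_bijections_id] lifts_aut[OF f(1)]] ..
  show "\<exists>D\<in>carrier RG. D \<otimes>\<^bsub>RG\<^esub> C = \<one>\<^bsub>RG\<^esub>"
    using inv_act_class_mult[OF f(1)] act_class_RG[OF lift_inv_lifts[OF f(1)]] unfolding f by blast
qed

lemma inv_act_class: "f \<in> lifts \<Longrightarrow> inv\<^bsub>RG\<^esub> (ae_class M M (act f)) = ae_class M M (act (lift_inv f))"
  using group.inv_equality[OF group_RG inv_act_class_mult act_class_RG act_class_RG[OF lift_inv_lifts]] by blast

subsection \<open>The quotient topology\<close>

lemma openin_RT: "openin RT U \<longleftrightarrow> U \<subseteq> carrier RG \<and> openin lift_topology {F \<in> lift_classes. Phi M \<phi> F \<in> U}"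
  unfolding orbit_full_topology_def openin_quotient_topology carrier_RG topspace_lift_topology ..

lemma topspace_RT: "topspace RT = carrier RG"
proof
  show "topspace RT \<subseteq> carrier RG" using openin_RT[of "topspace RT"] by simp
  have eq: "{F \<in> lift_classes. Phi M \<phi> F \<in> carrier RG} = topspace lift_topology"
    unfolding topspace_lift_topology Phi_image[symmetric] by blast
  have "openin RT (carrier RG)" unfolding openin_RT eq by (intro conjI order_refl openin_topspace)
  then show "carrier RG \<subseteq> topspace RT" by (rule openin_subset)
qed

lemma quotient_map_Phi: "quotient_map lift_topology RT (Phi M \<phi>)"
  unfolding quotient_map_def topspace_lift_topology topspace_RT using Phi_image openin_RT by auto

lemma continuous_Phi: "continuous_map lift_topology RT (Phi M \<phi>)"
  by (rule quotient_imp_continuous_map[OF quotient_map_Phi])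

text \<open>Two lifts of the same element differ by right multiplication with a map into the stabilizers, which acts
  homeomorphically on the lifts.\<close>

lemma open_map_Phi: "open_map lift_topology RT (Phi M \<phi>)"
  unfolding open_map_def
proof (intro allI impI)
  fix U assume U: "openin lift_topology U"
  have UL: "U \<subseteq> lift_classes" using openin_subset[OF U] topspace_lift_topology by simp
  define V where "V = {F \<in> lift_classes. Phi M \<phi> F \<in> Phi M \<phi> ` U}"
  have "\<exists>W. openin lift_topology W \<and> H \<in> W \<and> W \<subseteq> V" if H: "H \<in> V" for H
  proof -
    have HL: "H \<in> lift_classes" using H by (simp add: V_def)
    obtain F where F: "F \<in> U" "Phi M \<phi> H = Phi M \<phi> F" using H by (auto simp: V_def)
    have FL: "F \<in> lift_classes" using F UL by blast
    define h where "h = rep H"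
    define f where "f = rep F"
    have h: "h \<in> lifts" and f: "f \<in> lifts" unfolding h_def f_def using lift_classesE(1) HL FL by auto
    note hm = lifts_measurable[OF h] and fm = lifts_measurable[OF f]
    have hf: "AE x in M. act h x = act f x"
      using F(2) ae_class_eq_iff[OF act_measurable[OF hm] act_measurable[OF fm]] by (simp add: Phi_def h_def f_def)
    \<comment> \<open>The stabilizer-valued correction with \<open>h x \<otimes> k x = f x\<close>;
      it fixes \<open>x\<close> because \<open>h x\<close> and \<open>f x\<close> move
      \<open>x\<close> to the same point.\<close>
    define k where "k x = inv (h x) \<otimes> f x" for x
    have km: "k \<in> measurable M BG"
      unfolding k_def by (intro BG_mult_measurable fm measurable_compose[OF hm continuous_map_borel_measurable[OF TG(4)]])
    have k: "AE x in M. act k x = x"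
      using hf AE_space
    proof eventually_elim
      case (elim x)
      have "act k x = \<phi> (inv (h x)) (act f x)"
        unfolding k_def using BG_carrier[OF hm elim(2)] BG_carrier[OF fm elim(2)] elim(2) composition_rule by simp
      also have "\<dots> = x"
        using orbit_sym_aux[OF BG_carrier[OF hm elim(2)] elim(2) elim(1)] .
      finally show ?case .
    qed
    define \<rho> where "\<rho> E = ae_class M BG (\<lambda>x. rep E x \<otimes> k x)" for E
    have \<rho>_act: "AE x in M. act (\<lambda>x. e x \<otimes> k x) x = act e x" if e: "e \<in> measurable M BG" for e
      using k AE_space
    proof eventually_elim
      case (elim x)
      then show ?case
        using composition_rule[OF elim(2) BG_carrier[OF e elim(2)] BG_carrier[OF km elim(2)]] by simp
    qed
    have em: "(\<lambda>x. e x \<otimes> k x) \<in> measurable M BG" if "e \<in> measurable M BG" for e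
      using that km by (rule BG_mult_measurable)
    have el: "(\<lambda>x. e x \<otimes> k x) \<in> lifts" if e: "e \<in> lifts" for e
      using aut_cong_AE[OF lifts_aut[OF e] act_measurable[OF em[OF lifts_measurable[OF e]]] \<rho>_act[OF lifts_measurable[OF e]]]
        em[OF lifts_measurable[OF e]] by (simp add: lifts_def)
    have \<rho>L: "\<rho> E \<in> lift_classes" if "E \<in> lift_classes" for E
      unfolding \<rho>_def by (rule ae_class_lift[OF el[OF lift_classesE(1)[OF that]]])
    have \<rho>Phi: "Phi M \<phi> (\<rho> E) = Phi M \<phi> E" if E: "E \<in> lift_classes" for E
    proof -
      note e = lifts_measurable[OF lift_classesE(1)[OF E]]
      show ?thesis
        unfolding \<rho>_def Phi_ae_class[OF em[OF e]] unfolding Phi_def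
        using ae_class_eq_iff[OF act_measurable[OF em[OF e]] act_measurable[OF e]] \<rho>_act[OF e] by simp
    qed
    have cont: "continuous_map lift_topology lift_topology \<rho>"
    proof (rule metrizable_continuous_map_sequentially[OF metrizable_lift])
      show "\<rho> E \<in> topspace lift_topology" if "E \<in> topspace lift_topology" for E
        using that \<rho>L unfolding topspace_lift_topology by blast
      fix E l assume "range E \<subseteq> topspace lift_topology" and lim: "limitin lift_topology E l sequentially"
      then have E: "\<And>n. E n \<in> lift_classes" and l: "l \<in> lift_classes"
        using limitin_topspace[OF lim] unfolding topspace_lift_topology by auto
      note e = lift_classesE(1)[OF E] and l' = lift_classesE(1)[OF l]
      have c: "conv_in_measure M TG (\<lambda>n. rep (E n)) (rep l)"
        using limitin_lift_topology_iff[OF E l] lim by simp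
      have "conv_in_measure M TG (\<lambda>n x. rep (E n) x \<otimes> k x) (\<lambda>x. rep l x \<otimes> k x)"
        by (rule conv_in_measure_continuous2[OF TG(1) TG(3) lifts_measurable[OF e] lifts_measurable[OF l'] km km c])
          (simp add: conv_in_measure_def)
      then show "limitin lift_topology (\<lambda>n. \<rho> (E n)) (\<rho> l) sequentially"
        unfolding \<rho>_def using limitin_ae_class_lift_iff[where f = "\<lambda>n x. rep (E n) x \<otimes> k x", OF el[OF e] el[OF l']] by simp
    qed
    have \<rho>H: "\<rho> H = F"
    proof -
      have "AE x in M. h x \<otimes> k x = f x"
        using AE_space
      proof eventually_elim
        case (elim x)
        then show ?case
          using BG_carrier[OF hm elim] BG_carrier[OF fm elim] by (simp add: k_def m_assoc[symmetric])
      qed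
      then have "\<rho> H = ae_class M BG f"
        using ae_class_eq_iff[OF em[OF hm] fm] by (simp add: \<rho>_def h_def)
      then show ?thesis using lift_classesE(2)[OF FL] by (simp add: f_def)
    qed
    \<comment> \<open>Pulling \<open>U\<close> back along \<open>\<rho>\<close> gives a
      neighbourhood of \<open>H\<close>. It stays in the saturation \<open>V\<close> because
      \<open>\<rho>\<close> does not change the value of \<open>Phi\<close>.\<close>
    define W where "W = {E \<in> topspace lift_topology. \<rho> E \<in> U}"
    have "openin lift_topology W" unfolding W_def using cont U by (rule openin_continuous_map_preimage)
    moreover have "H \<in> W" using \<rho>H F HL by (simp add: W_def topspace_lift_topology del: topspace_subtopology)
    moreover have "W \<subseteq> V"
    proof
      fix E assume "E \<in> W"
      then have E: "E \<in> lift_classes" "\<rho> E \<in> U" unfolding W_def topspace_lift_topology by auto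
      then have "Phi M \<phi> E \<in> Phi M \<phi> ` U" using \<rho>Phi[OF E(1)] by (metis imageI)
      then show "E \<in> V" using E(1) by (simp add: V_def)
    qed
    ultimately show ?thesis by blast
  qed
  then have "openin lift_topology V" by (subst openin_subopen) blast
  then show "openin RT (Phi M \<phi> ` U)"
    unfolding openin_RT V_def Phi_image[symmetric] using UL by blast
qed

text \<open>The product of open quotient maps reduces the claim to pairs of lifts. There
  \<open>lift_mult\<close> is sequentially continuous, with values that are again lifts.\<close>

lemma continuous_mult_RG: "continuous_map (prod_topology RT RT) RT (\<lambda>(x, y). x \<otimes>\<^bsub>RG\<^esub> y)"
proof -
  define q where "q = (\<lambda>(F, H). (Phi M \<phi> F, Phi M \<phi> H))"
  have "quotient_map (prod_topology lift_topology lift_topology) (prod_topology RT RT) q"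
  proof (rule continuous_open_imp_quotient_map)
    show "continuous_map (prod_topology lift_topology lift_topology) (prod_topology RT RT) q"
      unfolding q_def case_prod_unfold
      by (intro continuous_map_pairedI continuous_map_compose[OF continuous_map_fst continuous_Phi, unfolded o_def]
          continuous_map_compose[OF continuous_map_snd continuous_Phi, unfolded o_def])
    show "open_map (prod_topology lift_topology lift_topology) (prod_topology RT RT) q"
      unfolding q_def by (rule open_map_prod[OF open_map_Phi open_map_Phi])
    show "q ` topspace (prod_topology lift_topology lift_topology) = topspace (prod_topology RT RT)"
      unfolding topspace_prod_topology topspace_lift_topology topspace_RT Phi_image[symmetric] q_def by force
  qed
  moreover have "continuous_map (prod_topology lift_topology lift_topology) RT ((\<lambda>(x, y). x \<otimes>\<^bsub>RG\<^esub> y) \<circ> q)"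
  proof -
    define m where "m = (\<lambda>(F, H). ae_class M BG (lift_mult (rep F) (rep H)))"
    have "continuous_map (prod_topology lift_topology lift_topology) lift_topology m"
    proof (rule metrizable_continuous_map_sequentially)
      show "metrizable_space (prod_topology lift_topology lift_topology)"
        using metrizable_lift by (simp add: metrizable_space_prod_topology)
      show "m p \<in> topspace lift_topology" if "p \<in> topspace (prod_topology lift_topology lift_topology)" for p
        using that lift_classesE(1) ae_class_lift lift_mult_lifts
        unfolding topspace_prod_topology topspace_lift_topology m_def by auto
      fix \<sigma> l
      assume \<sigma>: "range \<sigma> \<subseteq> topspace (prod_topology lift_topology lift_topology)"
        and lim: "limitin (prod_topology lift_topology lift_topology) \<sigma> l sequentially"
      define F where "F n = fst (\<sigma> n)" for n :: nat
      define H where "H n = snd (\<sigma> n)" for n :: nat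
      obtain A B where l: "l = (A, B)" by (cases l)
      have \<sigma>eq: "\<sigma> n = (F n, H n)" for n by (simp add: F_def H_def)
      have F: "F n \<in> lift_classes" and H: "H n \<in> lift_classes" for n
        using \<sigma> unfolding topspace_prod_topology topspace_lift_topology F_def H_def by (auto simp: image_subset_iff mem_Times_iff)
      have limF: "limitin lift_topology F A sequentially" and limH: "limitin lift_topology H B sequentially"
        using lim unfolding l by (simp_all add: limitin_pairwise o_def F_def[symmetric] H_def[symmetric])
      have A: "A \<in> lift_classes" and B: "B \<in> lift_classes"
        using limitin_topspace[OF limF] limitin_topspace[OF limH] unfolding topspace_lift_topology by auto
      note f = lift_classesE(1)[OF F] and h = lift_classesE(1)[OF H] and a = lift_classesE(1)[OF A] and b = lift_classesE(1)[OF B]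
      have cF: "conv_in_measure M TG (\<lambda>n. rep (F n)) (rep A)" using limitin_lift_topology_iff[OF F A] limF by simp
      have cH: "conv_in_measure M TG (\<lambda>n. rep (H n)) (rep B)" using limitin_lift_topology_iff[OF H B] limH by simp
      \<comment> \<open>Both the function and the inner transformation vary; weak convergence of the
        transformations is the point where the action being only Borel has been overcome.\<close>
      have "conv_in_measure M TG (\<lambda>n x. rep (F n) (act (rep (H n)) x)) (\<lambda>x. rep A (act (rep B) x))"
        by (rule conv_in_measure_compose[where H = "\<lambda>n. rep (F n)" and h = "rep A" and F = "\<lambda>n. act (rep (H n))" and S = "act (rep B)",
              OF TG(1) lifts_measurable[OF f] lifts_measurable[OF a] cF aut_mp_map[OF lifts_aut[OF h]]
                 act_measurable[OF lifts_measurable[OF b]] act_weakly_converges[OF h b cH]])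
      from conv_in_measure_continuous2[OF TG(1) TG(3)
          measurable_compose[OF act_measurable[OF lifts_measurable[OF h]] lifts_measurable[OF f]]
          measurable_compose[OF act_measurable[OF lifts_measurable[OF b]] lifts_measurable[OF a]]
          lifts_measurable[OF h] lifts_measurable[OF b] this cH]
      have "conv_in_measure M TG (\<lambda>n. lift_mult (rep (F n)) (rep (H n))) (lift_mult (rep A) (rep B))"
        unfolding lift_mult_def .
      then show "limitin lift_topology (\<lambda>n. m (\<sigma> n)) (m l) sequentially"
        unfolding m_def \<sigma>eq l
        using limitin_ae_class_lift_iff[where f = "\<lambda>n. lift_mult (rep (F n)) (rep (H n))", OF lift_mult_lifts[OF f h] lift_mult_lifts[OF a b]]
        by simp
    qed
    from continuous_map_compose[OF this continuous_Phi]
    have "continuous_map (prod_topology lift_topology lift_topology) RT (Phi M \<phi> \<circ> m)" .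
    then show ?thesis
    proof (rule continuous_map_eq)
      fix p assume "p \<in> topspace (prod_topology lift_topology lift_topology)"
      then obtain F H where p: "p = (F, H)" "F \<in> lift_classes" "H \<in> lift_classes"
        unfolding topspace_prod_topology topspace_lift_topology by auto
      note f = lift_classesE(1)[OF p(2)] and h = lift_classesE(1)[OF p(3)]
      show "(Phi M \<phi> \<circ> m) p = ((\<lambda>(x, y). x \<otimes>\<^bsub>RG\<^esub> y) \<circ> q) p"
        using Phi_ae_class[OF lifts_measurable[OF lift_mult_lifts[OF f h]]] mult_act_class[OF f h]
        by (simp add: p m_def q_def Phi_def)
    qed
  qed
  ultimately show ?thesis by (rule continuous_compose_quotient_map)
qed

lemma continuous_inv_RG: "continuous_map RT RT (\<lambda>x. inv\<^bsub>RG\<^esub> x)"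
proof -
  define i where "i = (\<lambda>F. ae_class M BG (lift_inv (rep F)))"
  have "continuous_map lift_topology lift_topology i"
  proof (rule metrizable_continuous_map_sequentially[OF metrizable_lift])
    show "i F \<in> topspace lift_topology" if "F \<in> topspace lift_topology" for F
      using that lift_classesE(1) ae_class_lift lift_inv_lifts unfolding topspace_lift_topology i_def by blast
    fix F l assume "range F \<subseteq> topspace lift_topology" and lim: "limitin lift_topology F l sequentially"
    then have F: "\<And>n. F n \<in> lift_classes" and l: "l \<in> lift_classes"
      using limitin_topspace[OF lim] unfolding topspace_lift_topology by auto
    note f = lift_classesE(1)[OF F] and h = lift_classesE(1)[OF l]
    note fa = lifts_aut[OF f] and ha = lifts_aut[OF h]
    have c: "conv_in_measure M TG (\<lambda>n. rep (F n)) (rep l)" using limitin_lift_topology_iff[OF F l] lim by simp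
    \<comment> \<open>The same composition argument, now with inner transformations the inverses,
      which converge weakly along with the maps themselves.\<close>
    have "conv_in_measure M TG (\<lambda>n x. rep (F n) (aut_inv (act (rep (F n))) x)) (\<lambda>x. rep l (aut_inv (act (rep l)) x))"
      by (rule conv_in_measure_compose[where H = "\<lambda>n. rep (F n)" and h = "rep l" and F = "\<lambda>n. aut_inv (act (rep (F n)))"
            and S = "aut_inv (act (rep l))", OF TG(1) lifts_measurable[OF f] lifts_measurable[OF h] c aut_mp_map[OF aut_inv(1)[OF fa]]
               aut_measurable[OF aut_inv(1)[OF ha]] aut_inv_weakly_converges[OF fa ha act_weakly_converges[OF f h c]]])
    from conv_in_measure_continuous[OF TG(1) TG(4)
        measurable_compose[OF aut_measurable[OF aut_inv(1)[OF fa]] lifts_measurable[OF f]]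
        measurable_compose[OF aut_measurable[OF aut_inv(1)[OF ha]] lifts_measurable[OF h]] this]
    have "conv_in_measure M TG (\<lambda>n. lift_inv (rep (F n))) (lift_inv (rep l))" unfolding lift_inv_def .
    then show "limitin lift_topology (\<lambda>n. i (F n)) (i l) sequentially"
      unfolding i_def
      using limitin_ae_class_lift_iff[where f = "\<lambda>n. lift_inv (rep (F n))", OF lift_inv_lifts[OF f] lift_inv_lifts[OF h]] by simp
  qed
  from continuous_map_compose[OF this continuous_Phi]
  have "continuous_map lift_topology RT (Phi M \<phi> \<circ> i)" .
  then have "continuous_map lift_topology RT ((\<lambda>x. inv\<^bsub>RG\<^esub> x) \<circ> Phi M \<phi>)"
  proof (rule continuous_map_eq)
    fix F assume "F \<in> topspace lift_topology"
    then have F: "F \<in> lift_classes" unfolding topspace_lift_topology .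
    note f = lift_classesE(1)[OF F]
    show "(Phi M \<phi> \<circ> i) F = ((\<lambda>x. inv\<^bsub>RG\<^esub> x) \<circ> Phi M \<phi>) F"
      using Phi_ae_class[OF lifts_measurable[OF lift_inv_lifts[OF f]]] inv_act_class[OF f] by (simp add: i_def Phi_def)
  qed
  then show ?thesis by (rule continuous_compose_quotient_map[OF quotient_map_Phi])
qed

lemma topological_group_RG: "topological_group RG RT"
  by (simp add: topological_group_def group_RG topspace_RT continuous_mult_RG continuous_inv_RG)

text \<open>The inclusion into the classes of self-maps of \<open>X\<close> with convergence in
  measure is continuous, since it is so after composition with the quotient map \<open>Phi\<close>;
  the target is metric.\<close>

lemma Hausdorff_RT: "Hausdorff_space RT"
proof (rule Hausdorff_space_injective_preimage)
  show "Hausdorff_space (L0_topology M TX dX)"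
    unfolding L0_topology_def by (rule Metric_space.Hausdorff_space_mtopology[OF Metric_space_L0[OF TX(1) dX(1)]])
  have "continuous_map lift_topology (L0_topology M TX dX) (id \<circ> Phi M \<phi>)"
  proof (rule metrizable_continuous_map_sequentially[OF metrizable_lift])
    show "(id \<circ> Phi M \<phi>) F \<in> topspace (L0_topology M TX dX)" if "F \<in> topspace lift_topology" for F
      using that Phi_Psi_L0(1) unfolding topspace_lift_topology topspace_L0_topology[OF TX(1) dX(1)] by simp
    fix F l assume "range F \<subseteq> topspace lift_topology" and lim: "limitin lift_topology F l sequentially"
    then have F: "\<And>n. F n \<in> lift_classes" and l: "l \<in> lift_classes"
      using limitin_topspace[OF lim] unfolding topspace_lift_topology by auto
    note f = lift_classesE(1)[OF F] and h = lift_classesE(1)[OF l]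
    have m: "f \<in> lifts \<Longrightarrow> act f \<in> measurable M (borel_of TX)" for f
      using aut_measurable[OF lifts_aut] by (simp add: measurable_TX)
    have c: "conv_in_measure M TG (\<lambda>n. rep (F n)) (rep l)" using limitin_lift_topology_iff[OF F l] lim by simp
    show "limitin (L0_topology M TX dX) (\<lambda>n. (id \<circ> Phi M \<phi>) (F n)) ((id \<circ> Phi M \<phi>) l) sequentially"
      using limitin_L0_ae_class_iff[where F = "\<lambda>n. act (rep (F n))", OF TX(1) dX(1) m[OF f] m[OF h]] act_conv_in_measure[OF f h c]
      by (simp add: Phi_lift[OF F] Phi_lift[OF l])
  qed
  then show "continuous_map RT (L0_topology M TX dX) id"
    by (rule continuous_compose_quotient_map[OF quotient_map_Phi])
qed simp

theorem polish_group_RG: "polish_group RG RT"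
proof -
  have img: "Phi M \<phi> ` topspace lift_topology = topspace RT"
    unfolding topspace_lift_topology topspace_RT by (rule Phi_image)
  have "completely_metrizable_space RT"
    by (rule open_image_completely_metrizable[OF completely_metrizable_lift second_countable_lift continuous_Phi open_map_Phi img
          topological_group_imp_regular_space[OF topological_group_RG] Hausdorff_RT])
  moreover have "separable_space RT"
    using second_countable_open_map_image[OF continuous_Phi open_map_Phi img second_countable_lift]
    by (rule second_countable_imp_separable_space)
  ultimately show ?thesis by (simp add: polish_group_def polish_topology_def topological_group_RG)
qed

end

context orbit_full
begin

subsection \<open>Comparison with the uniform and the weak topology\<close>

lemma carrier_RG_Aut: "carrier RG \<subseteq> Aut M"
  by (auto simp: carrier_RG orbit_full_set_def Aut_def)

lemma measurable_neq_set:
  assumes "S \<in> measurable M M" "T \<in> measurable M M"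
  shows "{x \<in> space M. S x \<noteq> T x} \<in> sets M"
proof -
  have "{x \<in> space M. S x = T x} \<in> sets M"
    using assms unfolding measurable_TX by (rule sets_Collect_eq_borel_of[OF TX(1)])
  then have "space M - {x \<in> space M. S x = T x} \<in> sets M" by (rule sets.compl_sets)
  moreover have "space M - {x \<in> space M. S x = T x} = {x \<in> space M. S x \<noteq> T x}" by auto
  ultimately show ?thesis by simp
qed

lemma Metric_space_uniform: "Metric_space (Aut M) (uniform_dist M)"
proof
  show "0 \<le> uniform_dist M C D" for C D by (simp add: uniform_dist_def)
  show "uniform_dist M C D = uniform_dist M D C" for C D by (simp add: uniform_dist_def eq_commute)
next
  fix C D assume "C \<in> Aut M" "D \<in> Aut M"
  then have C: "C \<in> L0 M M" "aut (rep C)" and D: "D \<in> L0 M M" "aut (rep D)" by (auto simp: Aut_iff)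
  have E: "{x \<in> space M. rep C x \<noteq> rep D x} \<in> sets M"
    using C D by (intro measurable_neq_set aut_measurable)
  show "uniform_dist M C D = 0 \<longleftrightarrow> C = D"
  proof
    assume "uniform_dist M C D = 0"
    then have "{x \<in> space M. rep C x \<noteq> rep D x} \<in> null_sets M"
      using E by (simp add: uniform_dist_def null_sets_def emeasure_eq_measure)
    from AE_not_in[OF this] AE_space have "AE x in M. rep C x = rep D x" by eventually_elim auto
    then show "C = D" by (rule L0_eqI[OF C(1) D(1)])
  qed (simp add: uniform_dist_def)
next
  fix C D E assume "C \<in> Aut M" "D \<in> Aut M" "E \<in> Aut M"
  then have m: "rep C \<in> measurable M M" "rep D \<in> measurable M M" "rep E \<in> measurable M M"
    by (auto simp: Aut_iff aut_measurable)
  have "uniform_dist M C E \<le> measure M ({x \<in> space M. rep C x \<noteq> rep D x} \<union> {x \<in> space M. rep D x \<noteq> rep E x})"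
    unfolding uniform_dist_def using m by (intro finite_measure_mono sets.Un measurable_neq_set) auto
  also have "\<dots> \<le> uniform_dist M C D + uniform_dist M D E"
    unfolding uniform_dist_def using m by (intro measure_Un_le measurable_neq_set)
  finally show "uniform_dist M C E \<le> uniform_dist M C D + uniform_dist M D E" .
qed

text \<open>The lift \<open>k\<close> follows \<open>h\<close> only where the two transformations
  differ and equals \<open>f\<close> elsewhere. Lifts of nearby elements can thus be chosen to
  differ on a set no larger than the uniform distance.\<close>

lemma uniform_approximation_lift:
  assumes f: "f \<in> lifts" and h: "h \<in> lifts"
  shows "\<exists>k\<in>lifts. ae_class M M (act k) = ae_class M M (act h) \<and>
    (\<forall>x\<in>space M. k x \<noteq> f x \<longrightarrow> act f x \<noteq> act h x)"
proof -
  note fm = lifts_measurable[OF f] and hm = lifts_measurable[OF h]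
  define k where "k x = (if x \<in> {x \<in> space M. act f x \<noteq> act h x} then h x else f x)" for x
  have km: "k \<in> measurable M BG"
    unfolding k_def using measurable_neq_set[OF act_measurable[OF fm] act_measurable[OF hm]]
    by (intro measurable_If_set hm fm) simp
  have kh: "AE x in M. act k x = act h x"
    using AE_space by eventually_elim (simp add: k_def)
  then have "k \<in> lifts"
    using aut_cong_AE[OF lifts_aut[OF h] act_measurable[OF km]] km by (simp add: lifts_def)
  moreover have "ae_class M M (act k) = ae_class M M (act h)"
    using ae_class_eq_iff[OF act_measurable[OF km] act_measurable[OF hm]] kh by simp
  ultimately show ?thesis by (intro bexI[of _ k]) (auto simp: k_def)
qed

text \<open>Fix a lift \<open>f\<close> of the uniform limit and give each \<open>\<sigma> n\<close>
  the lift that equals \<open>f\<close> wherever \<open>\<sigma> n\<close> and the limit agree.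
  These lifts converge to \<open>f\<close> in measure, so an open set containing the limit catches
  some \<open>\<sigma> n\<close>.\<close>

lemma uniform_finer_RT: "finer_topology (subtopology (uniform_topology M) (carrier RG)) RT"
  unfolding finer_topology_def
proof (intro conjI allI impI)
  note ms = Metric_space_uniform
  note sub = Metric_space.subspace[OF ms carrier_RG_Aut]
  have eq: "subtopology (uniform_topology M) (carrier RG) = Metric_space.mtopology (carrier RG) (uniform_dist M)"
    unfolding uniform_topology_def
    by (rule Submetric.mtopology_submetric[OF Submetric.intro[OF ms Submetric_axioms.intro[OF carrier_RG_Aut]], symmetric])
  show "topspace (subtopology (uniform_topology M) (carrier RG)) = topspace RT"
    unfolding eq topspace_RT by (rule Metric_space.topspace_mtopology[OF sub])
  fix U assume U: "openin RT U"
  have UR: "U \<subseteq> carrier RG" and Uo: "openin lift_topology {F \<in> lift_classes. Phi M \<phi> F \<in> U}"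
    using U by (simp_all add: openin_RT)
  show "openin (subtopology (uniform_topology M) (carrier RG)) U"
    unfolding eq
  proof (rule Metric_space.openin_if_sequentially[OF sub UR])
    fix \<sigma> C assume \<sigma>: "range \<sigma> \<subseteq> carrier RG - U"
      and lim: "limitin (Metric_space.mtopology (carrier RG) (uniform_dist M)) \<sigma> C sequentially"
    have CR: "C \<in> carrier RG" and null: "(\<lambda>n. uniform_dist M (\<sigma> n) C) \<longlonglongrightarrow> 0"
      using lim unfolding Metric_space.limitin_metric_dist_null[OF sub] by auto
    show "C \<notin> U"
    proof
      assume CU: "C \<in> U"
      obtain f where f: "f \<in> lifts" "C = ae_class M M (act f)" using CR by (rule RG_cases)
      have "\<forall>n. \<exists>h. h \<in> lifts \<and> \<sigma> n = ae_class M M (act h)"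
      proof
        fix n
        have "\<sigma> n \<in> carrier RG" using \<sigma> by auto
        then show "\<exists>h. h \<in> lifts \<and> \<sigma> n = ae_class M M (act h)" by (rule RG_cases) blast
      qed
      then obtain h where h: "\<And>n. h n \<in> lifts" "\<And>n. \<sigma> n = ae_class M M (act (h n))" by metis
      have "\<forall>n. \<exists>k. k \<in> lifts \<and> ae_class M M (act k) = \<sigma> n \<and>
          (\<forall>x\<in>space M. k x \<noteq> f x \<longrightarrow> act f x \<noteq> act (h n) x)"
      proof
        fix n
        show "\<exists>k. k \<in> lifts \<and> ae_class M M (act k) = \<sigma> n \<and> (\<forall>x\<in>space M. k x \<noteq> f x \<longrightarrow> act f x \<noteq> act (h n) x)"
          using uniform_approximation_lift[OF f(1) h(1)[of n]] unfolding h(2)[of n, symmetric] by (elim bexE) (rule exI, rule conjI)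
      qed
      then obtain k where k: "\<And>n. k n \<in> lifts" "\<And>n. ae_class M M (act (k n)) = \<sigma> n"
        "\<And>n x. x \<in> space M \<Longrightarrow> k n x \<noteq> f x \<Longrightarrow> act f x \<noteq> act (h n) x" by metis
      note fm = act_measurable[OF lifts_measurable[OF f(1)]]
      have hm: "act (h n) \<in> measurable M M" for n by (rule act_measurable[OF lifts_measurable[OF h(1)]])
      have ud: "uniform_dist M (\<sigma> n) C = measure M {x \<in> space M. act f x \<noteq> act (h n) x}" for n
        unfolding uniform_dist_def
      proof (rule measure_eq_AE)
        show "AE x in M. x \<in> {x \<in> space M. rep (\<sigma> n) x \<noteq> rep C x} \<longleftrightarrow> x \<in> {x \<in> space M. act f x \<noteq> act (h n) x}"
          using rep_ae_class(2)[OF fm] rep_ae_class(2)[OF hm[of n]] unfolding f(2) h(2)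
          by eventually_elim auto
        show "{x \<in> space M. rep (\<sigma> n) x \<noteq> rep C x} \<in> sets M"
          unfolding f(2) h(2) by (intro measurable_neq_set rep_ae_class(1) fm hm)
        show "{x \<in> space M. act f x \<noteq> act (h n) x} \<in> sets M" by (intro measurable_neq_set fm hm)
      qed
      have "conv_in_measure M TG k f"
        unfolding conv_in_measure_def
      proof (intro allI impI)
        fix V assume V: "openin TG V"
        have le: "measure M {x \<in> space M. f x \<in> V \<and> k n x \<notin> V} \<le> uniform_dist M (\<sigma> n) C" for n
          unfolding ud
        proof (intro finite_measure_mono measurable_neq_set fm hm subsetI)
          fix x assume x: "x \<in> {x \<in> space M. f x \<in> V \<and> k n x \<notin> V}"
          then have "k n x \<noteq> f x" by auto
          then show "x \<in> {x \<in> space M. act f x \<noteq> act (h n) x}" using k(3)[of x n] x by blast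
        qed
        show "(\<lambda>n. measure M {x \<in> space M. f x \<in> V \<and> k n x \<notin> V}) \<longlonglongrightarrow> 0"
          by (rule tendsto_sandwich[OF _ _ tendsto_const null]) (use le in \<open>auto intro!: always_eventually\<close>)
      qed
      then have "limitin lift_topology (\<lambda>n. ae_class M BG (k n)) (ae_class M BG f) sequentially"
        using limitin_ae_class_lift_iff[where f = k, OF k(1) f(1)] by simp
      moreover have "ae_class M BG f \<in> {F \<in> lift_classes. Phi M \<phi> F \<in> U}"
        using CU f ae_class_lift[OF f(1)] Phi_ae_class[OF lifts_measurable[OF f(1)]] by simp
      ultimately have "eventually (\<lambda>n. ae_class M BG (k n) \<in> {F \<in> lift_classes. Phi M \<phi> F \<in> U}) sequentially"
        by (rule limitinD[OF _ Uo])
      then obtain n where "Phi M \<phi> (ae_class M BG (k n)) \<in> U"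
        using eventually_happens' sequentially_bot by fastforce
      then have "\<sigma> n \<in> U" using Phi_ae_class[OF lifts_measurable[OF k(1)]] k(2) by simp
      then show False using \<sigma> by blast
    qed
  qed
qed

section \<open>Comparison with the weak topology\<close>

lemma measurable_image_eq:
  assumes T: "T \<in> mp_bijections M" and A: "A \<in> sets M"
  shows "T ` A = {x \<in> space M. the_inv_into (space M) T x \<in> A}"
proof
  note inv = mp_bijections_inv[OF standard T]
  have Tm: "T \<in> measurable M M" using T by (simp add: mp_bijections_def)
  show "T ` A \<subseteq> {x \<in> space M. the_inv_into (space M) T x \<in> A}"
  proof
    fix y assume "y \<in> T ` A"
    then obtain x where x: "x \<in> A" "y = T x" by blast
    then have "x \<in> space M" using sets.sets_into_space[OF A] by blast
    then show "y \<in> {x \<in> space M. the_inv_into (space M) T x \<in> A}"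
      using x inv(2) measurable_space[OF Tm] by simp
  qed
  show "{x \<in> space M. the_inv_into (space M) T x \<in> A} \<subseteq> T ` A"
  proof
    fix y assume "y \<in> {x \<in> space M. the_inv_into (space M) T x \<in> A}"
    then have "T (the_inv_into (space M) T y) = y" "the_inv_into (space M) T y \<in> A" using inv(3) by auto
    then show "y \<in> T ` A" by (metis imageI)
  qed
qed

text \<open>Images are preimages under the inverses, and weak convergence passes to inverses. The
  two one-sided differences together form the symmetric difference.\<close>

lemma image_tendsto:
  assumes S: "\<And>n. S n \<in> mp_bijections M" and R: "R \<in> mp_bijections M"
    and w: "weakly_converges M S R" and A: "A \<in> sets M"
  shows "(\<lambda>n. measure M (sym_diff (S n ` A) (R ` A))) \<longlonglongrightarrow> 0"
proof -
  define S' where "S' n = the_inv_into (space M) (S n)" for n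
  define R' where "R' = the_inv_into (space M) R"
  note invS = mp_bijections_inv[OF standard S, folded S'_def] and invR = mp_bijections_inv[OF standard R, folded R'_def]
  note mpS' = mp_bijections_mp_map[OF invS(1)] and mpR' = mp_bijections_mp_map[OF invR(1)]
  have "weakly_converges M S' R'"
    by (rule weakly_converges_inverse[OF mp_bijections_mp_map[OF S] mpS' _ mp_bijections_mp_map[OF R] mpR' _ w])
      (use invS(2) invR(2) in auto)
  from weakly_converges_sym[OF mpS' mpR' this A] this
  have lim: "(\<lambda>n. measure M {x \<in> space M. S' n x \<in> A \<and> R' x \<notin> A} + measure M {x \<in> space M. R' x \<in> A \<and> S' n x \<notin> A}) \<longlonglongrightarrow> 0 + 0"
    using A unfolding weakly_converges_def by (intro tendsto_add) auto
  have le: "measure M (sym_diff (S n ` A) (R ` A)) \<le>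
      measure M {x \<in> space M. S' n x \<in> A \<and> R' x \<notin> A} + measure M {x \<in> space M. R' x \<in> A \<and> S' n x \<notin> A}" for n
  proof -
    have "sym_diff (S n ` A) (R ` A) = {x \<in> space M. S' n x \<in> A \<and> R' x \<notin> A} \<union> {x \<in> space M. R' x \<in> A \<and> S' n x \<notin> A}"
      unfolding measurable_image_eq[OF S A] measurable_image_eq[OF R A] S'_def R'_def by auto
    then show ?thesis
      using measure_Un_le[OF exceptional_set_sets[OF mp_mapD(1)[OF mpS'] mp_mapD(1)[OF mpR'] A, of n]
          exceptional_set_sets[OF mp_mapD(1)[OF mpR'] mp_mapD(1)[OF mpS'] A, of n]] by simp
  qed
  show ?thesis
    by (rule tendsto_sandwich[OF _ _ tendsto_const lim[simplified]]) (use le in \<open>auto intro!: always_eventually\<close>)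
qed

lemma weakly_converges_cong_AE:
  assumes "\<And>n. F n \<in> measurable M M" "S \<in> measurable M M" "\<And>n. F' n \<in> measurable M M" "S' \<in> measurable M M"
    and "\<And>n. AE x in M. F n x = F' n x" "AE x in M. S x = S' x"
    and w: "weakly_converges M F S"
  shows "weakly_converges M F' S'"
  unfolding weakly_converges_def
proof
  fix A assume A: "A \<in> sets M"
  have eq: "measure M {x \<in> space M. S' x \<in> A \<and> F' n x \<notin> A} = measure M {x \<in> space M. S x \<in> A \<and> F n x \<notin> A}" for n
  proof (rule measure_eq_AE)
    show "AE x in M. x \<in> {x \<in> space M. S' x \<in> A \<and> F' n x \<notin> A} \<longleftrightarrow> x \<in> {x \<in> space M. S x \<in> A \<and> F n x \<notin> A}"
      using assms(5)[of n] assms(6) by eventually_elim auto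
  qed (intro exceptional_set_sets assms A)+
  show "(\<lambda>n. measure M {x \<in> space M. S' x \<in> A \<and> F' n x \<notin> A}) \<longlonglongrightarrow> 0"
    unfolding eq using w A unfolding weakly_converges_def by blast
qed

lemma openin_RT_weak_subbasic:
  assumes T: "T \<in> mp_bijections M" and A: "A \<in> sets M"
  shows "openin RT ({ae_class M M S | S. S \<in> mp_bijections M \<and> measure M (sym_diff (S ` A) (T ` A)) < e} \<inter> carrier RG)"
    (is "openin RT (?s \<inter> carrier RG)")
  unfolding openin_RT mtopology_lift[symmetric]
proof (intro conjI Metric_space.openin_if_sequentially[OF Metric_space_lift])
  fix F H assume F0: "range F \<subseteq> lift_classes - {F \<in> lift_classes. Phi M \<phi> F \<in> ?s \<inter> carrier RG}"
    and lim0: "limitin (Metric_space.mtopology lift_classes lift_dist) F H sequentially"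
  have F: "F n \<in> lift_classes" for n using F0 by auto
  have lim: "limitin lift_topology F H sequentially" using lim0 unfolding mtopology_lift .
  have H: "H \<in> lift_classes" using limitin_topspace[OF lim] unfolding topspace_lift_topology .
  show "H \<notin> {F \<in> lift_classes. Phi M \<phi> F \<in> ?s \<inter> carrier RG}"
  proof
    assume "H \<in> {F \<in> lift_classes. Phi M \<phi> F \<in> ?s \<inter> carrier RG}"
    then obtain R where R: "R \<in> mp_bijections M" "measure M (sym_diff (R ` A) (T ` A)) < e" "Phi M \<phi> H = ae_class M M R"
      by blast
    note f = lift_classesE(1)[OF F] and h = lift_classesE(1)[OF H]
    have bm: "S \<in> mp_bijections M \<Longrightarrow> S \<in> measurable M M" for S by (simp add: mp_bijections_def)
    have "\<forall>n. \<exists>S. S \<in> mp_bijections M \<and> (AE x in M. act (rep (F n)) x = S x)"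
      using lifts_aut[OF f] unfolding aut_def by blast
    then obtain S where S: "\<And>n. S n \<in> mp_bijections M" "\<And>n. AE x in M. act (rep (F n)) x = S n x" by metis
    have PhiF: "Phi M \<phi> (F n) = ae_class M M (S n)" for n
      unfolding Phi_def using ae_class_eq_iff[OF aut_measurable[OF lifts_aut[OF f]] bm[OF S(1)], of n n] S(2) by simp
    have hR: "AE x in M. act (rep H) x = R x"
      using R(3) unfolding Phi_def using ae_class_eq_iff[OF aut_measurable[OF lifts_aut[OF h]] bm[OF R(1)]] by simp
    have "weakly_converges M (\<lambda>n. act (rep (F n))) (act (rep H))"
      using act_weakly_converges[OF f h] limitin_lift_topology_iff[OF F H] lim by simp
    then have "weakly_converges M S R"
      by (rule weakly_converges_cong_AE[rotated 6])
        (use aut_measurable[OF lifts_aut[OF f]] aut_measurable[OF lifts_aut[OF h]] bm S R(1) hR in auto)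
    from image_tendsto[OF S(1) R(1) this A]
    have "(\<lambda>n. measure M (sym_diff (S n ` A) (R ` A))) \<longlonglongrightarrow> 0" .
    \<comment> \<open>The slack left by the strict inequality at the limit \<open>R\<close> absorbs
      the distance from \<open>S n\<close> to \<open>R\<close> in the triangle inequality for
      symmetric differences.\<close>
    then have "eventually (\<lambda>n. measure M (sym_diff (S n ` A) (R ` A)) < e - measure M (sym_diff (R ` A) (T ` A))) sequentially"
      using R(2) by (intro order_tendstoD(2)) auto
    then obtain n where n: "measure M (sym_diff (S n ` A) (R ` A)) < e - measure M (sym_diff (R ` A) (T ` A))"
      by (auto simp: eventually_sequentially)
    have im: "Q ` A \<in> sets M" if "Q \<in> mp_bijections M" for Q
      using standard_borel_bij_image[OF standard _ _ A, of Q] that by (simp add: mp_bijections_def)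
    have sd: "sym_diff (P ` A) (Q ` A) \<in> sets M" if "P \<in> mp_bijections M" "Q \<in> mp_bijections M" for P Q
      using im[OF that(1)] im[OF that(2)] by blast
    have "measure M (sym_diff (S n ` A) (T ` A)) \<le> measure M (sym_diff (S n ` A) (R ` A) \<union> sym_diff (R ` A) (T ` A))"
      by (intro finite_measure_mono sets.Un[OF sd[OF S(1) R(1)] sd[OF R(1) T]]) blast
    also have "\<dots> \<le> measure M (sym_diff (S n ` A) (R ` A)) + measure M (sym_diff (R ` A) (T ` A))"
      by (rule measure_Un_le[OF sd[OF S(1) R(1)] sd[OF R(1) T]])
    finally have "Phi M \<phi> (F n) \<in> ?s" using n S(1) PhiF by auto
    moreover have "Phi M \<phi> (F n) \<in> carrier RG" using F Phi_image by blast
    ultimately show False using F0 F by blast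
  qed
qed auto

lemma RT_finer_weak: "finer_topology RT (subtopology (weak_topology M) (carrier RG))"
proof -
  define \<S> where "\<S> = {{ae_class M M S | S. S \<in> mp_bijections M \<and> measure M (sym_diff (S ` A) (T ` A)) < e}
      | T A e. T \<in> mp_bijections M \<and> A \<in> sets M \<and> e > 0}"
  have W: "weak_topology M = topology_generated_by \<S>" by (simp add: weak_topology_def \<S>_def)
  have "carrier RG \<subseteq> \<Union>\<S>"
  proof
    fix C assume "C \<in> carrier RG"
    then obtain T where T: "T \<in> mp_bijections M" "C = ae_class M M T" using carrier_RG_Aut by (auto simp: Aut_def)
    \<comment> \<open>The empty test set imposes no condition, so the subbasic sets cover the
      carrier and the underlying sets of the two topologies agree.\<close>
    have "{ae_class M M S | S. S \<in> mp_bijections M \<and> measure M (sym_diff (S ` {}) (T ` {})) < 1} \<in> \<S>"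
      unfolding \<S>_def using T(1) by (intro CollectI exI[of _ T] exI[of _ "{}"] exI[of _ 1]) auto
    moreover have "C \<in> {ae_class M M S | S. S \<in> mp_bijections M \<and> measure M (sym_diff (S ` {}) (T ` {})) < 1}"
      using T by auto
    ultimately show "C \<in> \<Union>\<S>" by blast
  qed
  then have top: "topspace RT = topspace (subtopology (weak_topology M) (carrier RG))"
    unfolding topspace_RT W by (auto simp: topology_generated_by_topspace)
  have gen: "openin RT (U \<inter> carrier RG)" if "generate_topology_on \<S> U" for U
    using that
  proof induction
    case (Int a b)
    have "a \<inter> b \<inter> carrier RG = (a \<inter> carrier RG) \<inter> (b \<inter> carrier RG)" by auto
    then show ?case using openin_Int[OF Int.IH] by simp
  next
    case (UN K)
    have "openin RT (\<Union>((\<lambda>k. k \<inter> carrier RG) ` K))" using UN.IH by (intro openin_Union) auto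
    moreover have "\<Union>((\<lambda>k. k \<inter> carrier RG) ` K) = \<Union>K \<inter> carrier RG" by auto
    ultimately show ?case by simp
  next
    case (Basis s)
    then show ?case unfolding \<S>_def using openin_RT_weak_subbasic by blast
  qed simp
  then show ?thesis
    unfolding finer_topology_def using top by (auto simp: W openin_subtopology openin_topology_generated_by_iff)
qed

subsection \<open>Embedding of the acting group\<close>

lemma const_lifts:
  assumes mp: "measure_preserving_action G M \<phi>" and g: "g \<in> carrier G"
  shows "(\<lambda>x. g) \<in> lifts"
proof -
  have m: "(\<lambda>x. g) \<in> measurable M BG" using g by (simp add: TG(2))
  have "\<phi> g \<in> measurable M M" using act_measurable[OF m] by simp
  moreover have "bij_betw (\<phi> g) (space M) (space M)" using bij_prop0[OF g] by (simp add: Bij_def)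
  moreover have "distr M M (\<phi> g) = M" using mp g by (simp add: measure_preserving_action_def)
  ultimately have "aut (\<phi> g)" by (intro mp_bijections_aut) (simp add: mp_bijections_def)
  then show ?thesis using m by (simp add: lifts_def)
qed

text \<open>For constant maps the exceptional sets have measure \<open>0\<close> or
  \<open>1\<close>, so convergence in measure is convergence in \<open>G\<close>. Both spaces are
  metrizable, and sequences decide continuity in both directions.\<close>

lemma const_embedding:
  assumes mp: "measure_preserving_action G M \<phi>"
  shows "embedding_map TG lift_topology (\<lambda>g. ae_class M BG (\<lambda>x. g))"
proof -
  define c where "c g = ae_class M BG (\<lambda>x. g)" for g
  note l = const_lifts[OF mp]
  have conv_iff: "conv_in_measure M TG (\<lambda>n x. \<sigma> n) (\<lambda>x. g) \<longleftrightarrow> limitin TG \<sigma> g sequentially"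
    if g: "g \<in> carrier G" for \<sigma> g
  proof -
    have "(\<lambda>n. measure M {x \<in> space M. g \<in> U \<and> \<sigma> n \<notin> U}) \<longlonglongrightarrow> 0 \<longleftrightarrow> (g \<in> U \<longrightarrow> eventually (\<lambda>n. \<sigma> n \<in> U) sequentially)"
      for U
    proof -
      have m: "measure M {x \<in> space M. g \<in> U \<and> \<sigma> n \<notin> U} = (if g \<in> U \<and> \<sigma> n \<notin> U then 1 else 0)" for n
        using prob_space by (cases "g \<in> U"; cases "\<sigma> n \<in> U") simp_all
      show ?thesis
        unfolding m
      proof
        assume "(\<lambda>n. if g \<in> U \<and> \<sigma> n \<notin> U then 1 else 0 :: real) \<longlonglongrightarrow> 0"
        then have "eventually (\<lambda>n. (if g \<in> U \<and> \<sigma> n \<notin> U then 1 else 0 :: real) < 1) sequentially"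
          by (intro order_tendstoD(2)) auto
        then show "g \<in> U \<longrightarrow> eventually (\<lambda>n. \<sigma> n \<in> U) sequentially"
          by (auto elim: eventually_mono split: if_splits)
      next
        assume *: "g \<in> U \<longrightarrow> eventually (\<lambda>n. \<sigma> n \<in> U) sequentially"
        have "eventually (\<lambda>n. (if g \<in> U \<and> \<sigma> n \<notin> U then 1 else 0 :: real) = 0) sequentially"
        proof (cases "g \<in> U")
          case True
          then have "eventually (\<lambda>n. \<sigma> n \<in> U) sequentially" using * by blast
          then show ?thesis by eventually_elim simp
        qed simp
        then show "(\<lambda>n. if g \<in> U \<and> \<sigma> n \<notin> U then 1 else 0 :: real) \<longlonglongrightarrow> 0"
          by (rule tendsto_eventually)
      qed
    qed
    then show ?thesis unfolding conv_in_measure_def limitin_def using g TG(2) by auto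
  qed
  have inj: "inj_on c (carrier G)"
  proof (rule inj_onI)
    fix g h assume gh: "g \<in> carrier G" "h \<in> carrier G" "c g = c h"
    then have "AE x in M. g = h"
      using ae_class_eq_iff[OF lifts_measurable[OF l] lifts_measurable[OF l]] by (simp add: c_def)
    then show "g = h" using AE_E_prob by fastforce
  qed
  have c_cont: "continuous_map TG lift_topology c"
  proof (rule metrizable_continuous_map_sequentially)
    show "metrizable_space TG" using TG_cm by (rule completely_metrizable_imp_metrizable_space)
    show "c g \<in> topspace lift_topology" if "g \<in> topspace TG" for g
      unfolding topspace_lift_topology using that ae_class_lift[OF l] TG(2) by (simp add: c_def)
    fix \<sigma> g assume "range \<sigma> \<subseteq> topspace TG" and lim: "limitin TG \<sigma> g sequentially"
    then have \<sigma>: "\<And>n. \<sigma> n \<in> carrier G" and g: "g \<in> carrier G" using limitin_topspace[OF lim] TG(2) by auto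
    show "limitin lift_topology (\<lambda>n. c (\<sigma> n)) (c g) sequentially"
      using limitin_ae_class_lift_iff[where f = "\<lambda>n x. \<sigma> n", OF l[OF \<sigma>] l[OF g]] conv_iff[OF g] lim
      by (simp add: c_def)
  qed
  define S where "S = subtopology lift_topology (c ` carrier G)"
  have cL: "c ` carrier G \<subseteq> lift_classes" using ae_class_lift[OF l] by (auto simp: c_def)
  have topS: "topspace S = c ` carrier G"
    unfolding S_def topspace_subtopology[of lift_topology] topspace_lift_topology using cL by blast
  have inv_cont: "continuous_map S TG (inv_into (carrier G) c)"
  proof (rule metrizable_continuous_map_sequentially)
    show "metrizable_space S" unfolding S_def by (rule metrizable_space_subtopology[OF metrizable_lift])
    show "inv_into (carrier G) c F \<in> topspace TG" if "F \<in> topspace S" for F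
      using that unfolding topS TG(2) by (rule inv_into_into)
    fix F H assume F: "range F \<subseteq> topspace S" and lim: "limitin S F H sequentially"
    have "H \<in> c ` carrier G" using limitin_topspace[OF lim] topS by simp
    then obtain g where g: "g \<in> carrier G" "H = c g" by blast
    have "\<forall>n. \<exists>k. k \<in> carrier G \<and> F n = c k" 
    proof
      fix n
      have "F n \<in> c ` carrier G" using F topS by auto
      then show "\<exists>k. k \<in> carrier G \<and> F n = c k" by blast
    qed
    then obtain \<sigma> where \<sigma>: "\<And>n. \<sigma> n \<in> carrier G" "\<And>n. F n = c (\<sigma> n)" by metis
    have "limitin lift_topology (\<lambda>n. c (\<sigma> n)) (c g) sequentially"
      using lim unfolding S_def limitin_subtopology[of lift_topology] g(2) \<sigma>(2) by blast
    then have "limitin TG \<sigma> g sequentially"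
      using limitin_ae_class_lift_iff[where f = "\<lambda>n x. \<sigma> n", OF l[OF \<sigma>(1)] l[OF g(1)]] conv_iff[OF g(1)]
      by (simp add: c_def)
    then show "limitin TG (\<lambda>n. inv_into (carrier G) c (F n)) (inv_into (carrier G) c H) sequentially"
      unfolding \<sigma>(2) g(2) inv_into_f_f[OF inj \<sigma>(1)] inv_into_f_f[OF inj g(1)] .
  qed
  have "continuous_map TG S c"
    unfolding S_def using c_cont TG(2) by (simp add: continuous_map_in_subtopology)
  then have "homeomorphic_maps TG S c (inv_into (carrier G) c)"
    unfolding homeomorphic_maps_def topS TG(2) using inv_cont inv_into_f_f[OF inj] f_inv_into_f[of _ c "carrier G"] by blast
  then have "embedding_map TG lift_topology c"
    unfolding embedding_map_def homeomorphic_map_maps TG(2) S_def by blast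
  then show ?thesis unfolding c_def .
qed

text \<open>Two lifts with the same image differ by elements of stabilizers, and these are trivial
  at almost every point of an essentially free action.\<close>

lemma free_Phi_inj:
  assumes free: "essentially_free G M \<phi>"
  shows "inj_on (Phi M \<phi>) lift_classes"
proof (rule inj_onI)
  fix F H assume FH: "F \<in> lift_classes" "H \<in> lift_classes" "Phi M \<phi> F = Phi M \<phi> H"
  obtain A where A: "A \<subseteq> space M" "AE x in M. x \<in> A" "\<And>g x. g \<in> carrier G \<Longrightarrow> g \<noteq> \<one> \<Longrightarrow> x \<in> A \<Longrightarrow> \<phi> g x \<noteq> x"
    using free unfolding essentially_free_def by (metis DiffI singletonD)
  note f = lifts_measurable[OF lift_classesE(1)[OF FH(1)]] and h = lifts_measurable[OF lift_classesE(1)[OF FH(2)]]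
  have "AE x in M. act (rep F) x = act (rep H) x"
    using FH(3) ae_class_eq_iff[OF act_measurable[OF f] act_measurable[OF h]] by (simp add: Phi_def)
  then have "AE x in M. rep F x = rep H x"
    using A(2) AE_space
  proof eventually_elim
    case (elim x)
    note fx = BG_carrier[OF f elim(3)] and hx = BG_carrier[OF h elim(3)]
    have "\<phi> (inv (rep H x) \<otimes> rep F x) x = x"
      using composition_rule[OF elim(3) inv_closed[OF hx] fx] orbit_sym_aux[OF hx elim(3) elim(1)[symmetric]] by simp
    then have "inv (rep H x) \<otimes> rep F x = \<one>"
      using A(3)[of "inv (rep H x) \<otimes> rep F x" x] elim(2) m_closed[OF inv_closed[OF hx] fx] by blast
    then show ?case using fx hx by (metis inv_closed inv_equality inv_inv)
  qed
  then show "F = H" by (rule L0_eqI[OF lift_classesE(3)[OF FH(1)] lift_classesE(3)[OF FH(2)]])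
qed

text \<open>Essential freeness makes the open continuous map \<open>Phi\<close> injective, hence an
  embedding. Measure preservation makes the constant maps lifts, and the two embeddings are
  composed.\<close>

lemma group_embedding:
  assumes free: "essentially_free G M \<phi>" and mp: "measure_preserving_action G M \<phi>"
  shows "\<exists>\<iota>. topological_group_embedding G TG RG RT \<iota>"
proof -
  define \<iota> where "\<iota> = Phi M \<phi> \<circ> (\<lambda>g. ae_class M BG (\<lambda>x. g))"
  note l = const_lifts[OF mp]
  have \<iota>: "\<iota> g = ae_class M M (\<phi> g)" if "g \<in> carrier G" for g
    using Phi_ae_class[OF lifts_measurable[OF l[OF that]]] by (simp add: \<iota>_def)
  have "embedding_map TG RT \<iota>"
    unfolding \<iota>_def using const_embedding[OF mp]
  proof (rule embedding_map_compose)
    show "embedding_map lift_topology RT (Phi M \<phi>)"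
      by (rule injective_open_imp_embedding_map[OF continuous_Phi open_map_Phi])
        (use free_Phi_inj[OF free] in \<open>simp only: topspace_lift_topology\<close>)
  qed
  moreover have "\<iota> \<in> hom G RG"
  proof (rule homI)
    show "\<iota> g \<in> carrier RG" if "g \<in> carrier G" for g
      using act_class_RG[OF l[OF that]] \<iota>[OF that] by simp
    fix g h assume gh: "g \<in> carrier G" "h \<in> carrier G"
    have a: "aut (\<phi> k)" if "k \<in> carrier G" for k using lifts_aut[OF l[OF that]] by simp
    have "AE x in M. \<phi> (g \<otimes> h) x = \<phi> g (\<phi> h x)"
      using AE_space by eventually_elim (simp add: composition_rule gh)
    then show "\<iota> (g \<otimes> h) = \<iota> g \<otimes>\<^bsub>RG\<^esub> \<iota> h"
      unfolding \<iota>[OF gh(1)] \<iota>[OF gh(2)] \<iota>[OF m_closed[OF gh]] mult_ae_class[OF a[OF gh(1)] a[OF gh(2)]]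
      using ae_class_eq_iff[OF aut_measurable[OF a[OF m_closed[OF gh]]] aut_measurable[OF aut_compose[OF a[OF gh(1)] a[OF gh(2)]]]]
      by simp
  qed
  ultimately show ?thesis unfolding topological_group_embedding_def by blast
qed

end

theorem theorem3p17:
  fixes G :: "('g, 'm) monoid_scheme" and TG :: "'g topology" and d :: "'g \<Rightarrow> 'g \<Rightarrow> real"
    and M :: "'x measure" and \<phi> :: "'g \<Rightarrow> 'x \<Rightarrow> 'x"
  assumes "polish_group G TG"
    and "compatible_bounded_metric TG d"
    and "standard_prob_space M"
    and "borel_action G TG M \<phi>"
  shows "polish_group (orbit_full_group G M \<phi>) (orbit_full_topology G TG d M \<phi>)
    \<and> finer_topology (subtopology (uniform_topology M) (orbit_full_set G M \<phi>))
        (orbit_full_topology G TG d M \<phi>)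
    \<and> finer_topology (orbit_full_topology G TG d M \<phi>)
        (subtopology (weak_topology M) (orbit_full_set G M \<phi>))
    \<and> (essentially_free G M \<phi> \<and> measure_preserving_action G M \<phi> \<longrightarrow>
        (\<exists>\<iota>. topological_group_embedding G TG (orbit_full_group G M \<phi>)
               (orbit_full_topology G TG d M \<phi>) \<iota>))"
proof -
  have std: "standard_borel M" and "prob_space M" using assms(3) by (auto simp: standard_prob_space_def)
  obtain TX where TX: "polish_topology TX" "topspace TX = space M" "sets M = sets (borel_of TX)"
    using std by (auto simp: standard_borel_def)
  obtain dX where dX: "compatible_bounded_metric TX dX" "Metric_space.mcomplete (topspace TX) dX"
    using polish_bounded_complete_metric[OF TX(1)] by blast
  have "polish_topology TG" using assms(1) by (simp add: polish_group_def)
  then obtain dG where dG: "compatible_bounded_metric TG dG" "Metric_space.mcomplete (topspace TG) dG"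
    using polish_bounded_complete_metric by blast
  interpret orbit_full G TG M \<phi> d dG TX dX
    by (intro orbit_full.intro polish_borel_action.intro orbit_full_axioms.intro) fact+
  show ?thesis
    using polish_group_RG uniform_finer_RT RT_finer_weak group_embedding by (simp add: carrier_RG)
qed

end
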